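(* Let $G=U(n)$ or $G=SO(n)$, with Lie algebra $\mathcal{G}=u(n)$ (resp. $so(n)$). Let $\|\cdot\|$ be a unitarily invariant norm on $M(n)$ and let $\rho$ be the intrinsic metric on $G$ induced by $\|\cdot\|$. Then: (a) Cosets of one-parameter semigroups, i.e. curves of the form $\gamma(t)=ue^{tx}$ with $u\in G$, $x\in\mathcal{G}$, are geodesics in $(G,\rho)$. (b) If $\|\cdot\|$ is strictly convex (which happens in particular if $\|\cdot\|=\|\cdot\|_p$ is the Schatten $C_p$-norm for some $p\in(1,\infty)$), then all geodesics in $(G,\rho)$ are, up to a change of parameter, of the form given in (a) (or arcs of curves of such form). (c) If, furthermore (i.e. with $\|\cdot\|$ strictly convex), $u,v\in G$ are such that the spectrum of $u^{-1}v$ does not contain $-1$, then the curve of shortest length (geodesic arc) connecting $u$ and $v$ is unique (up to a change of parameter).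
   Context: $M(n)$ is the algebra of $n\times n$ matrices, complex if $G=U(n)$ and real if $G=SO(n)$; $\mathcal{G}\subset M(n)$ is the space of skew-Hermitian (resp. real skew-symmetric) matrices. A unitarily invariant norm on $M(n)$ is a norm with $\|uxv\|=\|x\|$ for all $x\in M(n)$, $u,v\in G$, associated with a symmetric norm on $\mathbf{R}^n$ (also written $\|\cdot\|$) via $\|x\|=\|(s_k(x))_{k=1}^n\|$, where $s_1(x),\dots,s_n(x)$ are the singular numbers of $x$. The Schatten $C_p$-norm is $\|x\|_p=(\mathrm{tr}\,|x|^p)^{1/p}$. A norm is strictly convex if its unit sphere $\{x:\|x\|=1\}$ does not contain a (nondegenerate) segment. The length of an absolutely continuous curve $\gamma:[a,b]\to G\subset M(n)$ is $\ell(\gamma)=\int_a^b\|\gamma'(t)\|\,dt$, and the intrinsic metric is $\rho(u,v)=\inf\ell(\gamma)$ over absolutely continuous curves $\gamma$ in $G$ connecting $u$ and $v$. A curve in $G$ is a geodesic if it locally realizes the distance $\rho$ between its points (i.e., sufficiently short arcs of it have length equal to the $\rho$-distance between their endpoints). *)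

theory Defs
  imports "HOL-Analysis.Analysis" "HOL-Computational_Algebra.Computational_Algebra"
begin

section \<open>Matrices\<close>

definition adj :: "complex^'n^'m \<Rightarrow> complex^'m^'n" where
  "adj x = transpose (map_matrix cnj x)"

definition complexify :: "real^'n^'m \<Rightarrow> complex^'n^'m" where
  "complexify x = map_matrix complex_of_real x"

definition unitary_group :: "(complex^'n^'n) set" where
  "unitary_group = {u. adj u ** u = mat 1 \<and> u ** adj u = mat 1}"

definition skew_hermitian :: "(complex^'n^'n) set" where
  "skew_hermitian = {x. adj x = - x}"

definition special_orthogonal_group :: "(real^'n^'n) set" where
  "special_orthogonal_group = {u. rotation_matrix u}"

definition skew_symmetric :: "(real^'n^'n) set" where
  "skew_symmetric = {x. transpose x = - x}"

text \<open>The type class product on \<^typ>\<open>'a^'n^'n\<close> is componentwise, so the library's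
  \<^const>\<open>power\<close> and \<^const>\<open>exp\<close> are not the matrix operations.\<close>

primrec matrix_pow :: "'a::real_normed_field^'n^'n \<Rightarrow> nat \<Rightarrow> 'a^'n^'n" where
  "matrix_pow x 0 = mat 1"
| "matrix_pow x (Suc k) = x ** matrix_pow x k"

definition matrix_exp :: "'a::real_normed_field^'n^'n \<Rightarrow> 'a^'n^'n" where
  "matrix_exp x = (\<Sum>k. matrix_pow x k /\<^sub>R fact k)"

definition matrix_spectrum :: "complex^'n^'n \<Rightarrow> complex set" where
  "matrix_spectrum x = {c. \<not> invertible (x - mat c)}"

definition charpoly :: "complex^'n^'n \<Rightarrow> complex poly" where
  "charpoly x = det (mat [:0, 1:] - map_matrix (\<lambda>c. [:c:]) x)"

text \<open>The inner product on \<^typ>\<open>complex^'n\<close> is the real part of the Hermitian one, which for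
  Hermitian \<open>y\<close> is no loss in the form \<open>w \<bullet> (y *v w)\<close>.\<close>

definition positive_semidef :: "complex^'n^'n \<Rightarrow> bool" where
  "positive_semidef y \<longleftrightarrow> adj y = y \<and> (\<forall>w. 0 \<le> w \<bullet> (y *v w))"

definition matrix_abs :: "complex^'n^'n \<Rightarrow> complex^'n^'n" where
  "matrix_abs x = (THE y. positive_semidef y \<and> y ** y = adj x ** x)"

definition diag :: "real^'n \<Rightarrow> complex^'n^'n" where
  "diag d = (\<chi> i j. if i = j then complex_of_real (d $ i) else 0)"

text \<open>Functional calculus \<open>t \<mapsto> t powr p\<close>, for positive semidefinite \<open>y\<close> only.\<close>

definition matrix_powr :: "complex^'n^'n \<Rightarrow> real \<Rightarrow> complex^'n^'n" where
  "matrix_powr y p =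
    (THE z. \<exists>u\<in>unitary_group. \<exists>d. (\<forall>i. 0 \<le> d $ i) \<and>
       y = u ** diag d ** adj u \<and> z = u ** diag (\<chi> i. d $ i powr p) ** adj u)"

text \<open>Eigenvalues of \<open>|x|\<close> with algebraic multiplicity. A multiset of size \<open>n\<close> carries the same
  information as the decreasing sequence of singular numbers. For a real matrix \<open>x\<close> one uses
  \<open>complexify x\<close>, which has the same singular numbers.\<close>

definition singular_numbers :: "complex^'n^'n \<Rightarrow> real multiset" where
  "singular_numbers x = image_mset Re (proots (charpoly (matrix_abs x)))"

definition schatten_norm :: "real \<Rightarrow> complex^'n^'n \<Rightarrow> real" where
  "schatten_norm p x = Re (trace (matrix_powr (matrix_abs x) p)) powr (1 / p)"


section \<open>Norms\<close>

definition is_norm :: "('k::real_normed_field \<Rightarrow> 'v::ab_group_add \<Rightarrow> 'v) \<Rightarrow> ('v \<Rightarrow> real) \<Rightarrow> bool" where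
  "is_norm smul N \<longleftrightarrow>
    (\<forall>x. 0 \<le> N x) \<and> (\<forall>x. N x = 0 \<longleftrightarrow> x = 0) \<and>
    (\<forall>c x. N (smul c x) = norm c * N x) \<and> (\<forall>x y. N (x + y) \<le> N x + N y)"

definition symmetric_norm :: "(real^'n \<Rightarrow> real) \<Rightarrow> bool" where
  "symmetric_norm \<Phi> \<longleftrightarrow> is_norm (*\<^sub>R) \<Phi> \<and>
    (\<forall>\<pi> s. bij \<pi> \<longrightarrow> \<Phi> (\<chi> i. s $ \<pi> i) = \<Phi> s) \<and>
    (\<forall>\<epsilon> s. (\<forall>i. \<epsilon> i \<in> {1, -1}) \<longrightarrow> \<Phi> (\<chi> i. \<epsilon> i * s $ i) = \<Phi> s)"

text \<open>\<open>sing\<close> assigns to a matrix its multiset of singular numbers; by symmetry of \<open>\<Phi>\<close> the order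
  in which a vector \<open>s\<close> lists them is irrelevant.\<close>

definition unitarily_invariant_norm ::
  "('a::real_normed_field^'n^'n) set \<Rightarrow> ('a^'n^'n \<Rightarrow> real multiset) \<Rightarrow> ('a^'n^'n \<Rightarrow> real) \<Rightarrow> bool" where
  "unitarily_invariant_norm G sing N \<longleftrightarrow>
    is_norm (\<lambda>c. map_matrix ((*) c)) N \<and>
    (\<forall>u\<in>G. \<forall>v\<in>G. \<forall>x. N (u ** x ** v) = N x) \<and>
    (\<exists>\<Phi>::real^'n \<Rightarrow> real. symmetric_norm \<Phi> \<and>
       (\<forall>x s. image_mset (($) s) (mset_set UNIV) = sing x \<longrightarrow> N x = \<Phi> s))"

definition strictly_convex_norm :: "('v::real_vector \<Rightarrow> real) \<Rightarrow> bool" where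
  "strictly_convex_norm N \<longleftrightarrow> \<not> (\<exists>x y. x \<noteq> y \<and> closed_segment x y \<subseteq> {z. N z = 1})"


section \<open>Curves and the intrinsic metric\<close>

text \<open>Absolute continuity and differentiability refer to the standard topology; all norms on a
  finite-dimensional space give the same notion.\<close>

definition abs_continuous :: "real \<Rightarrow> real \<Rightarrow> (real \<Rightarrow> 'v::real_normed_vector) \<Rightarrow> bool" where
  "abs_continuous a b \<gamma> \<longleftrightarrow>
    (\<forall>\<epsilon>>0. \<exists>\<delta>>0. \<forall>(m::nat) s t.
       (\<forall>k<m. a \<le> s k \<and> s k \<le> t k \<and> t k \<le> b) \<and>
       (\<forall>j<m. \<forall>k<m. j \<noteq> k \<longrightarrow> {s j<..<t j} \<inter> {s k<..<t k} = {}) \<and>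
       (\<Sum>k<m. t k - s k) < \<delta> \<longrightarrow>
       (\<Sum>k<m. norm (\<gamma> (t k) - \<gamma> (s k))) < \<epsilon>)"

definition curve_length :: "('v::real_normed_vector \<Rightarrow> real) \<Rightarrow> real \<Rightarrow> real \<Rightarrow> (real \<Rightarrow> 'v) \<Rightarrow> real" where
  "curve_length N a b \<gamma> = integral {a..b} (\<lambda>t. N (vector_derivative \<gamma> (at t)))"

definition connecting_curve ::
  "'v::real_normed_vector set \<Rightarrow> 'v \<Rightarrow> 'v \<Rightarrow> real \<Rightarrow> real \<Rightarrow> (real \<Rightarrow> 'v) \<Rightarrow> bool" where
  "connecting_curve G u v a b \<gamma> \<longleftrightarrow>
    a \<le> b \<and> abs_continuous a b \<gamma> \<and> \<gamma> ` {a..b} \<subseteq> G \<and> \<gamma> a = u \<and> \<gamma> b = v"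

definition intrinsic_dist ::
  "'v::real_normed_vector set \<Rightarrow> ('v \<Rightarrow> real) \<Rightarrow> 'v \<Rightarrow> 'v \<Rightarrow> real" where
  "intrinsic_dist G N u v = Inf {curve_length N a b \<gamma> |a b \<gamma>. connecting_curve G u v a b \<gamma>}"

definition shortest_curve ::
  "'v::real_normed_vector set \<Rightarrow> ('v \<Rightarrow> real) \<Rightarrow> 'v \<Rightarrow> 'v \<Rightarrow> real \<Rightarrow> real \<Rightarrow> (real \<Rightarrow> 'v) \<Rightarrow> bool" where
  "shortest_curve G N u v a b \<gamma> \<longleftrightarrow>
    connecting_curve G u v a b \<gamma> \<and> curve_length N a b \<gamma> = intrinsic_dist G N u v"

text \<open>Shortness of an arc is measured by its length, not by its parameter interval: otherwise a
  curve could turn a corner while standing still. On a compact interval the radius \<open>\<epsilon>\<close> may be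
  chosen independently of \<open>t\<close>.\<close>

definition geodesic ::
  "'v::real_normed_vector set \<Rightarrow> ('v \<Rightarrow> real) \<Rightarrow> real set \<Rightarrow> (real \<Rightarrow> 'v) \<Rightarrow> bool" where
  "geodesic G N I \<gamma> \<longleftrightarrow>
    is_interval I \<and> \<gamma> ` I \<subseteq> G \<and>
    (\<forall>a\<in>I. \<forall>b\<in>I. a \<le> b \<longrightarrow> abs_continuous a b \<gamma>) \<and>
    (\<forall>t\<in>I. \<exists>\<epsilon>>0. \<forall>a\<in>I. \<forall>b\<in>I. a \<le> t \<and> t \<le> b \<and> curve_length N a b \<gamma> < \<epsilon> \<longrightarrow>
       curve_length N a b \<gamma> = intrinsic_dist G N (\<gamma> a) (\<gamma> b))"

text \<open>Changes of parameter are nondecreasing rather than strictly increasing, since absolutely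
  continuous curves may be constant on subintervals. Both curves factor through a common
  curve \<open>\<sigma>\<close> on \<open>{p..q}\<close>.\<close>

definition same_up_to_parameter ::
  "real \<Rightarrow> real \<Rightarrow> (real \<Rightarrow> 'v) \<Rightarrow> real \<Rightarrow> real \<Rightarrow> (real \<Rightarrow> 'v) \<Rightarrow> bool" where
  "same_up_to_parameter a b \<gamma> c d \<eta> \<longleftrightarrow>
    (\<exists>(p::real) q \<sigma> \<phi> \<psi>.
       continuous_on {a..b} \<phi> \<and> mono_on {a..b} \<phi> \<and> \<phi> ` {a..b} = {p..q} \<and>
       continuous_on {c..d} \<psi> \<and> mono_on {c..d} \<psi> \<and> \<psi> ` {c..d} = {p..q} \<and>
       (\<forall>t\<in>{a..b}. \<gamma> t = \<sigma> (\<phi> t)) \<and> (\<forall>t\<in>{c..d}. \<eta> t = \<sigma> (\<psi> t)))"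

end

theory Submission
  imports Defs
begin

text \<open>Diagonalise \<open>u\<^sup>-\<^sup>1 v = w e\<^bsup>i\<theta>\<^esup> w\<^sup>*\<close> with all \<open>\<theta>\<^sub>k\<close> in \<open>[-\<pi>, \<pi>]\<close>. For nonnegative weights
  \<open>a\<close>, the largest value of \<open>\<Sum>\<^sub>k a\<^sub>k |\<theta>\<^sub>k|\<close> over all such diagonalisations of a unitary \<open>g\<close> grows along a
  curve no faster than the norm \<open>sup {\<Sum>\<^sub>k a\<^sub>k Re (p m q)\<^sub>k\<^sub>k | p, q unitary}\<close> of the velocity \<open>m\<close>; this
  follows from a rearrangement inequality for doubly stochastic matrices. If \<open>a\<close> is a norming functional
  of \<open>|\<theta>|\<close> for the symmetric norm \<open>\<Phi>\<close>, then this norm is at most \<open>N\<close>, whence every curve from \<open>u\<close> to \<open>v\<close>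
  has length at least \<open>\<Phi>(\<theta>)\<close>, the length of \<open>t \<mapsto> u w e\<^bsup>i t \<theta>\<^esup> w\<^sup>*\<close>.

  If \<open>\<Phi>\<close> is strictly convex, equality forces the singular numbers of the velocity to be proportional
  to \<open>|\<theta>|\<close> at almost every time, so a shortest curve for \<open>N\<close> is also shortest for the Frobenius norm.
  When \<open>|\<theta>\<^sub>k| < \<pi>\<close> for all \<open>k\<close>, the columns of such a curve run along great circles in the sphere of
  \<open>\<complex>\<^sup>n\<close>, and the curve is determined. Geodesics are then glued from short pieces.\<close>


text \<open>Eigenvalues cannot be followed differentiably through crossings, and |\<theta>| has a
  kink at the cut point -1. Only upper estimates of growth are needed, however, and at -1 the kink
  is a maximum, so a one-sided first-order inequality holds at every unitary matrix. A fixed weight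
  vector \<open>a\<close> is used because a linear functional of |\<theta>| can be averaged against
  doubly stochastic weights; \<Phi> returns only through the choice of \<open>a\<close> for the
  endpoint.

  In the equality case the singular numbers of the velocity are known only up to order, and the
  order may vary with time. The Euclidean norm forgets the order; this is why rigidity is extracted
  from Frobenius geometry and not from \<open>N\<close> itself.

  Both groups are treated at once through an embedding into complex matrices. For SO(n) the point to
  check is that logarithms with angles inside (-\<pi>, \<pi>) are real. Curves are merely absolutely
  continuous, so lengths rest on the fundamental theorem of calculus almost everywhere. Since such
  curves may stand still, geodesics are glued along arc length and not along the parameter.\<close>

no_notation fps_nth (infixl "$" 75) \<comment> \<open>keeps \<open>$\<close> unambiguous for vectors\<close>

section \<open>Differentiation of absolutely continuous curves\<close>

lemma cball_midpoint_real:
  fixes x y :: real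
  shows "cball ((x + y) / 2) (\<bar>y - x\<bar> / 2) = {min x y..max x y}"
  by (auto simp: dist_real_def abs_if min_def max_def field_simps split: if_splits)

text \<open>Vitali's theorem covers the set where the difference quotients deviate by at least \<open>e\<close>;
  Henstock's lemma bounds the total length of the covering intervals.\<close>

lemma negligible_bad_difference_quotients:
  fixes f :: "real \<Rightarrow> 'e::euclidean_space"
  assumes f: "f integrable_on {a..b}" and e: "e > 0"
  shows "negligible {x\<in>{a<..<b}. \<forall>d>0. \<exists>y\<in>{a<..<b}. y \<noteq> x \<and> \<bar>y - x\<bar> < d \<and>
     norm (integral {a..y} f - integral {a..x} f - (y - x) *\<^sub>R f x) \<ge> e * \<bar>y - x\<bar>}"
    (is "negligible ?E")
  unfolding negligible_outer_le
proof (intro allI impI)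
  fix \<eta> :: real assume "\<eta> > 0"
  \<comment> \<open>The second point may lie on either side of the tag \<open>x\<close>;
    \<open>J\<close> is the closed interval between them.\<close>
  define J where "J = (\<lambda>(x, y). {min x y..max x (y::real)})"
  \<comment> \<open>Tolerance \<open>e * \<eta>\<close>: a bad interval deviates by at least
    \<open>e\<close> times its length, so dividing Henstock's bound by \<open>e\<close> leaves a
    total length below \<eta>.\<close>
  obtain \<gamma> where "gauge \<gamma>" and \<gamma>: "\<And>p. \<lbrakk>p tagged_partial_division_of (cbox a b); \<gamma> fine p\<rbrakk> \<Longrightarrow>
             sum (\<lambda>(x,k). norm(measure lborel k *\<^sub>R f x - integral k f)) p < e * \<eta>"
    using Henstock_lemma[of f a b "e * \<eta>"] f e \<open>\<eta> > 0\<close> by (auto simp: box_real)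
  define K where "K = {(x, y). x \<in> {a<..<b} \<and> y \<in> {a<..<b} \<and> y \<noteq> x \<and> J (x, y) \<subseteq> \<gamma> x \<and>
     norm (integral {a..y} f - integral {a..x} f - (y - x) *\<^sub>R f x) \<ge> e * \<bar>y - x\<bar>}"
  have cball: "cball ((fst i + snd i) / 2) (\<bar>snd i - fst i\<bar> / 2) = J i" for i
    unfolding J_def by (simp add: cball_midpoint_real case_prod_beta)
  have deviation: "e * measure lebesgue (J i) \<le> norm (measure lborel (J i) *\<^sub>R f (fst i) - integral (J i) f)"
    if iK: "i \<in> K" for i
  proof -
    obtain x y where i: "i = (x, y)" and xy: "x \<in> {a<..<b}" "y \<in> {a<..<b}" "y \<noteq> x"
      "norm (integral {a..y} f - integral {a..x} f - (y - x) *\<^sub>R f x) \<ge> e * \<bar>y - x\<bar>"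
      using iK unfolding K_def by blast
    have "integral {a..s} f + integral {s..t} f = integral {a..t} f" if "a \<le> s" "s \<le> t" "t \<le> b" for s t
      using that by (intro Henstock_Kurzweil_Integration.integral_combine integrable_subinterval_real[OF f]) auto
    note combine = this
    show ?thesis
    proof (cases "x < y")
      case True
      then have "integral (J i) f = integral {a..y} f - integral {a..x} f" "measure lborel (J i) = y - x"
        using combine[of x y] xy by (auto simp: i J_def algebra_simps)
      with xy True show ?thesis by (simp add: i J_def norm_minus_commute)
    next
      case False
      then have *: "integral (J i) f = integral {a..x} f - integral {a..y} f" "measure lborel (J i) = x - y" "measure lebesgue (J i) = x - y"
        using combine[of y x] xy by (auto simp: i J_def algebra_simps)
      have eq: "(x - y) *\<^sub>R f x - (integral {a..x} f - integral {a..y} f) = integral {a..y} f - integral {a..x} f - (y - x) *\<^sub>R f x"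
        by (simp add: algebra_simps)
      have "fst i = x" by (simp add: i)
      show ?thesis unfolding * \<open>fst i = x\<close> eq using xy(4) False by simp
    qed
  qed
  obtain C where C: "countable C" "C \<subseteq> K"
     "pairwise (\<lambda>i j. disjnt (J i) (J j)) C" "negligible (?E - (\<Union>i \<in> C. J i))"
  proof (rule Vitali_covering_theorem_cballs[of K "\<lambda>i. \<bar>snd i - fst i\<bar> / 2" ?E "\<lambda>i. (fst i + snd i) / 2", unfolded cball])
    show "0 < \<bar>snd i - fst i\<bar> / 2" if "i \<in> K" for i using that by (auto simp: K_def)
    fix x d :: real assume x: "x \<in> ?E" and d: "0 < d"
    obtain r where r: "r > 0" "ball x r \<subseteq> \<gamma> x"
      using \<open>gauge \<gamma>\<close> unfolding gauge_def by (meson open_contains_ball)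
    obtain y where y: "y \<in> {a<..<b}" "y \<noteq> x" "\<bar>y - x\<bar> < min d r"
       "norm (integral {a..y} f - integral {a..x} f - (y - x) *\<^sub>R f x) \<ge> e * \<bar>y - x\<bar>"
      using x d r(1) by (auto dest!: spec[of _ "min d r"])
    have "J (x, y) \<subseteq> ball x r"
      using y(3) by (auto simp: J_def dist_real_def)
    then have "(x, y) \<in> K" using x y r by (auto simp: K_def)
    then show "\<exists>i. i \<in> K \<and> x \<in> J i \<and> \<bar>snd i - fst i\<bar> / 2 < d"
      using y(3) d by (intro exI[of _ "(x, y)"]) (auto simp: J_def)
  qed (use that in blast)
  have Jm: "J i \<in> lmeasurable" for i by (auto simp: J_def case_prod_beta)
  \<comment> \<open>Vitali gives a countable family, Henstock speaks of finite partial divisions;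
    the bound on finite subfamilies then passes to the union.\<close>
  have bound: "measure lebesgue (\<Union>i\<in>D. J i) \<le> \<eta>" if D: "D \<subseteq> C" "finite D" for D
  proof -
    have DK: "D \<subseteq> K" using D C by auto
    define p where "p = (\<lambda>i. (fst i, J i)) ` D"
    have nonempty: "J i \<noteq> {}" for i by (auto simp: J_def case_prod_beta)
    have disj: "J i \<inter> J j = {}" if "i \<in> D" "j \<in> D" "i \<noteq> j" for i j
      using C(3) D that unfolding pairwise_def disjnt_def by blast
    have inj: "inj_on (\<lambda>i. (fst i, J i)) D"
      unfolding inj_on_def using disj nonempty by (metis inf.idem prod.inject)
    have "p tagged_partial_division_of cbox a b"
      unfolding tagged_partial_division_of_def
    proof (intro conjI allI impI)
      show "finite p" using D by (simp add: p_def)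
      fix x k assume "(x, k) \<in> p"
      then obtain i where i: "i \<in> D" "x = fst i" "k = J i" by (auto simp: p_def)
      with DK have "i \<in> K" by auto
      with i show "x \<in> k" "k \<subseteq> cbox a b" by (auto simp: K_def J_def)
      show "\<exists>c d. k = cbox c d" using i by (auto simp: J_def case_prod_beta)
    next
      fix x k x' k' assume k': "(x, k) \<in> p \<and> (x', k') \<in> p \<and> (x, k) \<noteq> (x', k')"
      then obtain i j where j: "i \<in> D" "x = fst i" "k = J i" "j \<in> D" "x' = fst j" "k' = J j" by (auto simp: p_def)
      with k' have "i \<noteq> j" by auto
      then show "interior k \<inter> interior k' = {}"
        using disj[of i j] j interior_subset[of k] interior_subset[of k'] by blast
    qed
    moreover have "\<gamma> fine p" using DK by (fastforce simp: fine_def p_def K_def)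
    ultimately have "sum (\<lambda>(x,k). norm(measure lborel k *\<^sub>R f x - integral k f)) p < e * \<eta>" by (rule \<gamma>)
    then have *: "(\<Sum>i\<in>D. norm (measure lborel (J i) *\<^sub>R f (fst i) - integral (J i) f)) < e * \<eta>"
      unfolding p_def by (simp add: sum.reindex[OF inj] case_prod_beta)
    have "measure lebesgue (\<Union>i\<in>D. J i) \<le> (\<Sum>i\<in>D. measure lebesgue (J i))"
      using D Jm by (intro measure_UNION_le) auto
    then have "e * measure lebesgue (\<Union>i\<in>D. J i) \<le> (\<Sum>i\<in>D. e * measure lebesgue (J i))"
      using e by (simp add: sum_distrib_left[symmetric])
    also have "\<dots> \<le> (\<Sum>i\<in>D. norm (measure lborel (J i) *\<^sub>R f (fst i) - integral (J i) f))"
      by (intro sum_mono deviation) (use DK in auto)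
    also note *
    finally show ?thesis using e by simp
  qed
  have "(\<Union>i\<in>C. J i) \<in> lmeasurable" "measure lebesgue (\<Union>i\<in>C. J i) \<le> \<eta>"
    using fmeasurable_UN_bound[OF C(1) Jm bound] measure_UN_bound[OF C(1) Jm bound] by blast+
  moreover define R where "R = ?E - (\<Union>i \<in> C. J i)"
  moreover have "R \<in> lmeasurable" "measure lebesgue R = 0"
    using C(4) unfolding R_def negligible_iff_measure by auto
  ultimately have "?E \<subseteq> (\<Union>i\<in>C. J i) \<union> R" "(\<Union>i\<in>C. J i) \<union> R \<in> lmeasurable" "measure lebesgue ((\<Union>i\<in>C. J i) \<union> R) \<le> \<eta>"
    using measure_Un_le[of "\<Union>i\<in>C. J i" lebesgue R] by (blast, blast intro: fmeasurable.Un, auto dest: fmeasurableD)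
  then show "\<exists>T. ?E \<subseteq> T \<and> T \<in> lmeasurable \<and> measure lebesgue T \<le> \<eta>" by blast
qed

text \<open>Failure of differentiability at \<open>x\<close> means that for some \<open>n\<close>
  the difference quotients deviate by at least 1/(n+1) arbitrarily close to \<open>x\<close>, so the
  exceptional set is covered by countably many null sets.\<close>

lemma has_vector_derivative_integral_ae:
  fixes f :: "real \<Rightarrow> 'e::euclidean_space"
  assumes f: "f integrable_on {a..b}"
  shows "negligible {x\<in>{a<..<b}. \<not> ((\<lambda>u. integral {a..u} f) has_vector_derivative f x) (at x)}"
proof -
  define F where "F = (\<lambda>u. integral {a..u} f)"
  define E where "E e = {x\<in>{a<..<b}. \<forall>d>0. \<exists>y\<in>{a<..<b}. y \<noteq> x \<and> \<bar>y - x\<bar> < d \<and>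
     norm (F y - F x - (y - x) *\<^sub>R f x) \<ge> e * \<bar>y - x\<bar>}" for e
  have "(F has_vector_derivative f x) (at x)" if x: "x \<in> {a<..<b}" "\<And>n. x \<notin> E (inverse (Suc n))" for x
    unfolding has_vector_derivative_def has_derivative_within_alt
  proof (intro conjI allI impI)
    show "bounded_linear (\<lambda>h. h *\<^sub>R f x)" by (rule bounded_linear_scaleR_left)
    fix e :: real assume "0 < e"
    then obtain n where n: "inverse (Suc n) < e" using reals_Archimedean by blast
    from x(2)[of n] x(1) obtain d where d: "d > 0" and
      dd: "\<And>y. y \<in> {a<..<b} \<Longrightarrow> y \<noteq> x \<Longrightarrow> \<bar>y - x\<bar> < d \<Longrightarrow> norm (F y - F x - (y - x) *\<^sub>R f x) < inverse (Suc n) * \<bar>y - x\<bar>"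
      unfolding E_def by (fastforce simp: not_le)
    show "\<exists>d>0. \<forall>y\<in>UNIV. norm (y - x) < d \<longrightarrow> norm (F y - F x - (y - x) *\<^sub>R f x) \<le> e * norm (y - x)"
    proof (intro exI[of _ "min d (min (x - a) (b - x))"] conjI ballI impI)
      show "0 < min d (min (x - a) (b - x))" using x d by auto
      fix y assume y: "norm (y - x) < min d (min (x - a) (b - x))"
      show "norm (F y - F x - (y - x) *\<^sub>R f x) \<le> e * norm (y - x)"
      proof (cases "y = x")
        case False
        with y have "norm (F y - F x - (y - x) *\<^sub>R f x) < inverse (Suc n) * \<bar>y - x\<bar>"
          by (intro dd) (auto simp: abs_if split: if_splits)
        also have "\<dots> \<le> e * \<bar>y - x\<bar>" using n by (intro mult_right_mono) auto
        finally show ?thesis by simp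
      qed simp
    qed
  qed
  then have "{x\<in>{a<..<b}. \<not> (F has_vector_derivative f x) (at x)} \<subseteq> (\<Union>n. E (inverse (Suc n)))"
    by blast
  moreover have "negligible (\<Union>n. E (inverse (Suc n)))"
    unfolding E_def F_def by (intro negligible_Union_nat negligible_bad_difference_quotients f) auto
  ultimately show ?thesis unfolding F_def using negligible_subset by blast
qed

section \<open>Total variation of absolutely continuous functions\<close>

definition packing :: "real \<Rightarrow> real \<Rightarrow> nat \<Rightarrow> (nat \<Rightarrow> real) \<Rightarrow> (nat \<Rightarrow> real) \<Rightarrow> bool" where
  "packing c d m s t \<longleftrightarrow> (\<forall>k<m. c \<le> s k \<and> s k \<le> t k \<and> t k \<le> d) \<and>
     (\<forall>j<m. \<forall>k<m. j \<noteq> k \<longrightarrow> {s j<..<t j} \<inter> {s k<..<t k} = {})"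

lemma abs_continuous_packing:
  "abs_continuous a b \<gamma> \<longleftrightarrow> (\<forall>\<epsilon>>0. \<exists>\<delta>>0. \<forall>m s t. packing a b m s t \<and> (\<Sum>k<m. t k - s k) < \<delta> \<longrightarrow>
     (\<Sum>k<m. norm (\<gamma> (t k) - \<gamma> (s k))) < \<epsilon>)"
  unfolding abs_continuous_def packing_def by (simp add: conj_assoc)

lemma abs_continuous_packingD:
  assumes "abs_continuous a b \<gamma>" "\<epsilon> > 0"
  obtains \<delta> where "\<delta> > 0" "\<And>m s t. packing a b m s t \<Longrightarrow> (\<Sum>k<m. t k - s k) < \<delta> \<Longrightarrow>
     (\<Sum>k<m. norm (\<gamma> (t k) - \<gamma> (s k))) < \<epsilon>"
  using assms unfolding abs_continuous_packing by meson

lemma packing_mono: "packing c d m s t \<Longrightarrow> a \<le> c \<Longrightarrow> d \<le> b \<Longrightarrow> packing a b m s t"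
  unfolding packing_def by force

text \<open>Cutting an interval at \<open>d\<close> leaves a part on each side, one of which may be
  a point. \<open>packing\<close> admits degenerate intervals, so truncation keeps the index set
  unchanged.\<close>

lemma packing_min: "packing c e m s t \<Longrightarrow> c \<le> d \<Longrightarrow> packing c d m (\<lambda>k. min (s k) d) (\<lambda>k. min (t k) d)"
  unfolding packing_def by (fastforce simp: set_eq_iff min_def split: if_splits)

lemma packing_max: "packing c e m s t \<Longrightarrow> d \<le> e \<Longrightarrow> packing d e m (\<lambda>k. max (s k) d) (\<lambda>k. max (t k) d)"
  unfolding packing_def by (fastforce simp: set_eq_iff max_def split: if_splits)

lemma packing_append:
  assumes "packing c d m s t" "packing c d m' s' t'"
    and "\<And>j k. j < m \<Longrightarrow> k < m' \<Longrightarrow> {s j<..<t j} \<inter> {s' k<..<t' k} = {}"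
  shows "packing c d (m + m') (\<lambda>k. if k < m then s k else s' (k - m)) (\<lambda>k. if k < m then t k else t' (k - m))"
  unfolding packing_def
proof (intro conjI allI impI)
  fix j k assume jk: "j < m + m'" "k < m + m'" "j \<noteq> k"
  have "\<And>j k. j < m \<Longrightarrow> k < m \<Longrightarrow> j \<noteq> k \<Longrightarrow> {s j<..<t j} \<inter> {s k<..<t k} = {}"
    "\<And>j k. j < m' \<Longrightarrow> k < m' \<Longrightarrow> j \<noteq> k \<Longrightarrow> {s' j<..<t' j} \<inter> {s' k<..<t' k} = {}"
    using assms(1,2) unfolding packing_def by blast+
  with assms(3) assms(3)[THEN trans[OF Int_commute]] jk
  show "{if j < m then s j else s' (j - m)<..<if j < m then t j else t' (j - m)} \<inter>
        {if k < m then s k else s' (k - m)<..<if k < m then t k else t' (k - m)} = {}"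
    by (cases "j < m"; cases "k < m") simp_all
qed (use assms(1,2) in \<open>auto simp: packing_def\<close>)

lemma sum_append:
  fixes f :: "real \<Rightarrow> real \<Rightarrow> 'a::comm_monoid_add" and m m' :: nat
  shows "(\<Sum>k<m + m'. f (if k < m then s k else s' (k - m)) (if k < m then t k else t' (k - m))) =
    (\<Sum>k<m. f (s k) (t k)) + (\<Sum>k<m'. f (s' k) (t' k))"
  by (induction m') (simp_all add: add.assoc)

lemma packing_length:
  assumes "packing c d m s t" "c \<le> d"
  shows "(\<Sum>k<m. t k - s k) \<le> d - c"
proof -
  have "ennreal (\<Sum>k<m. t k - s k) = (\<Sum>k<m. ennreal (t k - s k))"
    using assms by (intro sum_ennreal[symmetric]) (auto simp: packing_def)
  also have "\<dots> = (\<Sum>k<m. emeasure lborel {s k<..<t k})"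
    using assms by (intro sum.cong) (auto simp: packing_def)
  also have "\<dots> = emeasure lborel (\<Union>k<m. {s k<..<t k})"
    using assms by (intro sum_emeasure) (auto simp: packing_def disjoint_family_on_def)
  also have "\<dots> \<le> emeasure lborel {c..d}"
    using assms by (intro emeasure_mono) (force simp: packing_def)+
  also have "\<dots> = ennreal (d - c)" using assms by simp
  finally show ?thesis using assms(2) by (simp add: ennreal_le_iff)
qed

definition variation :: "(real \<Rightarrow> real) \<Rightarrow> real \<Rightarrow> real \<Rightarrow> real" where
  "variation f c d = Sup {(\<Sum>k<m. \<bar>f (t k) - f (s k)\<bar>) | m s t. packing c d m s t}"

locale abs_continuous_real =
  fixes a b :: real and f :: "real \<Rightarrow> real"
  assumes ac: "abs_continuous a b f"
begin

lemma sum_split: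
  fixes m :: nat and s t :: "nat \<Rightarrow> real"
  shows "(\<Sum>k<m. \<bar>f (t k) - f (s k)\<bar>) \<le>
    (\<Sum>k<m. \<bar>f (min (t k) d) - f (min (s k) d)\<bar>) + (\<Sum>k<m. \<bar>f (max (t k) d) - f (max (s k) d)\<bar>)"
  unfolding sum.distrib[symmetric] by (intro sum_mono) (auto simp: min_def max_def)

text \<open>The interval is cut into finitely many pieces shorter than \<delta>, on each of which
  every sum is below 1; the number of pieces is then a bound.\<close>

lemma bounded_sums: "\<exists>B. \<forall>m s t. packing a b m s t \<longrightarrow> (\<Sum>k<m. \<bar>f (t k) - f (s k)\<bar>) \<le> B"
proof (cases "a \<le> b")
  case ab: True
  obtain \<delta> where \<delta>: "\<delta> > 0" "\<And>m s t. packing a b m s t \<Longrightarrow> (\<Sum>k<m. t k - s k) < \<delta> \<Longrightarrow>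
     (\<Sum>k<m. \<bar>f (t k) - f (s k)\<bar>) < 1"
    using abs_continuous_packingD[OF ac zero_less_one] by auto
  \<comment> \<open>The step \<open>\<delta> / 2\<close> keeps the length of each piece strictly
    below \<delta>.\<close>
  define c where "c j = min b (a + real j * (\<delta> / 2))" for j
  have bound: "packing a (c j) m s t \<Longrightarrow> (\<Sum>k<m. \<bar>f (t k) - f (s k)\<bar>) \<le> real j" for j m s t
  proof (induction j arbitrary: s t)
    case 0
    then have "s k = a \<and> t k = a" if "k < m" for k
      using that ab unfolding packing_def c_def by (auto simp: antisym)
    then show ?case by simp
  next
    case (Suc j)
    have c: "a \<le> c j" "c j \<le> c (Suc j)" "c (Suc j) \<le> b" "c (Suc j) - c j < \<delta>"
      using \<delta>(1) ab by (auto simp: c_def min_def field_simps)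
    have P: "packing (c j) (c (Suc j)) m (\<lambda>k. max (s k) (c j)) (\<lambda>k. max (t k) (c j))"
      by (rule packing_max[OF Suc.prems]) (use c in auto)
    have "(\<Sum>k<m. \<bar>f (max (t k) (c j)) - f (max (s k) (c j))\<bar>) < 1"
      using packing_mono[OF P] packing_length[OF P] c by (intro \<delta>(2)) auto
    moreover have "(\<Sum>k<m. \<bar>f (min (t k) (c j)) - f (min (s k) (c j))\<bar>) \<le> real j"
      by (intro Suc.IH packing_min[OF Suc.prems] c)
    ultimately show ?case using sum_split[where d = "c j" and m = m and s = s and t = t] by simp
  qed
  obtain j where "(b - a) / (\<delta> / 2) \<le> real j" using real_arch_simple by blast
  then have "c j = b" using \<delta>(1) by (simp add: c_def field_simps)
  then show ?thesis using bound[of j] by auto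
next
  case False
  then have "packing a b m s t \<Longrightarrow> m = 0" for m s t unfolding packing_def by (cases m) force+
  then show ?thesis by (intro exI[of _ 0]) fastforce
qed

lemma sum_le_variation:
  assumes "packing c d m s t" "a \<le> c" "d \<le> b"
  shows "(\<Sum>k<m. \<bar>f (t k) - f (s k)\<bar>) \<le> variation f c d"
proof -
  obtain B where "\<And>m s t. packing a b m s t \<Longrightarrow> (\<Sum>k<m. \<bar>f (t k) - f (s k)\<bar>) \<le> B"
    using bounded_sums by blast
  then have "bdd_above {(\<Sum>k<m. \<bar>f (t k) - f (s k)\<bar>) | m s t. packing c d m s t}"
    using assms(2,3) by (auto intro!: bdd_aboveI[of _ B] dest: packing_mono)
  then show ?thesis unfolding variation_def using assms(1) by (intro cSup_upper) auto
qed

lemma variation_le: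
  assumes "\<And>m s t. packing c d m s t \<Longrightarrow> (\<Sum>k<m. \<bar>f (t k) - f (s k)\<bar>) \<le> B"
  shows "variation f c d \<le> B"
proof -
  have "packing c d 0 s s" for s :: "nat \<Rightarrow> real" by (simp add: packing_def)
  then show ?thesis unfolding variation_def using assms by (intro cSup_least) blast+
qed

lemma variation_split:
  assumes "a \<le> c" "c \<le> d" "d \<le> e" "e \<le> b"
  shows "variation f c e \<le> variation f c d + variation f d e"
proof (rule variation_le)
  fix m s t assume p: "packing c e m s t"
  show "(\<Sum>k<m. \<bar>f (t k) - f (s k)\<bar>) \<le> variation f c d + variation f d e"
    using assms sum_split[where d = d and m = m and s = s and t = t]
      sum_le_variation[OF packing_min[OF p assms(2)]] sum_le_variation[OF packing_max[OF p assms(3)]] by auto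
qed

text \<open>The single interval from \<open>d\<close> to \<open>e\<close> can be appended to any
  packing of \<open>{c..d}\<close>. This is what makes both the variation \<open>V\<close> and
  \<open>V - f\<close> nondecreasing.\<close>

lemma variation_increment:
  assumes "a \<le> c" "c \<le> d" "d \<le> e" "e \<le> b"
  shows "\<bar>f e - f d\<bar> + variation f c d \<le> variation f c e"
proof -
  have "variation f c d \<le> variation f c e - \<bar>f e - f d\<bar>"
  proof (rule variation_le)
    fix m s t assume p: "packing c d m s t"
    have "packing c e (m + 1) (\<lambda>k. if k < m then s k else d) (\<lambda>k. if k < m then t k else e)"
      using packing_append[of c e m s t 1 "\<lambda>_. d" "\<lambda>_. e"] p assms
      by (force simp: packing_def)
    from sum_le_variation[OF this] assms sum_append[where f = "\<lambda>s t. \<bar>f t - f s\<bar>" and m = m and m' = 1 and s = s and s' = "\<lambda>_. d" and t = t and t' = "\<lambda>_. e"]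
    show "(\<Sum>k<m. \<bar>f (t k) - f (s k)\<bar>) \<le> variation f c e - \<bar>f e - f d\<bar>" by simp
  qed
  then show ?thesis by simp
qed

text \<open>The intervals of a packing are refined one after another; all refinements together still
  have total length below \<delta>, so the sum of the variations inherits the bound for
  \<open>f\<close>.\<close>

lemma abs_continuous_variation: "abs_continuous a b (variation f a)"
  unfolding abs_continuous_packing
proof (intro allI impI)
  fix \<epsilon> :: real assume \<epsilon>: "\<epsilon> > 0"
  obtain \<delta> where \<delta>: "\<delta> > 0" "\<And>m s t. packing a b m s t \<Longrightarrow> (\<Sum>k<m. t k - s k) < \<delta> \<Longrightarrow>
     (\<Sum>k<m. \<bar>f (t k) - f (s k)\<bar>) < \<epsilon> / 2"
    using abs_continuous_packingD[OF ac, of "\<epsilon> / 2"] \<epsilon> by auto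
  \<comment> \<open>Induction over the intervals \<open>S\<close>, \<open>T\<close> that are still
    counted by their variation; \<open>u\<close>, \<open>v\<close> are those already refined.
    Suprema turn < into \<le>, for which \<open>\<epsilon> / 2\<close> leaves room.\<close>
  have key: "(\<Sum>k<m. variation f (S k) (T k)) + (\<Sum>k<l. \<bar>f (v k) - f (u k)\<bar>) \<le> \<epsilon> / 2"
    if "packing a b m S T" "packing a b l u v" "(\<Sum>k<m. T k - S k) + (\<Sum>k<l. v k - u k) < \<delta>"
      "\<And>j k. j < m \<Longrightarrow> k < l \<Longrightarrow> {S j<..<T j} \<inter> {u k<..<v k} = {}" for m S T l u v
    using that
  proof (induction m arbitrary: l u v)
    case 0
    then show ?case using \<delta>(2)[of l u v] by simp
  next
    case (Suc m)
    have ST: "a \<le> S m" "S m \<le> T m" "T m \<le> b" using Suc.prems(1) by (auto simp: packing_def)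
    have "variation f (S m) (T m) \<le> \<epsilon> / 2 - (\<Sum>k<m. variation f (S k) (T k)) - (\<Sum>k<l. \<bar>f (v k) - f (u k)\<bar>)"
    proof (rule variation_le)
      fix n s t assume p: "packing (S m) (T m) n s t"
      have sub: "{s k<..<t k} \<subseteq> {S m<..<T m}" if "k < n" for k
        using p that by (fastforce simp: packing_def)
      have q: "packing a b (l + n) (\<lambda>k. if k < l then u k else s (k - l)) (\<lambda>k. if k < l then v k else t (k - l))"
        by (intro packing_append Suc.prems packing_mono[OF p] ST) (use Suc.prems(4)[of m] sub in blast)
      have "(\<Sum>k<m. variation f (S k) (T k)) +
         (\<Sum>k<l + n. \<bar>f (if k < l then v k else t (k - l)) - f (if k < l then u k else s (k - l))\<bar>) \<le> \<epsilon> / 2"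
      proof (rule Suc.IH[OF _ q])
        show "packing a b m S T" using Suc.prems(1) by (auto simp: packing_def)
        show "(\<Sum>k<m. T k - S k) + (\<Sum>k<l + n. (if k < l then v k else t (k - l)) - (if k < l then u k else s (k - l))) < \<delta>"
          unfolding sum_append[of "\<lambda>x y. y - x"] using packing_length[OF p] ST Suc.prems(3) by simp
        fix j k assume jk: "j < m" "k < l + n"
        then have "{S j<..<T j} \<inter> {S m<..<T m} = {}" using Suc.prems(1) by (auto simp: packing_def)
        then show "{S j<..<T j} \<inter> {if k < l then u k else s (k - l)<..<if k < l then v k else t (k - l)} = {}"
        proof (cases "k < l")
          case True
          then show ?thesis using jk Suc.prems(4)[of j k] by simp
        next
          case False
          then have "k - l < n" using jk by simp
          with \<open>{S j<..<T j} \<inter> {S m<..<T m} = {}\<close> sub[of "k - l"] show ?thesis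
            unfolding if_not_P[OF False] by blast
        qed
      qed
      then show "(\<Sum>k<n. \<bar>f (t k) - f (s k)\<bar>) \<le> \<epsilon> / 2 - (\<Sum>k<m. variation f (S k) (T k)) - (\<Sum>k<l. \<bar>f (v k) - f (u k)\<bar>)"
        unfolding sum_append[of "\<lambda>x y. \<bar>f y - f x\<bar>"] by simp
    qed
    then show ?case by simp
  qed
  show "\<exists>\<delta>>0. \<forall>m s t. packing a b m s t \<and> (\<Sum>k<m. t k - s k) < \<delta> \<longrightarrow>
     (\<Sum>k<m. norm (variation f a (t k) - variation f a (s k))) < \<epsilon>"
  proof (intro exI[of _ \<delta>] conjI allI impI \<delta>(1))
    fix m s t assume p: "packing a b m s t \<and> (\<Sum>k<m. t k - s k) < \<delta>"
    have "(\<Sum>k<m. norm (variation f a (t k) - variation f a (s k))) \<le> (\<Sum>k<m. variation f (s k) (t k))"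
    proof (rule sum_mono)
      fix k assume "k \<in> {..<m}"
      then have "a \<le> s k" "s k \<le> t k" "t k \<le> b" using p by (auto simp: packing_def)
      then show "norm (variation f a (t k) - variation f a (s k)) \<le> variation f (s k) (t k)"
        using variation_split[of a "s k" "t k"] variation_increment[of a "s k" "t k"] by simp
    qed
    also have "\<dots> \<le> \<epsilon> / 2" using key[of m s t 0] p by (simp add: packing_def)
    also have "\<dots> < \<epsilon>" using \<epsilon> by simp
    finally show "(\<Sum>k<m. norm (variation f a (t k) - variation f a (s k))) < \<epsilon>" .
  qed
qed

end

section \<open>Densities and the fundamental theorem of calculus\<close>

lemma abs_continuous_finite_family:
  assumes "abs_continuous a b \<gamma>" "\<epsilon> > 0"
  shows "\<exists>\<delta>>0. \<forall>(I :: 'i set) s t. finite I \<longrightarrow> (\<forall>i\<in>I. a \<le> s i \<and> s i \<le> t i \<and> t i \<le> b) \<longrightarrow>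
      (\<forall>i\<in>I. \<forall>j\<in>I. i \<noteq> j \<longrightarrow> {s i<..<t i} \<inter> {s j<..<t j} = {}) \<longrightarrow>
      (\<Sum>i\<in>I. t i - s i) < \<delta> \<longrightarrow> (\<Sum>i\<in>I. norm (\<gamma> (t i) - \<gamma> (s i))) < \<epsilon>"
proof -
  obtain \<delta> where \<delta>: "\<delta> > 0" "\<And>m s t. packing a b m s t \<Longrightarrow> (\<Sum>k<m. t k - s k) < \<delta> \<Longrightarrow>
     (\<Sum>k<m. norm (\<gamma> (t k) - \<gamma> (s k))) < \<epsilon>"
    by (rule abs_continuous_packingD[OF assms]) (rule that)
  show ?thesis
  proof (intro exI[of _ \<delta>] conjI allI impI \<delta>(1))
    fix I :: "'i set" and s t
    assume I: "finite I" "\<forall>i\<in>I. a \<le> s i \<and> s i \<le> t i \<and> t i \<le> b"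
      "\<forall>i\<in>I. \<forall>j\<in>I. i \<noteq> j \<longrightarrow> {s i<..<t i} \<inter> {s j<..<t j} = {}" "(\<Sum>i\<in>I. t i - s i) < \<delta>"
    obtain h where h: "bij_betw h {0..<card I} I" using ex_bij_betw_nat_finite[OF I(1)] by blast
    then have h: "bij_betw h {..<card I} I" by (simp add: atLeast0LessThan)
    have "h k \<in> I" if "k < card I" for k using h that by (auto simp: bij_betw_def)
    moreover have "h j \<noteq> h k" if "j < card I" "k < card I" "j \<noteq> k" for j k
      using h that by (auto simp: bij_betw_def inj_on_def)
    ultimately have "packing a b (card I) (s \<circ> h) (t \<circ> h)"
      unfolding packing_def o_def using I(2,3) by blast
    moreover have "(\<Sum>k<card I. (t \<circ> h) k - (s \<circ> h) k) < \<delta>"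
      using I(4) sum.reindex_bij_betw[OF h, of "\<lambda>i. t i - s i"] by simp
    ultimately have "(\<Sum>k<card I. norm (\<gamma> ((t \<circ> h) k) - \<gamma> ((s \<circ> h) k))) < \<epsilon>" by (rule \<delta>(2))
    then show "(\<Sum>i\<in>I. norm (\<gamma> (t i) - \<gamma> (s i))) < \<epsilon>"
      using sum.reindex_bij_betw[OF h, of "\<lambda>i. norm (\<gamma> (t i) - \<gamma> (s i))"] by simp
  qed
qed

lemma abs_continuous_imp_continuous_on:
  assumes "abs_continuous a b \<gamma>"
  shows "continuous_on {a..b} \<gamma>"
  unfolding continuous_on_iff
proof (intro ballI allI impI)
  fix x \<epsilon> :: real assume x: "x \<in> {a..b}" and \<epsilon>: "\<epsilon> > 0"
  obtain \<delta> where \<delta>: "\<delta> > 0" "\<And>m s t. packing a b m s t \<Longrightarrow> (\<Sum>k<m. t k - s k) < \<delta> \<Longrightarrow>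
     (\<Sum>k<m. norm (\<gamma> (t k) - \<gamma> (s k))) < \<epsilon>"
    by (rule abs_continuous_packingD[OF assms \<epsilon>]) (rule that)
  show "\<exists>d>0. \<forall>y\<in>{a..b}. dist y x < d \<longrightarrow> dist (\<gamma> y) (\<gamma> x) < \<epsilon>"
  proof (intro exI[of _ \<delta>] conjI ballI impI \<delta>(1))
    fix y assume y: "y \<in> {a..b}" "dist y x < \<delta>"
    have "packing a b 1 (\<lambda>_. min x y) (\<lambda>_. max x y)" using x y by (auto simp: packing_def)
    from \<delta>(2)[OF this] y show "dist (\<gamma> y) (\<gamma> x) < \<epsilon>"
      by (cases "x \<le> y") (auto simp: dist_norm dist_real_def norm_minus_commute)
  qed
qed

lemma abs_continuous_subinterval:
  "abs_continuous a b \<gamma> \<Longrightarrow> a \<le> c \<Longrightarrow> d \<le> b \<Longrightarrow> abs_continuous c d \<gamma>"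
  unfolding abs_continuous_packing using packing_mono by meson

lemma abs_continuous_diff:
  assumes "abs_continuous a b f" "abs_continuous a b g"
  shows "abs_continuous a b (\<lambda>t. f t - g t)"
  unfolding abs_continuous_packing
proof (intro allI impI)
  fix \<epsilon> :: real assume \<epsilon>: "\<epsilon> > 0"
  then have "\<epsilon> / 2 > 0" by simp
  obtain \<delta> where \<delta>: "\<delta> > 0" "\<And>m s t. packing a b m s t \<Longrightarrow> (\<Sum>k<m. t k - s k) < \<delta> \<Longrightarrow>
     (\<Sum>k<m. norm (f (t k) - f (s k))) < \<epsilon> / 2" by (rule abs_continuous_packingD[OF assms(1) \<open>\<epsilon> / 2 > 0\<close>]) (rule that)
  obtain \<delta>' where \<delta>': "\<delta>' > 0" "\<And>m s t. packing a b m s t \<Longrightarrow> (\<Sum>k<m. t k - s k) < \<delta>' \<Longrightarrow>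
     (\<Sum>k<m. norm (g (t k) - g (s k))) < \<epsilon> / 2" by (rule abs_continuous_packingD[OF assms(2) \<open>\<epsilon> / 2 > 0\<close>]) (rule that)
  show "\<exists>\<delta>>0. \<forall>m s t. packing a b m s t \<and> (\<Sum>k<m. t k - s k) < \<delta> \<longrightarrow>
     (\<Sum>k<m. norm ((f (t k) - g (t k)) - (f (s k) - g (s k)))) < \<epsilon>"
  proof (intro exI[of _ "min \<delta> \<delta>'"] conjI allI impI)
    show "min \<delta> \<delta>' > 0" using \<delta>(1) \<delta>'(1) by simp
    fix m s t assume p: "packing a b m s t \<and> (\<Sum>k<m. t k - s k) < min \<delta> \<delta>'"
    have "(\<Sum>k<m. norm ((f (t k) - g (t k)) - (f (s k) - g (s k)))) \<le>
        (\<Sum>k<m. norm (f (t k) - f (s k)) + norm (g (t k) - g (s k)))"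
    proof (intro sum_mono)
      fix k
      have "(f (t k) - g (t k)) - (f (s k) - g (s k)) = (f (t k) - f (s k)) - (g (t k) - g (s k))" by simp
      then show "norm ((f (t k) - g (t k)) - (f (s k) - g (s k))) \<le> norm (f (t k) - f (s k)) + norm (g (t k) - g (s k))"
        using norm_triangle_ineq4 by metis
    qed
    with \<delta>(2)[of m s t] \<delta>'(2)[of m s t] p
    show "(\<Sum>k<m. norm ((f (t k) - g (t k)) - (f (s k) - g (s k)))) < \<epsilon>"
      by (simp add: sum.distrib)
  qed
qed

lemma abs_continuous_bounded_linear:
  assumes "bounded_linear h" "abs_continuous a b f"
  shows "abs_continuous a b (\<lambda>t. h (f t))"
  unfolding abs_continuous_packing
proof (intro allI impI)
  interpret bounded_linear h by fact
  fix \<epsilon> :: real assume \<epsilon>: "\<epsilon> > 0"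
  obtain K where K: "K > 0" "\<And>x. norm (h x) \<le> norm x * K" using pos_bounded by blast
  then have "\<epsilon> / K > 0" using \<epsilon> by simp
  obtain \<delta> where \<delta>: "\<delta> > 0" "\<And>m s t. packing a b m s t \<Longrightarrow> (\<Sum>k<m. t k - s k) < \<delta> \<Longrightarrow>
     (\<Sum>k<m. norm (f (t k) - f (s k))) < \<epsilon> / K" by (rule abs_continuous_packingD[OF assms(2) \<open>\<epsilon> / K > 0\<close>]) (rule that)
  show "\<exists>\<delta>>0. \<forall>m s t. packing a b m s t \<and> (\<Sum>k<m. t k - s k) < \<delta> \<longrightarrow>
     (\<Sum>k<m. norm (h (f (t k)) - h (f (s k)))) < \<epsilon>"
  proof (intro exI[of _ \<delta>] conjI allI impI \<delta>(1))
    fix m s t assume p: "packing a b m s t \<and> (\<Sum>k<m. t k - s k) < \<delta>"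
    have "(\<Sum>k<m. norm (h (f (t k)) - h (f (s k)))) \<le> (\<Sum>k<m. norm (f (t k) - f (s k))) * K"
      unfolding sum_distrib_right diff[symmetric] by (intro sum_mono K)
    also have "\<dots> < \<epsilon>" using \<delta>(2)[of m s t] p K(1) by (simp add: pos_less_divide_eq)
    finally show "(\<Sum>k<m. norm (h (f (t k)) - h (f (s k)))) < \<epsilon>" .
  qed
qed

text \<open>The Lebesgue-Stieltjes measure of \<open>F\<close> is absolutely continuous with respect
  to Lebesgue measure, and its Radon-Nikodym derivative is the density. A null set lies in an open
  set of small measure, whose components are the intervals on which the absolute continuity of
  \<open>F\<close> is tested.\<close>

lemma abs_continuous_mono_density:
  fixes F :: "real \<Rightarrow> real"
  assumes ac: "abs_continuous a b F" and mono: "mono_on {a..b} F" and ab: "a \<le> b"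
  obtains g where "\<And>x. 0 \<le> g x" "\<And>s t. a \<le> s \<Longrightarrow> s \<le> t \<Longrightarrow> t \<le> b \<Longrightarrow> (g has_integral (F t - F s)) {s..t}"
proof -
  \<comment> \<open>Stieltjes measures belong to functions on the whole line, so \<open>F\<close> is
    continued by constants outside \<open>{a..b}\<close>.\<close>
  define clip where "clip t = max a (min b t)" for t :: real
  have clip: "clip t \<in> {a..b}" for t using ab by (auto simp: clip_def)
  have clip_mono: "s \<le> t \<Longrightarrow> clip s \<le> clip t" for s t by (auto simp: clip_def)
  define G where "G t = F (clip t)" for t
  have G_mono: "G s \<le> G t" if "s \<le> t" for s t
    unfolding G_def by (rule mono_onD[OF mono clip clip clip_mono[OF that]])
  have "continuous_on UNIV G"
    unfolding G_def
    by (rule continuous_on_compose2[OF abs_continuous_imp_continuous_on[OF ac]])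
      (use clip in \<open>auto simp: clip_def intro!: continuous_intros\<close>)
  then have G_cont: "continuous (at_right x) G" for x
    by (auto simp: continuous_on_eq_continuous_within continuous_at_imp_continuous_at_within)
  note Ioc = emeasure_interval_measure_Ioc[OF _ G_mono G_cont]
  define \<mu> where "\<mu> = interval_measure G"
  have sets_\<mu>[measurable_cong]: "sets \<mu> = sets borel" by (simp add: \<mu>_def)
  have Ioo: "emeasure \<mu> {s<..<t} \<le> ennreal (G t - G s)" for s t
  proof (cases "s \<le> t")
    case True
    have "emeasure \<mu> {s<..<t} \<le> emeasure \<mu> {s<..t}" by (intro emeasure_mono) (auto simp: sets_\<mu>)
    also have "\<dots> = ennreal (G t - G s)" unfolding \<mu>_def by (rule Ioc[OF True])
    finally show ?thesis .
  qed simp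
  have null: "A \<in> null_sets \<mu>" if A: "A \<in> null_sets lborel" for A
  proof -
    \<comment> \<open>Only bounded portions of \<open>A\<close>, so that the components of the
      surrounding open set have finite endpoints.\<close>
    have "A \<inter> {- real n<..<real n} \<in> null_sets \<mu>" for n
    proof -
      define B where "B = A \<inter> {- real n<..<real n}"
      have B: "B \<in> sets borel" "emeasure lborel B = 0"
        using A null_set_Int2[OF A, of "{- real n<..<real n}"] by (auto simp: B_def null_sets_def)
      have small: "emeasure \<mu> B \<le> 0 + ennreal e" if e: "e > 0" for e
      proof -
        obtain \<delta> where \<delta>: "\<delta> > 0" "\<forall>(I :: real set set) s t. finite I \<longrightarrow> (\<forall>i\<in>I. a \<le> s i \<and> s i \<le> t i \<and> t i \<le> b) \<longrightarrow>
      (\<forall>i\<in>I. \<forall>j\<in>I. i \<noteq> j \<longrightarrow> {s i<..<t i} \<inter> {s j<..<t j} = {}) \<longrightarrow>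
      (\<Sum>i\<in>I. t i - s i) < \<delta> \<longrightarrow> (\<Sum>i\<in>I. norm (F (t i) - F (s i))) < e"
          using abs_continuous_finite_family[OF ac e] by blast
        obtain U0 where U0: "open U0" "B \<subseteq> U0" "emeasure lborel (U0 - B) < \<delta>"
          using outer_regular_lborel[OF B(1) \<delta>(1)] by blast
        define U where "U = U0 \<inter> {- real n<..<real n}"
        have U: "open U" "B \<subseteq> U" "U \<subseteq> {- real n<..<real n}"
          using U0 by (auto simp: U_def B_def)
        have "emeasure lborel U \<le> emeasure lborel (U0 - B) + emeasure lborel B"
          using B U0 by (intro order.trans[OF emeasure_mono emeasure_subadditive]) (auto simp: U_def)
        with U0 B have U_small: "emeasure lborel U < \<delta>" by simp
        define l r where "l = (\<lambda>C :: real set. Inf C)" and "r = (\<lambda>C :: real set. Sup C)"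
        have comp: "C = {l C<..<r C} \<and> l C < r C" if C: "C \<in> components U" for C
        proof -
          have ne: "C \<noteq> {}" "C \<subseteq> U" "connected C"
            using C in_components_nonempty in_components_subset in_components_connected by blast+
          have "open C" using open_components[OF U(1)] C by blast
          have bdd: "bdd_below C" "bdd_above C"
            using order.trans[OF ne(2) U(3)] by (meson bdd_below_mono bdd_below_Ioo, meson bdd_above_mono bdd_above_Ioo)
          have ends: "x \<in> {l C<..<r C}" if x: "x \<in> C" for x
          proof -
            obtain d where "d > 0" "cball x d \<subseteq> C" using \<open>open C\<close> x open_contains_cball by blast
            then have "x - d \<in> C" "x + d \<in> C" by (auto simp: dist_real_def)
            then show ?thesis
              using cInf_lower[OF _ bdd(1), of "x - d"] cSup_upper[OF _ bdd(2), of "x + d"] \<open>d > 0\<close>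
              by (auto simp: l_def r_def)
          qed
          have sub: "x \<in> C" if x: "x \<in> {l C<..<r C}" for x
          proof -
            obtain y z where "y \<in> C" "y < x" "z \<in> C" "x < z"
              using x ne(1) bdd by (auto simp: l_def r_def cInf_less_iff less_cSup_iff)
            then show ?thesis using ne(3) unfolding connected_iff_interval by (meson less_imp_le)
          qed
          obtain x where "x \<in> C" using ne(1) by blast
          from ends[OF this] have "l C < r C" by simp
          moreover have "C = {l C<..<r C}" using ends sub by blast
          ultimately show ?thesis by blast
        qed
        have span: "{l C<..<r C} = C" if "C \<in> components U" for C using comp[OF that] by blast
        have pw: "pairwise disjnt (components U)"
          using pairwise_disjoint_components[of U] unfolding pairwise_def disjnt_def .
        have countable: "countable (components U)"
          by (rule countable_disjoint_open_subsets[OF _ pw]) (rule open_components[OF U(1)])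
        \<comment> \<open>Absolute continuity speaks of finite families; the bound then passes to
          the countable union of all components.\<close>
        have fin: "emeasure \<mu> (\<Union>C\<in>D. C) \<le> ennreal e" if D: "D \<subseteq> components U" "finite D" for D
        proof -
          have disj: "{l C<..<r C} \<inter> {l C'<..<r C'} = {}" if "C \<in> D" "C' \<in> D" "C \<noteq> C'" for C C'
            
          proof -
            have "C \<in> components U" "C' \<in> components U" using that D by auto
            moreover from this have "C \<inter> C' = {}" using that pw by (auto simp: pairwise_def disjnt_def)
            ultimately show ?thesis using span[of C] span[of C'] by (simp only:)
          qed
          have lt: "l C \<le> r C" if "C \<in> D" for C using comp D(1) that by (meson less_imp_le subsetD)
          have "ennreal (\<Sum>C\<in>D. r C - l C) = (\<Sum>C\<in>D. emeasure lborel {l C<..<r C})"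
          proof -
            have "ennreal (\<Sum>C\<in>D. r C - l C) = (\<Sum>C\<in>D. ennreal (r C - l C))"
              by (rule sum_ennreal[symmetric]) (simp add: lt)
            also have "\<dots> = (\<Sum>C\<in>D. emeasure lborel {l C<..<r C})"
              by (rule sum.cong) (simp_all add: lt)
            finally show ?thesis .
          qed
          also have "\<dots> = emeasure lborel (\<Union>C\<in>D. {l C<..<r C})"
            using D disj by (intro sum_emeasure) (auto simp: disjoint_family_on_def)
          also have "\<dots> \<le> emeasure lborel U"
          proof (rule emeasure_mono)
            show "(\<Union>C\<in>D. {l C<..<r C}) \<subseteq> U"
            proof (rule UN_least)
              fix C assume "C \<in> D"
              then have "C \<in> components U" using D(1) by blast
              then show "{l C<..<r C} \<subseteq> U" unfolding span[OF \<open>C \<in> components U\<close>] by (rule in_components_subset)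
            qed
          qed (use U(1) in simp)
          also note U_small
          finally have len: "(\<Sum>C\<in>D. r C - l C) < \<delta>"
            by (rule contrapos_pp) (simp add: not_less ennreal_leI)
          have "emeasure \<mu> (\<Union>C\<in>D. C) \<le> (\<Sum>C\<in>D. emeasure \<mu> C)"
            using D open_components[OF U(1)] by (intro emeasure_subadditive_finite) (auto simp: sets_\<mu>)
          also have "\<dots> \<le> (\<Sum>C\<in>D. ennreal (G (r C) - G (l C)))"
            
          proof (rule sum_mono)
            fix C assume "C \<in> D"
            then have "C \<in> components U" using D(1) by blast
            from Ioo[of "l C" "r C"] show "emeasure \<mu> C \<le> ennreal (G (r C) - G (l C))"
              unfolding span[OF \<open>C \<in> components U\<close>] .
          qed
          also have "\<dots> = ennreal (\<Sum>C\<in>D. G (r C) - G (l C))"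
            
          proof (rule sum_ennreal)
            fix C assume "C \<in> D"
            then have "l C \<le> r C" using comp D(1) by (meson less_imp_le subsetD)
            then show "0 \<le> G (r C) - G (l C)" using G_mono by simp
          qed
          finally have bound: "emeasure \<mu> (\<Union>C\<in>D. C) \<le> ennreal (\<Sum>C\<in>D. G (r C) - G (l C))" .
          have "(\<Sum>C\<in>D. G (r C) - G (l C)) \<le> (\<Sum>C\<in>D. norm (F (clip (r C)) - F (clip (l C))))"
            by (intro sum_mono) (auto simp: G_def)
          also have "\<dots> < e"
          proof (rule \<delta>(2)[THEN spec, THEN spec, THEN spec, THEN mp, OF D(2), THEN mp, THEN mp, THEN mp])
            show "\<forall>C\<in>D. a \<le> clip (l C) \<and> clip (l C) \<le> clip (r C) \<and> clip (r C) \<le> b"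
            proof
              fix C assume "C \<in> D"
              then have "l C \<le> r C" using comp D(1) by (meson less_imp_le subsetD)
              then show "a \<le> clip (l C) \<and> clip (l C) \<le> clip (r C) \<and> clip (r C) \<le> b"
                using clip[of "l C"] clip[of "r C"] clip_mono[of "l C" "r C"] by simp
            qed
          next
            \<comment> \<open>\<open>clip\<close> can only shrink an open interval, so disjointness
              survives.\<close>
            have "{clip s<..<clip t} \<subseteq> {s<..<t}" for s t
              by (auto simp: clip_def min_def max_def split: if_splits)
            then show "\<forall>C\<in>D. \<forall>C'\<in>D. C \<noteq> C' \<longrightarrow> {clip (l C)<..<clip (r C)} \<inter> {clip (l C')<..<clip (r C')} = {}"
              using disj by blast
          next
            have "(\<Sum>C\<in>D. clip (r C) - clip (l C)) \<le> (\<Sum>C\<in>D. r C - l C)"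
            proof (rule sum_mono)
              fix C assume "C \<in> D"
              then have "l C \<le> r C" using comp D(1) by (meson less_imp_le subsetD)
              then show "clip (r C) - clip (l C) \<le> r C - l C"
                using ab by (simp add: clip_def min_def max_def)
            qed
            with len show "(\<Sum>C\<in>D. clip (r C) - clip (l C)) < \<delta>" by simp
          qed
          finally have "(\<Sum>C\<in>D. G (r C) - G (l C)) \<le> e" by simp
          then show ?thesis by (rule order.trans[OF bound ennreal_leI])
        qed
        have "emeasure \<mu> (\<Union>C\<in>components U. C) \<le> ennreal e"
        proof -
          have fm: "C \<in> fmeasurable \<mu>" if "C \<in> components U" for C
          proof (rule fmeasurableI)
            show "C \<in> sets \<mu>" using open_components[OF U(1) that] by (simp add: sets_\<mu>)
            have "emeasure \<mu> C \<le> ennreal e" using fin[of "{C}"] that by simp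
            then show "emeasure \<mu> C < \<infinity>" by (rule le_less_trans) simp
          qed
          have meas: "measure \<mu> (\<Union>C\<in>D. C) \<le> e" if "D \<subseteq> components U" "finite D" for D
            unfolding measure_def using e by (intro enn2real_leI fin[OF that]) simp
          have fmU: "(\<Union>C\<in>components U. C) \<in> fmeasurable \<mu>"
            by (rule fmeasurable_UN_bound[OF countable fm meas])
          have "measure \<mu> (\<Union>C\<in>components U. C) \<le> e"
            by (rule measure_UN_bound[OF countable fm meas])
          then show ?thesis unfolding emeasure_eq_measure2[OF fmU] by (rule ennreal_leI)
        qed
        moreover have "B \<subseteq> (\<Union>C\<in>components U. C)" using U(2) Union_components[of U] by auto
        moreover have "(\<Union>C\<in>components U. C) \<in> sets \<mu>"
          using U(1) Union_components[of U] by (simp add: sets_\<mu>)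
        ultimately show "emeasure \<mu> B \<le> 0 + ennreal e"
          unfolding add_0_left by (metis (no_types) emeasure_mono order.trans)
      qed
      have "emeasure \<mu> B \<le> 0" by (rule ennreal_le_epsilon) (rule small)
      then show ?thesis using B(1) by (auto simp: B_def null_sets_def sets_\<mu>)
    qed
    then have "(\<Union>n. A \<inter> {- real n<..<real n}) \<in> null_sets \<mu>" by blast
    moreover have "(\<Union>n. A \<inter> {- real n<..<real n}) = A"
    proof -
      have "\<exists>n. - real n < x \<and> x < real n" for x :: real
        using reals_Archimedean2[of "\<bar>x\<bar>"] by (auto simp: abs_less_iff minus_less_iff)
      then show ?thesis by auto
    qed
    ultimately show ?thesis by simp
  qed
  have "absolutely_continuous lborel \<mu>" unfolding absolutely_continuous_def using null by blast
  from sigma_finite_measure.Radon_Nikodym[OF sigma_finite_lborel this] obtain h where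
    h[measurable]: "h \<in> borel_measurable borel" and h\<mu>: "density lborel h = \<mu>" by (auto simp: sets_\<mu>)
  have hint: "(\<integral>\<^sup>+x. h x * indicator {s<..t} x \<partial>lborel) = ennreal (G t - G s)" if "s \<le> t" for s t
    using Ioc[OF that] emeasure_density[of h lborel "{s<..t}"] h by (simp add: h\<mu> \<mu>_def)
  \<comment> \<open>On \<open>{a<..b}\<close> the density is infinite at most on a null set, where
    \<open>enn2real\<close> yields 0.\<close>
  have fin: "AE x in lborel. h x * indicator {a<..b} x \<noteq> \<infinity>"
    by (rule nn_integral_PInf_AE) (use hint[OF ab] in auto)
  define g where "g x = enn2real (h x)" for x
  show thesis
  proof (rule that[of g])
    show "0 \<le> g x" for x by (simp add: g_def)
    fix s t assume st: "a \<le> s" "s \<le> t" "t \<le> b"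
    have "((\<lambda>x. g x * indicator {s<..t} x) has_integral (F t - F s)) UNIV"
    proof (rule nn_integral_has_integral)
      show "(\<lambda>x. g x * indicator {s<..t} x) \<in> borel_measurable borel" by (simp add: g_def)
      have "(\<integral>\<^sup>+x. ennreal (g x * indicator {s<..t} x) \<partial>lborel) = (\<integral>\<^sup>+x. h x * indicator {s<..t} x \<partial>lborel)"
        by (rule nn_integral_cong_AE, rule eventually_mono[OF fin])
          (use st in \<open>auto simp: g_def indicator_def less_top split: if_splits\<close>)
      also have "\<dots> = ennreal (F t - F s)" using hint[OF st(2)] st by (simp add: G_def clip_def)
      finally show "(\<integral>\<^sup>+x. ennreal (g x * indicator {s<..t} x) \<partial>lborel) = ennreal (F t - F s)" .
      show "0 \<le> F t - F s" using mono_onD[OF mono, of s t] st by auto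
    qed (simp add: g_def)
    then have "((\<lambda>x. if x \<in> {s<..t} then g x else 0) has_integral (F t - F s)) UNIV"
      by (rule has_integral_eq[rotated]) auto
    then have "(g has_integral (F t - F s)) {s<..t}" by (simp only: has_integral_restrict_UNIV)
    then show "(g has_integral (F t - F s)) {s..t}"
      by (subst has_integral_spike_set_eq[of _ "{s<..t}"])
        (auto intro: negligible_subset[of "{s}"])
  qed
qed

text \<open>Jordan decomposition \<open>f = V - (V - f)\<close> with the variation \<open>V\<close>:
  both terms are nondecreasing and absolutely continuous.\<close>

lemma abs_continuous_density_real:
  fixes f :: "real \<Rightarrow> real"
  assumes "abs_continuous a b f" and ab: "a \<le> b"
  obtains g where "g absolutely_integrable_on {a..b}"
    "\<And>s t. a \<le> s \<Longrightarrow> s \<le> t \<Longrightarrow> t \<le> b \<Longrightarrow> (g has_integral (f t - f s)) {s..t}"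
proof -
  interpret abs_continuous_real a b f by unfold_locales fact
  define V where "V = variation f a"
  have V: "\<bar>f t - f s\<bar> \<le> V t - V s" if "a \<le> s" "s \<le> t" "t \<le> b" for s t
    using variation_increment[of a s t] that by (simp add: V_def)
  have m1: "mono_on {a..b} V" and m2: "mono_on {a..b} (\<lambda>t. V t - f t)"
    using V by (force intro!: mono_onI)+
  note acV = abs_continuous_variation[folded V_def]
  obtain g where g: "\<And>x. 0 \<le> g x" "\<And>s t. a \<le> s \<Longrightarrow> s \<le> t \<Longrightarrow> t \<le> b \<Longrightarrow> (g has_integral (V t - V s)) {s..t}"
    using abs_continuous_mono_density[OF acV m1 ab] by blast
  obtain h where h: "\<And>x. 0 \<le> h x" "\<And>s t. a \<le> s \<Longrightarrow> s \<le> t \<Longrightarrow> t \<le> b \<Longrightarrow>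
      (h has_integral ((V t - f t) - (V s - f s))) {s..t}"
    using abs_continuous_mono_density[OF abs_continuous_diff[OF acV ac] m2 ab] by blast
  show thesis
  proof (rule that[of "\<lambda>x. g x - h x"])
    have "g absolutely_integrable_on {a..b}" "h absolutely_integrable_on {a..b}"
      using g(1) g(2)[of a b] h(1) h(2)[of a b] ab
      by (auto intro!: nonnegative_absolutely_integrable_1 has_integral_integrable)
    then show "(\<lambda>x. g x - h x) absolutely_integrable_on {a..b}" by (rule set_integral_diff(1))
    fix s t assume "a \<le> s" "s \<le> t" "t \<le> b"
    from has_integral_diff[OF g(2)[OF this] h(2)[OF this]]
    show "((\<lambda>x. g x - h x) has_integral (f t - f s)) {s..t}" by simp
  qed
qed

lemma abs_continuous_density:
  fixes f :: "real \<Rightarrow> 'e::euclidean_space"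
  assumes f: "abs_continuous a b f" and ab: "a \<le> b"
  obtains g where "g absolutely_integrable_on {a..b}"
    "\<And>s t. a \<le> s \<Longrightarrow> s \<le> t \<Longrightarrow> t \<le> b \<Longrightarrow> (g has_integral (f t - f s)) {s..t}"
proof -
  have "\<exists>g. g absolutely_integrable_on {a..b} \<and>
     (\<forall>s t. a \<le> s \<longrightarrow> s \<le> t \<longrightarrow> t \<le> b \<longrightarrow> (g has_integral (f t \<bullet> k - f s \<bullet> k)) {s..t})" for k
    using abs_continuous_density_real[OF abs_continuous_bounded_linear[OF bounded_linear_inner_left f] ab] by metis
  then obtain g where g: "\<And>k. g k absolutely_integrable_on {a..b}"
     "\<And>k s t. a \<le> s \<Longrightarrow> s \<le> t \<Longrightarrow> t \<le> b \<Longrightarrow> (g k has_integral (f t \<bullet> k - f s \<bullet> k)) {s..t}"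
    by metis
  define G where "G x = (\<Sum>k\<in>Basis. g k x *\<^sub>R k)" for x
  have G: "G x \<bullet> k = g k x" if "k \<in> Basis" for x k
    using that by (simp add: G_def inner_sum_left inner_Basis if_distrib cong: if_cong)
  show thesis
  proof (rule that[of G])
    show "G absolutely_integrable_on {a..b}"
      by (rule absolutely_integrable_componentwise) (simp add: G g)
    show "(G has_integral (f t - f s)) {s..t}" if "a \<le> s" "s \<le> t" "t \<le> b" for s t
      by (subst has_integral_componentwise_iff) (use g(2)[OF that] in \<open>simp add: G inner_diff_left\<close>)
  qed
qed

text \<open>A density is determined only almost everywhere, whereas \<open>curve_length\<close>
  integrates the pointwise derivative. The two agree off a null set because an indefinite integral
  has its integrand as derivative almost everywhere.\<close>

theorem abs_continuous_fundamental_theorem: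
  fixes f :: "real \<Rightarrow> 'e::euclidean_space"
  assumes f: "abs_continuous a b f" and ab: "a \<le> b"
  shows "negligible {t\<in>{a<..<b}. \<not> f differentiable (at t)}"
    and "(\<lambda>t. vector_derivative f (at t)) absolutely_integrable_on {a..b}"
    and "\<And>s t. a \<le> s \<Longrightarrow> s \<le> t \<Longrightarrow> t \<le> b \<Longrightarrow>
           ((\<lambda>t. vector_derivative f (at t)) has_integral (f t - f s)) {s..t}"
proof -
  obtain g where g: "g absolutely_integrable_on {a..b}"
    "\<And>s t. a \<le> s \<Longrightarrow> s \<le> t \<Longrightarrow> t \<le> b \<Longrightarrow> (g has_integral (f t - f s)) {s..t}"
    using abs_continuous_density[OF f ab] by blast
  define Z where "Z = {x\<in>{a<..<b}. \<not> ((\<lambda>u. integral {a..u} g) has_vector_derivative g x) (at x)}"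
  have "negligible Z" unfolding Z_def
    using g(2)[of a b] ab by (intro has_vector_derivative_integral_ae) (auto simp: integrable_on_def)
  have d: "(f has_vector_derivative g x) (at x)" if "x \<in> {a<..<b} - Z" for x
  proof -
    have "((\<lambda>u. f a + integral {a..u} g) has_vector_derivative g x) (at x)"
      using that by (auto simp: Z_def intro: has_vector_derivative_add_const[THEN iffD2] derivative_eq_intros)
    then show ?thesis
    proof (rule has_vector_derivative_transform_within_open[where S = "{a<..<b}"])
      fix y assume "y \<in> {a<..<b}"
      then show "f a + integral {a..y} g = f y"
        using g(2)[of a y] by (simp add: integral_unique)
    qed (use that in auto)
  qed
  show "negligible {t\<in>{a<..<b}. \<not> f differentiable (at t)}"
    by (rule negligible_subset[OF \<open>negligible Z\<close>]) (use d in \<open>blast intro: differentiableI_vector\<close>)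
  \<comment> \<open>The endpoints are excluded: the derivative \<open>at x\<close> is two-sided, and
    nothing is known of \<open>f\<close> outside \<open>{a..b}\<close>.\<close>
  have eq: "vector_derivative f (at x) = g x" if "x \<in> {a..b} - (Z \<union> {a, b})" for x
    using that by (intro vector_derivative_at d) auto
  have neg: "negligible (Z \<union> {a, b})" using \<open>negligible Z\<close> by (intro negligible_Un) auto
  show "(\<lambda>t. vector_derivative f (at t)) absolutely_integrable_on {a..b}"
    by (rule absolutely_integrable_spike[OF g(1) neg]) (use eq in auto)
  fix s t assume st: "a \<le> s" "s \<le> t" "t \<le> b"
  show "((\<lambda>t. vector_derivative f (at t)) has_integral (f t - f s)) {s..t}"
    by (rule has_integral_spike[OF neg _ g(2)[OF st]]) (use eq st in auto)
qed

text \<open>A maximum point of the quadratic form \<open>h x \<bullet> x\<close> on the unit sphere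
  of \<open>S\<close> is an eigenvector; otherwise the residual \<open>v = h x - c x\<close> would
  be a direction of increase.\<close>

lemma self_adjoint_eigenvector_exists:
  fixes h :: "'e::euclidean_space \<Rightarrow> 'e"
  assumes lin: "linear h" and sa: "\<And>x y. h x \<bullet> y = x \<bullet> h y" and S: "subspace S"
    and inv: "\<And>x. x \<in> S \<Longrightarrow> h x \<in> S" and ne: "w \<in> S" "w \<noteq> 0"
  obtains x c where "x \<in> S" "norm x = 1" "h x = c *\<^sub>R x"
proof -
  interpret linear h by fact
  let ?K = "S \<inter> sphere 0 1"
  have 1: "compact ?K" by (simp add: closed_subspace[OF S] closed_Int_compact)
  have "(1 / norm w) *\<^sub>R w \<in> ?K"
    using ne subspace_scale[OF S] by simp
  then have 2: "?K \<noteq> {}" by blast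
  have 3: "continuous_on ?K (\<lambda>x. h x \<bullet> x)"
    by (intro continuous_on_inner continuous_on_id linear_continuous_on) (simp add: lin linear_conv_bounded_linear[symmetric])
  obtain x where x: "x \<in> ?K" and max: "\<And>y. y \<in> ?K \<Longrightarrow> h y \<bullet> y \<le> h x \<bullet> x"
    using continuous_attains_sup[OF 1 2 3] by blast
  define c where "c = h x \<bullet> x"
  have le: "h y \<bullet> y \<le> c * (y \<bullet> y)" if "y \<in> S" for y
  proof (cases "y = 0")
    case False
    with max[of "(1 / norm y) *\<^sub>R y"] that subspace_scale[OF S]
    have "h y \<bullet> y / (norm y * norm y) \<le> c" by (simp add: scale c_def)
    with False show ?thesis by (simp add: divide_le_eq power2_norm_eq_inner[symmetric] power2_eq_square)
  qed (simp add: zero)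
  define v where "v = h x - c *\<^sub>R x"
  have "v \<in> S" unfolding v_def using x inv S by (simp add: subspace_diff subspace_scale)
  have quad: "2 * t * (v \<bullet> v) \<le> t\<^sup>2 * (c * (v \<bullet> v) - h v \<bullet> v)" for t
  proof -
    have "x + t *\<^sub>R v \<in> S" using x \<open>v \<in> S\<close> S by (simp add: subspace_add subspace_scale)
    from le[OF this] have "h x \<bullet> x + 2 * t * (h x \<bullet> v) + t\<^sup>2 * (h v \<bullet> v) \<le>
        c * (x \<bullet> x) + 2 * t * (c * (x \<bullet> v)) + t\<^sup>2 * (c * (v \<bullet> v))"
      by (simp add: add scale inner_add_left inner_add_right sa[of x v] inner_commute[of _ "h v"]
          inner_commute[of v x] algebra_simps power2_eq_square)
    moreover have "x \<bullet> x = 1" using x by (simp add: power2_norm_eq_inner[symmetric])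
    moreover have vv: "v \<bullet> v = h x \<bullet> v - c * (x \<bullet> v)"
      unfolding v_def[THEN arg_cong, of "\<lambda>z. z \<bullet> v"] by (simp add: inner_diff_left)
    then have "2 * t * (v \<bullet> v) = 2 * t * (h x \<bullet> v) - 2 * t * (c * (x \<bullet> v))"
      by (simp add: right_diff_distrib)
    ultimately show ?thesis by (simp add: c_def[symmetric] right_diff_distrib)
  qed
  have "v \<bullet> v = 0"
  proof (rule ccontr)
    assume "v \<bullet> v \<noteq> 0"
    then have pos: "v \<bullet> v > 0" by simp
    define M where "M = \<bar>c * (v \<bullet> v) - h v \<bullet> v\<bar> + 1"
    have M: "M > 0" "c * (v \<bullet> v) - h v \<bullet> v < M" by (auto simp: M_def)
    \<comment> \<open>So small that the quadratic side is at most half of the linear term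
      \<open>2 * ?t * (v \<bullet> v)\<close>.\<close>
    let ?t = "v \<bullet> v / M"
    have "?t > 0" using pos M by simp
    have "2 * ?t * (v \<bullet> v) \<le> ?t\<^sup>2 * (c * (v \<bullet> v) - h v \<bullet> v)" by (rule quad)
    also have "\<dots> \<le> ?t\<^sup>2 * M" using M by (intro mult_left_mono) auto
    also have "\<dots> = ?t * (v \<bullet> v)" using M by (simp add: power2_eq_square)
    finally show False using mult_pos_pos[OF \<open>?t > 0\<close> pos] by linarith
  qed
  then show thesis using that[of x c] x by (simp add: v_def)
qed

section \<open>Unitary matrices\<close>

text \<open>Eigenvalues and phases need complex diagonal entries; \<open>diag\<close>, on which
  \<open>matrix_powr\<close> is built, takes real ones.\<close>

definition dg :: "complex^'n \<Rightarrow> complex^'n^'n" where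
  "dg c = (\<chi> i j. if i = j then c $ i else 0)"

lemma dg_nth [simp]: "dg c $ i $ j = (if i = j then c $ i else 0)"
  by (simp add: dg_def)

lemma adj_nth [simp]: "adj x $ i $ j = cnj (x $ j $ i)"
  by (simp add: adj_def transpose_def map_matrix_def)

lemma adj_adj [simp]: "adj (adj x) = x"
  by (simp add: vec_eq_iff)

lemma adj_mult: "adj (x ** y) = adj y ** adj x"
  by (simp add: vec_eq_iff matrix_matrix_mult_def mult.commute)

lemma adj_mat_1 [simp]: "adj (mat 1) = mat 1"
  by (simp add: vec_eq_iff mat_def)

lemma adj_dg: "adj (dg c) = dg (\<chi> i. cnj (c $ i))"
  by (simp add: vec_eq_iff)

lemma adj_add: "adj (x + y) = adj x + adj y" by (simp add: vec_eq_iff)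
lemma adj_scaleR: "adj (r *\<^sub>R x) = r *\<^sub>R adj x" by (simp add: vec_eq_iff)

lemma dg_mult_nth: "(dg c ** x) $ i $ j = c $ i * x $ i $ j"
  by (simp add: matrix_matrix_mult_def if_distrib[of "\<lambda>z. z * _"] cong: if_cong)

lemma mult_dg_nth: "(x ** dg c) $ i $ j = x $ i $ j * c $ j"
  by (simp add: matrix_matrix_mult_def if_distrib[of "\<lambda>z. _ * z"] cong: if_cong)

lemma dg_mult_dg: "dg c ** dg d = dg (\<chi> i. c $ i * d $ i)"
  by (simp add: vec_eq_iff dg_mult_nth)

lemma dg_1: "dg (\<chi> i. 1) = mat 1"
  by (simp add: vec_eq_iff mat_def)

lemma mult_dg_mult_nth: "(p ** dg c ** q) $ i $ j = (\<Sum>k\<in>UNIV. p $ i $ k * c $ k * q $ k $ j)"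
  unfolding matrix_matrix_mult_def[of "p ** dg c"] by (simp add: mult_dg_nth)

lemma unitary_groupI: "adj u ** u = mat 1 \<Longrightarrow> u \<in> unitary_group"
  unfolding unitary_group_def using matrix_left_right_inverse by blast

lemma unitary_adj_mult: "u \<in> unitary_group \<Longrightarrow> adj u ** u = mat 1"
  and unitary_mult_adj: "u \<in> unitary_group \<Longrightarrow> u ** adj u = mat 1"
  by (auto simp: unitary_group_def)

lemma unitary_cancel:
  assumes "u \<in> unitary_group"
  shows "adj u ** (u ** x) = x" "u ** (adj u ** x) = x" "x ** u ** adj u = x" "x ** adj u ** u = x"
  by (simp_all add: matrix_mul_assoc unitary_adj_mult[OF assms] unitary_mult_adj[OF assms])
    (simp_all add: matrix_mul_assoc[symmetric] unitary_adj_mult[OF assms] unitary_mult_adj[OF assms])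

lemma unitary_mult: "u \<in> unitary_group \<Longrightarrow> v \<in> unitary_group \<Longrightarrow> u ** v \<in> unitary_group"
  by (rule unitary_groupI)
    (simp add: adj_mult unitary_cancel unitary_adj_mult matrix_mul_assoc[symmetric])

lemma unitary_adj: "u \<in> unitary_group \<Longrightarrow> adj u \<in> unitary_group"
  by (simp add: unitary_group_def)

lemma unitary_mat_1: "mat 1 \<in> unitary_group"
  by (simp add: unitary_group_def)

lemma unitary_dg: "(\<And>i. norm (c $ i) = 1) \<Longrightarrow> dg c \<in> unitary_group"
  by (rule unitary_groupI) (simp add: adj_dg dg_mult_dg dg_1[symmetric] mult.commute[of "cnj _"] complex_norm_square[symmetric])

lemma cmod_square: "(complex_of_real (cmod z))\<^sup>2 = z * cnj z"
  using complex_norm_square[of z] by simp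

text \<open>The norm of the nested vector type is the Frobenius norm; its invariance under unitary
  factors is used throughout.\<close>

lemma norm_matrix_square: "(norm x)\<^sup>2 = (\<Sum>i\<in>UNIV. \<Sum>j\<in>UNIV. (norm (x $ i $ j))\<^sup>2)"
  for x :: "complex^'n^'m"
  by (simp add: norm_vec_def L2_set_def sum_nonneg)

lemma norm_matrix_trace: "complex_of_real ((norm x)\<^sup>2) = trace (adj x ** x)" for x :: "complex^'n^'n"
  unfolding norm_matrix_square trace_def matrix_matrix_mult_def
  by (subst sum.swap) (simp add: cmod_square mult.commute[of "cnj _"])

lemma norm_adj: "norm (adj x) = norm x" for x :: "complex^'n^'n"
proof -
  have "(norm (adj x))\<^sup>2 = (norm x)\<^sup>2"
    unfolding norm_matrix_square by (subst sum.swap) simp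
  then show ?thesis by simp
qed

lemma norm_unitary_mult: "u \<in> unitary_group \<Longrightarrow> norm (u ** x) = norm x"
  and norm_mult_unitary: "u \<in> unitary_group \<Longrightarrow> norm (x ** u) = norm x" for x :: "complex^'n^'n"
proof -
  have eq: "norm x = norm y" if "trace (adj x ** x) = trace (adj y ** y)" for x y :: "complex^'n^'n"
    using that unfolding norm_matrix_trace[symmetric] of_real_eq_iff
    by simp
  show left: "norm (u ** x) = norm x" if "u \<in> unitary_group" for u x :: "complex^'n^'n"
    by (rule eq) (simp add: adj_mult unitary_cancel[OF that] matrix_mul_assoc[symmetric])
  show "norm (x ** u) = norm x" if "u \<in> unitary_group"
    using left[OF unitary_adj[OF that], of "adj x"] by (simp add: adj_mult[symmetric] norm_adj)
qed

lemma unitary_row_sum: "u \<in> unitary_group \<Longrightarrow> (\<Sum>j\<in>UNIV. (norm (u $ i $ j))\<^sup>2) = 1"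
  and unitary_column_sum: "u \<in> unitary_group \<Longrightarrow> (\<Sum>i\<in>UNIV. (norm (u $ i $ j))\<^sup>2) = 1"
proof -
  assume u: "u \<in> unitary_group"
  have "(u ** adj u) $ i $ i = 1" "(adj u ** u) $ j $ j = 1"
    by (simp_all add: unitary_adj_mult[OF u] unitary_mult_adj[OF u] mat_def)
  then have "complex_of_real (\<Sum>j\<in>UNIV. (norm (u $ i $ j))\<^sup>2) = of_real 1"
     "complex_of_real (\<Sum>i\<in>UNIV. (norm (u $ i $ j))\<^sup>2) = of_real 1"
    by (simp_all add: matrix_matrix_mult_def cmod_square mult.commute[of "cnj _"])
  then show "(\<Sum>j\<in>UNIV. (norm (u $ i $ j))\<^sup>2) = 1" "(\<Sum>i\<in>UNIV. (norm (u $ i $ j))\<^sup>2) = 1"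
    unfolding of_real_eq_iff by auto
qed

lemma unitary_entry_le_1: "u \<in> unitary_group \<Longrightarrow> norm (u $ i $ j) \<le> 1"
  using member_le_sum[of j UNIV "\<lambda>j. (norm (u $ i $ j))\<^sup>2"] unitary_row_sum[of u i]
  by (simp add: power_le_one_iff abs_square_le_1)

lemma norm_unitary: "u \<in> unitary_group \<Longrightarrow> norm u = sqrt (CARD('n))" for u :: "complex^'n^'n"
  using norm_matrix_square[of u] by (simp add: unitary_row_sum real_sqrt_unique)

lemma bounded_bilinear_matrix_mult: "bounded_bilinear ((**) :: complex^'n^'n \<Rightarrow> complex^'n^'n \<Rightarrow> _)"
proof (rule bilinear_conv_bounded_bilinear[THEN iffD1])
  show "bilinear ((**) :: complex^'n^'n \<Rightarrow> complex^'n^'n \<Rightarrow> _)"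
    unfolding bilinear_def
    by (auto intro!: linearI simp: vec_eq_iff matrix_matrix_mult_def algebra_simps sum.distrib scaleR_sum_right)
qed

lemmas continuous_on_matrix_mult [continuous_intros] =
  bounded_bilinear.continuous_on[OF bounded_bilinear_matrix_mult]
lemmas tendsto_matrix_mult [tendsto_intros] = bounded_bilinear.tendsto[OF bounded_bilinear_matrix_mult]

lemma bounded_linear_adj: "bounded_linear (adj :: complex^'n^'n \<Rightarrow> _)"
  by (rule linear_conv_bounded_linear[THEN iffD1]) (auto intro!: linearI simp: adj_add adj_scaleR)

lemmas continuous_on_adj [continuous_intros] = bounded_linear.continuous_on[OF bounded_linear_adj]
lemmas tendsto_adj [tendsto_intros] = bounded_linear.tendsto[OF bounded_linear_adj]

lemma compact_unitary_group: "compact (unitary_group :: (complex^'n^'n) set)"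
proof -
  have "closed ((unitary_group :: (complex^'n^'n) set))"
    unfolding unitary_group_def by (intro closed_Collect_conj closed_Collect_eq continuous_intros)
  moreover have "bounded (unitary_group :: (complex^'n^'n) set)"
    unfolding bounded_iff using norm_unitary by (metis order_refl)
  ultimately show ?thesis by (simp add: compact_eq_bounded_closed)
qed

section \<open>The spectral theorem and the singular value decomposition\<close>

text \<open>The inner product \<bullet> is only the real part of this form; orthogonality over the
  complex numbers, as the columns of a unitary matrix require it, needs the whole.\<close>

definition hip :: "complex^'n \<Rightarrow> complex^'n \<Rightarrow> complex" where
  "hip x y = (\<Sum>i\<in>UNIV. x $ i * cnj (y $ i))"

lemma Re_hip: "Re (hip x y) = x \<bullet> y"
  by (simp add: hip_def inner_vec_def inner_complex_def)

lemma hip_self: "hip x x = of_real ((norm x)\<^sup>2)"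
  by (simp add: hip_def norm_vec_def L2_set_def sum_nonneg cmod_square)

lemma hip_matrix: "hip (A *v x) y = hip x (adj A *v y)"
  by (simp add: hip_def matrix_vector_mult_def sum_distrib_left sum_distrib_right mult_ac)
    (subst sum.swap, simp)

lemma hip_simps:
  "hip (x + y) z = hip x z + hip y z" "hip (c *s x) z = c * hip x z" "hip z (c *s x) = cnj c * hip z x"
  "hip (r *\<^sub>R x) z = of_real r * hip x z" "hip z (r *\<^sub>R x) = of_real r * hip z x" "hip z (x + y) = hip z x + hip z y"
  "hip (x - y) z = hip x z - hip y z" "hip z (x - y) = hip z x - hip z y"
  by (simp_all add: hip_def sum.distrib sum_distrib_left sum_subtractf algebra_simps scaleR_conv_of_real[where 'a = complex])

lemma hip_cnj: "cnj (hip x y) = hip y x"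
  by (simp add: hip_def mult.commute)

definition orthonormal_family :: "'n set \<Rightarrow> ('n \<Rightarrow> complex^'n) \<Rightarrow> bool" where
  "orthonormal_family J \<xi> \<longleftrightarrow> (\<forall>i\<in>J. \<forall>j\<in>J. hip (\<xi> i) (\<xi> j) = (if i = j then 1 else 0))"

text \<open>The matrix whose rows are the conjugated vectors for \<open>J\<close> and zero elsewhere
  is singular; a kernel vector is orthogonal to the family.\<close>

lemma orthogonal_vector_exists:
  fixes \<xi> :: "'n \<Rightarrow> complex^'n"
  assumes "J \<noteq> UNIV"
  obtains w where "w \<noteq> 0" "\<And>i. i \<in> J \<Longrightarrow> hip w (\<xi> i) = 0"
proof -
  define A :: "complex^'n^'n" where "A = (\<chi> i. if i \<in> J then (\<chi> j. cnj (\<xi> i $ j)) else 0)"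
  obtain k where "k \<notin> J" using assms by blast
  then have "row k A = 0" by (simp add: row_def A_def vec_eq_iff)
  then have "\<not> invertible A" using det_zero_row(1) by (auto simp: invertible_det_nz)
  then obtain w where w: "w \<noteq> 0" "A *v w = 0"
    by (metis invertible_left_inverse matrix_left_invertible_ker)
  have "hip w (\<xi> i) = (A *v w) $ i" if "i \<in> J" for i
    using that by (simp add: hip_def A_def matrix_vector_mult_def mult.commute)
  with w show thesis using that by simp
qed

lemma orthonormal_family_insert:
  assumes "orthonormal_family J \<xi>" "j \<notin> J" "norm x = 1" "\<And>i. i \<in> J \<Longrightarrow> hip x (\<xi> i) = 0"
  shows "orthonormal_family (insert j J) (\<xi>(j := x))"
proof -
  have "hip (\<xi> i) x = 0" if "i \<in> J" for i using assms(4)[OF that] hip_cnj[of x "\<xi> i"] by simp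
  then show ?thesis using assms by (auto simp: orthonormal_family_def hip_self[of x])
qed

lemma orthonormal_family_extend:
  assumes "orthonormal_family J \<xi>"
  obtains \<xi>' where "orthonormal_family UNIV \<xi>'" "\<And>i. i \<in> J \<Longrightarrow> \<xi>' i = \<xi> i"
proof -
  have "\<exists>\<xi>'. orthonormal_family (J \<union> I) \<xi>' \<and> (\<forall>i\<in>J. \<xi>' i = \<xi> i)" if "finite I" for I
    using that
  proof induction
    case empty
    then show ?case using assms by auto
  next
    case (insert k I)
    then obtain \<xi>' where \<xi>': "orthonormal_family (J \<union> I) \<xi>'" "\<forall>i\<in>J. \<xi>' i = \<xi> i" by blast
    show ?case
    proof (cases "k \<in> J")
      case True
      then show ?thesis using \<xi>' by (auto simp: insert_absorb)
    next
      case False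
      then have "J \<union> I \<noteq> UNIV" "k \<notin> J \<union> I" using insert by auto
      obtain w where w: "w \<noteq> 0" "\<And>i. i \<in> J \<union> I \<Longrightarrow> hip w (\<xi>' i) = 0"
        using orthogonal_vector_exists[OF \<open>J \<union> I \<noteq> UNIV\<close>] by blast
      have "orthonormal_family (insert k (J \<union> I)) (\<xi>'(k := (1 / norm w) *\<^sub>R w))"
        using \<xi>'(1) \<open>k \<notin> J \<union> I\<close> w by (intro orthonormal_family_insert) (auto simp: hip_simps)
      moreover have "\<forall>i\<in>J. (\<xi>'(k := (1 / norm w) *\<^sub>R w)) i = \<xi> i" using \<xi>'(2) False by auto
      ultimately show ?thesis by auto
    qed
  qed
  from this[of UNIV] show thesis using that by auto
qed

lemma unitary_of_orthonormal_family:
  assumes "orthonormal_family UNIV \<xi>"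
  shows "(\<chi> i j. \<xi> j $ i) \<in> unitary_group"
proof (rule unitary_groupI)
  show "adj (\<chi> i j. \<xi> j $ i) ** (\<chi> i j. \<xi> j $ i) = mat 1"
    using assms by (auto simp: vec_eq_iff matrix_matrix_mult_def mat_def orthonormal_family_def hip_def mult.commute)
qed

lemma matrix_vector_scaleR: "m *v (r *\<^sub>R x) = r *\<^sub>R (m *v x)" for m :: "complex^'n^'m"
  by (simp add: vec_eq_iff matrix_vector_mult_def scaleR_sum_right)

text \<open>\<open>h\<close> and \<open>k\<close> are the Hermitian parts in m = h + i k. They
  commute since \<open>m\<close> is normal, so \<open>k\<close> preserves an eigenspace of
  \<open>h\<close> and has an eigenvector there. The invariant subspace \<open>S\<close> is carried
  along for the induction in the spectral theorem.\<close>

lemma normal_eigenvector_exists: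
  fixes m :: "complex^'n^'n"
  assumes normal: "m ** adj m = adj m ** m" and S: "subspace S" and cS: "\<And>x c. x \<in> S \<Longrightarrow> c *s x \<in> S"
    and inv: "\<And>x. x \<in> S \<Longrightarrow> m *v x \<in> S" "\<And>x. x \<in> S \<Longrightarrow> adj m *v x \<in> S" and ne: "w \<in> S" "w \<noteq> 0"
  obtains x c where "x \<in> S" "norm x = 1" "m *v x = c *s x" "adj m *v x = cnj c *s x"
proof -
  define h where "h x = (1/2) *\<^sub>R (m *v x + adj m *v x)" for x
  define k where "k x = (1/2) *\<^sub>R ((- \<i>) *s (m *v x - adj m *v x))" for x
  have lin: "linear h" "linear k"
    unfolding h_def k_def
    by (auto intro!: linearI simp: matrix_vector_right_distrib vec_eq_iff matrix_vector_mult_def sum.distrib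
        scaleR_sum_right sum_subtractf algebra_simps scaleR_conv_of_real[where 'a = complex] sum_distrib_left sum_divide_distrib)
  have sa: "(m *v x) \<bullet> y = x \<bullet> (adj m *v y)" "(adj m *v x) \<bullet> y = x \<bullet> (m *v y)" for x y
    using hip_matrix[of m x y] hip_matrix[of "adj m" x y] by (simp_all add: Re_hip[symmetric])
  have h_sa: "h x \<bullet> y = x \<bullet> h y" for x y
    unfolding h_def by (simp add: inner_add_left inner_add_right sa)
  have k_sa: "k x \<bullet> y = x \<bullet> k y" for x y
    by (simp add: Re_hip[symmetric] k_def hip_simps hip_matrix)
  have hS: "h x \<in> S" "k x \<in> S" if "x \<in> S" for x
    unfolding h_def k_def by (intro subspace_scale[OF S] subspace_add[OF S] subspace_diff[OF S] cS inv that)+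
  obtain x0 a where x0: "x0 \<in> S" "norm x0 = 1" "h x0 = a *\<^sub>R x0"
    using self_adjoint_eigenvector_exists[OF lin(1) h_sa S hS(1) ne] by blast
  define T where "T = {x \<in> S. h x = a *\<^sub>R x}"
  have T: "subspace T"
    using S lin(1) unfolding T_def subspace_def
    by (auto simp: linear_0 linear_add linear_scale scaleR_right_distrib)
  have comm: "m *v (adj m *v x) = adj m *v (m *v x)" for x
    by (simp add: matrix_vector_mul_assoc normal)
  have "h (m *v x) = m *v h x" "h (adj m *v x) = adj m *v h x" for x
    unfolding h_def by (simp_all add: comm matrix_vector_right_distrib matrix_vector_scaleR)
  then have "m *v x \<in> T" "adj m *v x \<in> T" if "x \<in> T" for x
    using that inv by (auto simp: T_def matrix_vector_scaleR)
  moreover have "c *s x \<in> T" if "x \<in> T" for c x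
  proof -
    have "h (c *s x) = c *s h x"
      unfolding h_def by (simp add: vec_eq_iff matrix_vector_mult_def sum_distrib_left algebra_simps scaleR_conv_of_real[where 'a = complex])
    then show ?thesis using that cS by (auto simp: T_def vec_eq_iff scaleR_conv_of_real[where 'a = complex])
  qed
  ultimately have kT: "k x \<in> T" if "x \<in> T" for x
    using that unfolding k_def by (auto intro!: subspace_scale[OF T] subspace_diff[OF T])
  have "x0 \<in> T" "x0 \<noteq> 0" using x0 by (auto simp: T_def)
  from self_adjoint_eigenvector_exists[OF lin(2) k_sa T kT this]
  obtain x b where x: "x \<in> T" "norm x = 1" "k x = b *\<^sub>R x" by blast
  have dec: "m *v x = h x + \<i> *s k x" "adj m *v x = h x - \<i> *s k x"
    by (simp_all add: h_def k_def vec_eq_iff scaleR_conv_of_real[where 'a = complex] field_simps)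
  show thesis
  proof (rule that[of x "Complex a b"])
    show "x \<in> S" "norm x = 1" using x by (auto simp: T_def)
    show "m *v x = Complex a b *s x" "adj m *v x = cnj (Complex a b) *s x"
      unfolding dec using x by (simp_all add: T_def vec_eq_iff scaleR_conv_of_real[where 'a = complex] complex_eq_iff)
  qed
qed

text \<open>The eigenvectors are chosen common to \<open>m\<close> and \<open>adj m\<close>, so that
  the orthogonal complement of those already found is invariant under both.\<close>

theorem normal_spectral_theorem:
  fixes m :: "complex^'n^'n"
  assumes normal: "m ** adj m = adj m ** m"
  obtains u c where "u \<in> unitary_group" "m = u ** dg c ** adj u"
proof -
  have "\<exists>\<xi> c. orthonormal_family J \<xi> \<and> (\<forall>i\<in>J. m *v \<xi> i = c i *s \<xi> i \<and> adj m *v \<xi> i = cnj (c i) *s \<xi> i)"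
    if "finite J" for J :: "'n set"
    using that
  proof induction
    case (insert j J)
    then obtain \<xi> c where \<xi>: "orthonormal_family J \<xi>"
      "\<And>i. i \<in> J \<Longrightarrow> m *v \<xi> i = c i *s \<xi> i \<and> adj m *v \<xi> i = cnj (c i) *s \<xi> i" by blast
    define S where "S = {w. \<forall>i\<in>J. hip w (\<xi> i) = 0}"
    have "J \<noteq> UNIV" using insert by auto
    then obtain w where w: "w \<in> S" "w \<noteq> 0"
      unfolding S_def by (rule orthogonal_vector_exists[of J \<xi>]) blast
    have "subspace S" by (auto simp: S_def subspace_def hip_simps hip_def[of 0])
    moreover have "c *s x \<in> S" "m *v x \<in> S" "adj m *v x \<in> S" if "x \<in> S" for x c
      using that by (auto simp: S_def hip_simps hip_matrix \<xi>(2))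
    ultimately obtain x b where x: "x \<in> S" "norm x = 1" "m *v x = b *s x" "adj m *v x = cnj b *s x"
      using normal_eigenvector_exists[OF normal _ _ _ _ w] by metis
    have "orthonormal_family (insert j J) (\<xi>(j := x))"
      using \<xi>(1) insert(2) x(1,2) by (intro orthonormal_family_insert) (auto simp: S_def)
    moreover have "\<forall>i\<in>insert j J. m *v (\<xi>(j := x)) i = (c(j := b)) i *s (\<xi>(j := x)) i \<and>
        adj m *v (\<xi>(j := x)) i = cnj ((c(j := b)) i) *s (\<xi>(j := x)) i"
      using \<xi>(2) x insert(2) by auto
    ultimately show ?case by blast
  qed (auto simp: orthonormal_family_def)
  from this[of UNIV] obtain \<xi> c where \<xi>: "orthonormal_family UNIV \<xi>" "\<And>i. m *v \<xi> i = c i *s \<xi> i" by auto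
  define u :: "complex^'n^'n" where "u = (\<chi> i j. \<xi> j $ i)"
  have u: "u \<in> unitary_group" unfolding u_def by (rule unitary_of_orthonormal_family[OF \<xi>(1)])
  have "m ** u = u ** dg (\<chi> i. c i)"
    unfolding vec_eq_iff mult_dg_nth using \<xi>(2)
    by (simp add: u_def matrix_matrix_mult_def matrix_vector_mult_def vec_eq_iff mult.commute)
  then have "m = u ** dg (\<chi> i. c i) ** adj u"
    using unitary_cancel(3)[OF u, of m] by simp
  then show thesis using that[OF u] by blast
qed

text \<open>If \<open>v\<close> diagonalises \<open>adj m ** m\<close>, the columns of
  \<open>m ** v\<close> are orthogonal and their lengths are the singular numbers. The nonzero
  columns are normalised and completed to a unitary \<open>p\<close>; the new columns are multiplied
  by \<open>d $ j = 0\<close>.\<close>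

theorem singular_value_decomposition:
  fixes m :: "complex^'n^'n"
  obtains p q :: "complex^'n^'n" and d :: "real^'n" where "p \<in> unitary_group" "q \<in> unitary_group" "\<And>i. 0 \<le> d $ i"
    "m = p ** dg (\<chi> i. complex_of_real (d $ i)) ** q"
proof -
  define H where "H = adj m ** m"
  have "adj H = H" by (simp add: H_def adj_mult)
  then obtain v c where v: "v \<in> unitary_group" and H: "H = v ** dg c ** adj v"
    using normal_spectral_theorem[of H] by metis
  define B where "B = m ** v"
  have BB: "adj B ** B = dg c"
  proof -
    have "adj B ** B = adj v ** H ** v" by (simp add: B_def H_def adj_mult matrix_mul_assoc)
    also have "\<dots> = dg c" unfolding H by (simp add: matrix_mul_assoc[symmetric] unitary_cancel[OF v] unitary_adj_mult[OF v])
    finally show ?thesis .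
  qed
  define b where "b j = (\<chi> i. B $ i $ j)" for j
  have hip_b: "hip (b j) (b k) = (if j = k then c $ j else 0)" for j k
  proof -
    have "(adj B ** B) $ k $ j = hip (b j) (b k)"
      by (simp add: matrix_matrix_mult_def hip_def b_def mult.commute)
    then show ?thesis unfolding BB by auto
  qed
  define d :: "real^'n" where "d = (\<chi> j. norm (b j))"
  have c: "c $ j = of_real ((d $ j)\<^sup>2)" for j using hip_b[of j j] by (simp add: hip_self d_def)
  define J where "J = {j. d $ j \<noteq> 0}"
  have "orthonormal_family J (\<lambda>j. (1 / d $ j) *\<^sub>R b j)"
  proof -
    have "hip ((1 / d $ j) *\<^sub>R b j) ((1 / d $ k) *\<^sub>R b k) = of_real (1 / d $ j) * of_real (1 / d $ k) * hip (b j) (b k)" for j k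
      by (simp add: hip_def sum_distrib_left scaleR_conv_of_real[where 'a = complex] mult_ac)
    then show ?thesis
      by (auto simp: orthonormal_family_def J_def hip_b c power2_eq_square)
  qed
  then obtain \<xi> where \<xi>: "orthonormal_family UNIV \<xi>" "\<And>j. j \<in> J \<Longrightarrow> \<xi> j = (1 / d $ j) *\<^sub>R b j"
    by (rule orthonormal_family_extend) blast
  define p :: "complex^'n^'n" where "p = (\<chi> i j. \<xi> j $ i)"
  have p: "p \<in> unitary_group" unfolding p_def by (rule unitary_of_orthonormal_family[OF \<xi>(1)])
  have "p ** dg (\<chi> i. complex_of_real (d $ i)) = B"
  proof -
    have "\<xi> j $ i * complex_of_real (d $ j) = b j $ i" for i j
      by (cases "j \<in> J") (auto simp: \<xi>(2) J_def scaleR_conv_of_real[where 'a = complex] d_def)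
    then show ?thesis by (simp add: vec_eq_iff mult_dg_nth p_def b_def)
  qed
  then have "m = p ** dg (\<chi> i. complex_of_real (d $ i)) ** adj v"
    using unitary_cancel(3)[OF v, of m] by (simp add: B_def)
  then show thesis using that[OF p unitary_adj[OF v], of d] by (simp add: d_def)
qed

section \<open>Rearrangement\<close>

text \<open>Some permutation maximises the sum of \<open>a k * s (\<pi> k)\<close>; exchanging two
  badly ordered values would increase it.\<close>

lemma similarly_ordered_permutation:
  fixes a s :: "'n::finite \<Rightarrow> real"
  obtains \<pi> where "bij \<pi>" "\<And>i j. a i < a j \<Longrightarrow> s (\<pi> i) \<le> s (\<pi> j)"
proof -
  define f where "f \<pi> = (\<Sum>k\<in>UNIV. a k * s (\<pi> k))" for \<pi> :: "'n \<Rightarrow> 'n"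
  have "finite {\<pi> :: 'n \<Rightarrow> 'n. bij \<pi>}" "{\<pi> :: 'n \<Rightarrow> 'n. bij \<pi>} \<noteq> {}" by (auto intro: exI[of _ id])
  then obtain \<pi> where \<pi>: "bij \<pi>" "\<And>\<pi>'. bij \<pi>' \<Longrightarrow> f \<pi>' \<le> f \<pi>"
    using obtains_MAX[of "{\<pi> :: 'n \<Rightarrow> 'n. bij \<pi>}" f] Max_ge[of "f ` {\<pi> :: 'n \<Rightarrow> 'n. bij \<pi>}"]
    by (metis (no_types, lifting) finite_imageI imageI mem_Collect_eq)
  show thesis
  proof (rule that[OF \<pi>(1)])
    fix i j assume ij: "a i < a j"
    then have "i \<noteq> j" by auto
    define \<pi>' where "\<pi>' = \<pi> \<circ> Transposition.transpose i j"
    have "bij \<pi>'" unfolding \<pi>'_def using \<pi>(1) by (intro bij_comp) simp_all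
    have split: "f \<tau> = a i * s (\<tau> i) + a j * s (\<tau> j) + (\<Sum>k\<in>UNIV - {i} - {j}. a k * s (\<tau> k))" for \<tau>
      unfolding f_def using \<open>i \<noteq> j\<close>
      by (subst sum.remove[of _ i], simp, simp, subst sum.remove[of _ j]) auto
    have "(\<Sum>k\<in>UNIV - {i} - {j}. a k * s (\<pi>' k)) = (\<Sum>k\<in>UNIV - {i} - {j}. a k * s (\<pi> k))"
      by (intro sum.cong) (auto simp: \<pi>'_def Transposition.transpose_def)
    with \<pi>(2)[OF \<open>bij \<pi>'\<close>] have "a i * s (\<pi> j) + a j * s (\<pi> i) \<le> a i * s (\<pi> i) + a j * s (\<pi> j)"
      unfolding split by (simp add: \<pi>'_def)
    then have "(a j - a i) * (s (\<pi> i) - s (\<pi> j)) \<le> 0" by (simp add: algebra_simps)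
    with ij show "s (\<pi> i) \<le> s (\<pi> j)" by (simp add: mult_le_0_iff)
  qed
qed

definition doubly_stochastic :: "('n::finite \<Rightarrow> 'n \<Rightarrow> real) \<Rightarrow> bool" where
  "doubly_stochastic w \<longleftrightarrow> (\<forall>i j. 0 \<le> w i j) \<and> (\<forall>i. (\<Sum>j\<in>UNIV. w i j) = 1) \<and> (\<forall>j. (\<Sum>i\<in>UNIV. w i j) = 1)"

text \<open>With \<tau> the least value of \<open>s\<close> on \<open>J\<close>, the partial column
  sums \<open>W j\<close> lie between 0 and 1, so \<open>W j * (s j - \<tau>)\<close> is at most
  \<open>s j - \<tau>\<close> on \<open>J\<close> and at most 0 elsewhere.\<close>

lemma doubly_stochastic_top_set:
  fixes s :: "'n::finite \<Rightarrow> real"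
  assumes w: "doubly_stochastic w" and J: "\<And>i j. i \<in> J \<Longrightarrow> j \<notin> J \<Longrightarrow> s j \<le> s i"
  shows "(\<Sum>i\<in>J. \<Sum>j\<in>UNIV. w i j * s j) \<le> (\<Sum>i\<in>J. s i)"
proof (cases "J = {}")
  case False
  define \<tau> where "\<tau> = Min (s ` J)"
  have \<tau>: "\<tau> \<le> s i" if "i \<in> J" for i using that by (simp add: \<tau>_def)
  have "\<tau> \<in> s ` J" unfolding \<tau>_def by (rule Min_in) (use False in auto)
  then have \<tau>': "s j \<le> \<tau>" if "j \<notin> J" for j using J that by auto
  define W where "W j = (\<Sum>i\<in>J. w i j)" for j
  have W: "0 \<le> W j" "W j \<le> 1" for j
  proof -
    show "0 \<le> W j" using w by (auto simp: W_def doubly_stochastic_def intro: sum_nonneg)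
    have "W j \<le> (\<Sum>i\<in>UNIV. w i j)" unfolding W_def
      using w by (intro sum_mono2) (auto simp: doubly_stochastic_def)
    then show "W j \<le> 1" using w by (simp add: doubly_stochastic_def)
  qed
  have row: "(\<Sum>j\<in>UNIV. w i j * (s j - \<tau>)) = (\<Sum>j\<in>UNIV. w i j * s j) - \<tau>" for i
  proof -
    have "(\<Sum>j\<in>UNIV. w i j * \<tau>) = \<tau>"
      unfolding sum_distrib_right[symmetric] using w by (simp add: doubly_stochastic_def)
    then show ?thesis by (simp add: right_diff_distrib sum_subtractf)
  qed
  have "(\<Sum>i\<in>J. (\<Sum>j\<in>UNIV. w i j * s j) - \<tau>) = (\<Sum>j\<in>UNIV. W j * (s j - \<tau>))"
    unfolding row[symmetric] W_def sum_distrib_right by (rule sum.swap)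
  also have "\<dots> \<le> (\<Sum>j\<in>UNIV. if j \<in> J then s j - \<tau> else 0)"
  proof (rule sum_mono)
    fix j show "W j * (s j - \<tau>) \<le> (if j \<in> J then s j - \<tau> else 0)"
      using W[of j] \<tau>[of j] \<tau>'[of j] mult_right_mono[of "W j" 1 "s j - \<tau>"] mult_nonneg_nonpos[of "W j" "s j - \<tau>"]
      by auto
  qed
  also have "\<dots> = (\<Sum>j\<in>J. s j - \<tau>)" by (simp add: sum.If_cases)
  finally show ?thesis by (simp add: sum_subtractf)
qed simp

text \<open>Abel summation over the level sets of \<open>a\<close>: lowering the top value to the
  next one splits off a multiple of the indicator of the top set, to which
  \<open>doubly_stochastic_top_set\<close> applies.\<close>

lemma doubly_stochastic_similarly_ordered:
  fixes a s :: "'n::finite \<Rightarrow> real"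
  assumes w: "doubly_stochastic w" and "\<And>i j. a i < a j \<Longrightarrow> s i \<le> s j"
  shows "(\<Sum>i\<in>UNIV. a i * (\<Sum>j\<in>UNIV. w i j * s j)) \<le> (\<Sum>i\<in>UNIV. a i * s i)"
  using assms(2)
proof (induction "card (range a)" arbitrary: a rule: less_induct)
  case less
  define A where "A = Max (range a)"
  have A: "a i \<le> A" for i by (simp add: A_def)
  have "A \<in> range a" unfolding A_def by (rule Max_in) auto
  show ?case
  proof (cases "range a = {A}")
    case True
    then have a: "a i = A" for i by auto
    have "(\<Sum>i\<in>UNIV. \<Sum>j\<in>UNIV. w i j * s j) = (\<Sum>j\<in>UNIV. s j)"
      by (subst sum.swap, unfold sum_distrib_right[symmetric]) (use w in \<open>simp add: doubly_stochastic_def\<close>)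
    then show ?thesis by (simp add: a sum_distrib_left[symmetric])
  next
    case False
    define R where "R = range a - {A}"
    define B where "B = Max R"
    have R: "finite R" "R \<noteq> {}" using False \<open>A \<in> range a\<close> by (auto simp: R_def)
    have "B \<in> R" unfolding B_def by (rule Max_in[OF R])
    have leB: "a i \<le> B" if "a i \<noteq> A" for i unfolding B_def using that R by (intro Max_ge) (auto simp: R_def)
    have "B < A" using \<open>B \<in> R\<close> A by (auto simp: R_def order.not_eq_order_implies_strict)
    define J where "J = {i. a i = A}"
    define a' where "a' i = (if i \<in> J then B else a i)" for i
    have "range a' = R"
      using \<open>B \<in> R\<close> by (auto simp: a'_def J_def R_def image_iff)
    then have "card (range a') < card (range a)"
      unfolding \<open>range a' = R\<close> R_def using \<open>A \<in> range a\<close> by (intro card_Diff1_less) auto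
    moreover have "s i \<le> s j" if "a' i < a' j" for i j
    proof (rule less.prems)
      show "a i < a j"
        using that A[of i] A[of j] leB[of i] leB[of j] \<open>B < A\<close>
        by (auto simp: a'_def J_def less_le split: if_splits)
    qed
    ultimately have IH: "(\<Sum>i\<in>UNIV. a' i * (\<Sum>j\<in>UNIV. w i j * s j)) \<le> (\<Sum>i\<in>UNIV. a' i * s i)"
      by (rule less.hyps)
    have top: "(\<Sum>i\<in>J. \<Sum>j\<in>UNIV. w i j * s j) \<le> (\<Sum>i\<in>J. s i)"
      by (rule doubly_stochastic_top_set[OF w], rule less.prems)
        (use A in \<open>auto simp: J_def order.not_eq_order_implies_strict\<close>)
    have dec: "(\<Sum>i\<in>UNIV. a i * f i) = (\<Sum>i\<in>UNIV. a' i * f i) + (A - B) * (\<Sum>i\<in>J. f i)" for f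
    proof -
      have "a i * f i = a' i * f i + (if i \<in> J then (A - B) * f i else 0)" for i
        by (auto simp: a'_def J_def algebra_simps)
      then show ?thesis by (simp add: sum.distrib sum.If_cases sum_distrib_left)
    qed
    show ?thesis unfolding dec
      using IH mult_left_mono[OF top, of "A - B"] \<open>B < A\<close> by linarith
  qed
qed

text \<open>One permutation serves every \<open>w\<close>. This uniformity is essential, as
  \<open>w\<close> will come from arbitrary diagonalisations of neighbouring matrices.\<close>

lemma doubly_stochastic_rearrangement:
  fixes a s :: "'n::finite \<Rightarrow> real"
  obtains \<pi> where "bij \<pi>" "\<And>w. doubly_stochastic w \<Longrightarrow>
    (\<Sum>i\<in>UNIV. a i * (\<Sum>j\<in>UNIV. w i j * s j)) \<le> (\<Sum>i\<in>UNIV. a i * s (\<pi> i))"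
proof -
  obtain \<pi> where \<pi>: "bij \<pi>" "\<And>i j. a i < a j \<Longrightarrow> s (\<pi> i) \<le> s (\<pi> j)"
    by (rule similarly_ordered_permutation[of a s]) blast
  have "(\<Sum>i\<in>UNIV. a i * (\<Sum>j\<in>UNIV. w i j * s j)) \<le> (\<Sum>i\<in>UNIV. a i * s (\<pi> i))"
    if w: "doubly_stochastic w" for w
  proof -
    have re: "(\<Sum>j\<in>UNIV. f (\<pi> j)) = (\<Sum>j\<in>UNIV. f j)" for f :: "'n \<Rightarrow> real"
      using \<pi>(1) by (rule sum.reindex_bij_betw)
    have "doubly_stochastic (\<lambda>i j. w i (\<pi> j))"
      using w re[of "w _"] by (simp add: doubly_stochastic_def)
    from doubly_stochastic_similarly_ordered[where s = "\<lambda>j. s (\<pi> j)" and a = a, OF this \<pi>(2)]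
    show ?thesis using re[of "\<lambda>j. w _ j * s j"] by simp
  qed
  with \<pi>(1) show thesis by (rule that)
qed

section \<open>Dual norms\<close>

text \<open>For nonnegative \<open>a\<close> this is the sum of the decreasing weights times the
  decreasing singular numbers, by von Neumann's trace inequality. Written as a supremum of linear
  functionals it is visibly sublinear.\<close>

definition dual_norm :: "real^'n \<Rightarrow> complex^'n^'n \<Rightarrow> real" where
  "dual_norm a m = (SUP (p, q)\<in>unitary_group \<times> unitary_group. \<Sum>i\<in>UNIV. a $ i * Re ((p ** m ** q) $ i $ i))"

definition abs_sum :: "real^'n \<Rightarrow> real" where
  "abs_sum a = (\<Sum>i\<in>UNIV. \<bar>a $ i\<bar>)"

lemma abs_sum_nonneg: "0 \<le> abs_sum a" by (simp add: abs_sum_def sum_nonneg)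

lemma weighted_trace_le:
  assumes "p \<in> unitary_group" "q \<in> unitary_group"
  shows "\<bar>\<Sum>i\<in>UNIV. a $ i * Re ((p ** m ** q) $ i $ i)\<bar> \<le> abs_sum a * norm m"
proof -
  have "\<bar>Re ((p ** m ** q) $ i $ i)\<bar> \<le> norm m" for i
    using abs_Re_le_cmod[of "(p ** m ** q) $ i $ i"] Finite_Cartesian_Product.norm_nth_le[of "(p ** m ** q) $ i" i]
      Finite_Cartesian_Product.norm_nth_le[of "p ** m ** q" i] norm_unitary_mult[OF assms(1), of m]
      norm_mult_unitary[OF assms(2), of "p ** m"] by linarith
  then show ?thesis
    unfolding abs_sum_def sum_distrib_right
    by (intro order.trans[OF sum_abs] sum_mono) (simp add: abs_mult mult_left_mono)
qed

lemma weighted_trace_le_dual_norm: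
  assumes "p \<in> unitary_group" "q \<in> unitary_group"
  shows "(\<Sum>i\<in>UNIV. a $ i * Re ((p ** m ** q) $ i $ i)) \<le> dual_norm a m"
proof -
  have "bdd_above ((\<lambda>(p, q). \<Sum>i\<in>UNIV. a $ i * Re ((p ** m ** q) $ i $ i)) ` (unitary_group \<times> unitary_group))"
    using weighted_trace_le by (intro bdd_aboveI[of _ "abs_sum a * norm m"]) (fastforce simp: abs_le_iff)
  from cSUP_upper[OF _ this, of "(p, q)"] show ?thesis unfolding dual_norm_def using assms by simp
qed

lemma dual_norm_least:
  assumes "\<And>p q. p \<in> unitary_group \<Longrightarrow> q \<in> unitary_group \<Longrightarrow> (\<Sum>i\<in>UNIV. a $ i * Re ((p ** m ** q) $ i $ i)) \<le> B"
  shows "dual_norm a m \<le> B"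
  unfolding dual_norm_def using assms unitary_mat_1 by (intro cSUP_least) auto

lemma abs_dual_norm_le: "\<bar>dual_norm a m\<bar> \<le> abs_sum a * norm m"
proof (rule abs_leI)
  show "dual_norm a m \<le> abs_sum a * norm m"
    by (rule dual_norm_least) (use weighted_trace_le in \<open>force simp: abs_le_iff\<close>)
  show "- dual_norm a m \<le> abs_sum a * norm m"
    using weighted_trace_le_dual_norm[OF unitary_mat_1 unitary_mat_1, of a m]
      weighted_trace_le[OF unitary_mat_1 unitary_mat_1, of a m] by linarith
qed

lemma dual_norm_triangle: "dual_norm a (m + m') \<le> dual_norm a m + dual_norm a m'"
proof (rule dual_norm_least)
  fix p q :: "complex^'a^'a" assume pq: "p \<in> unitary_group" "q \<in> unitary_group"
  have "p ** (m + m') ** q = p ** m ** q + p ** m' ** q"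
    by (simp add: bounded_bilinear.add_left[OF bounded_bilinear_matrix_mult] bounded_bilinear.add_right[OF bounded_bilinear_matrix_mult])
  then have "(\<Sum>i\<in>UNIV. a $ i * Re ((p ** (m + m') ** q) $ i $ i)) =
     (\<Sum>i\<in>UNIV. a $ i * Re ((p ** m ** q) $ i $ i)) + (\<Sum>i\<in>UNIV. a $ i * Re ((p ** m' ** q) $ i $ i))"
    by (simp add: distrib_left sum.distrib)
  then show "(\<Sum>i\<in>UNIV. a $ i * Re ((p ** (m + m') ** q) $ i $ i)) \<le> dual_norm a m + dual_norm a m'"
    using weighted_trace_le_dual_norm[OF pq, of a m] weighted_trace_le_dual_norm[OF pq, of a m'] by linarith
qed

lemma continuous_on_dual_norm: "continuous_on S (dual_norm a)"
proof -
  have lip: "\<bar>dual_norm a m - dual_norm a m'\<bar> \<le> abs_sum a * norm (m - m')" for m m'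
    using dual_norm_triangle[of a "m - m'" m'] dual_norm_triangle[of a "m' - m" m]
      abs_dual_norm_le[of a "m - m'"] abs_dual_norm_le[of a "m' - m"] by (simp add: norm_minus_commute)
  have "(abs_sum a)-lipschitz_on S (dual_norm a)"
    by (rule lipschitz_onI) (use lip abs_sum_nonneg in \<open>auto simp: dist_norm\<close>)
  then show ?thesis by (rule lipschitz_on_continuous_on)
qed

text \<open>The upper half of von Neumann's trace inequality. Products of moduli of entries of
  \<open>P\<close> and \<open>Q\<close> are bounded by the means of their squares, and these means
  form a doubly stochastic matrix.\<close>

lemma dual_norm_svd_le:
  fixes a d :: "real^'n"
  assumes a: "\<And>i. 0 \<le> a $ i" and d: "\<And>i. 0 \<le> d $ i"
  obtains \<pi> where "bij \<pi>" "\<And>p q. p \<in> unitary_group \<Longrightarrow> q \<in> unitary_group \<Longrightarrow>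
     dual_norm a (p ** dg (\<chi> i. complex_of_real (d $ i)) ** q) \<le> (\<Sum>i\<in>UNIV. a $ i * d $ \<pi> i)"
proof -
  obtain \<pi> where \<pi>: "bij \<pi>" "\<And>w. doubly_stochastic w \<Longrightarrow>
    (\<Sum>i\<in>UNIV. a $ i * (\<Sum>j\<in>UNIV. w i j * d $ j)) \<le> (\<Sum>i\<in>UNIV. a $ i * d $ \<pi> i)"
    by (rule doubly_stochastic_rearrangement[of "\<lambda>i. a $ i" "\<lambda>i. d $ i"]) blast
  show thesis
  proof (rule that[OF \<pi>(1)], rule dual_norm_least)
    fix p q p' q' :: "complex^'n^'n"
    assume U: "p \<in> unitary_group" "q \<in> unitary_group" "p' \<in> unitary_group" "q' \<in> unitary_group"
    define P where "P = p' ** p"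
    define Q where "Q = q ** q'"
    have PQ: "P \<in> unitary_group" "Q \<in> unitary_group" using U by (simp_all add: P_def Q_def unitary_mult)
    define w where "w i k = ((norm (P $ i $ k))\<^sup>2 + (norm (Q $ k $ i))\<^sup>2) / 2" for i k
    have "doubly_stochastic w"
      by (simp add: doubly_stochastic_def w_def sum.distrib sum_divide_distrib[symmetric]
          unitary_row_sum[OF PQ(1)] unitary_row_sum[OF PQ(2)] unitary_column_sum[OF PQ(1)] unitary_column_sum[OF PQ(2)])
    have entry: "Re ((p' ** (p ** dg (\<chi> i. complex_of_real (d $ i)) ** q) ** q') $ i $ i) \<le> (\<Sum>k\<in>UNIV. w i k * d $ k)" for i
    proof -
      have "p' ** (p ** dg (\<chi> i. complex_of_real (d $ i)) ** q) ** q' = P ** dg (\<chi> i. complex_of_real (d $ i)) ** Q"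
        by (simp add: P_def Q_def matrix_mul_assoc)
      then have "Re ((p' ** (p ** dg (\<chi> i. complex_of_real (d $ i)) ** q) ** q') $ i $ i) =
          (\<Sum>k\<in>UNIV. Re (P $ i $ k * complex_of_real (d $ k) * Q $ k $ i))"
        by (simp add: mult_dg_mult_nth)
      also have "\<dots> \<le> (\<Sum>k\<in>UNIV. w i k * d $ k)"
      proof (rule sum_mono)
        fix k
        have "Re (P $ i $ k * complex_of_real (d $ k) * Q $ k $ i) \<le> norm (P $ i $ k) * norm (Q $ k $ i) * d $ k"
          using complex_Re_le_cmod[of "P $ i $ k * complex_of_real (d $ k) * Q $ k $ i"] d[of k] by (simp add: norm_mult mult_ac)
        also have "norm (P $ i $ k) * norm (Q $ k $ i) \<le> w i k"
          using sum_squares_bound[of "norm (P $ i $ k)" "norm (Q $ k $ i)"] by (simp add: w_def)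
        finally show "Re (P $ i $ k * complex_of_real (d $ k) * Q $ k $ i) \<le> w i k * d $ k"
          using d[of k] by (meson mult_right_mono order_trans)
      qed
      finally show ?thesis .
    qed
    have "(\<Sum>i\<in>UNIV. a $ i * Re ((p' ** (p ** dg (\<chi> i. complex_of_real (d $ i)) ** q) ** q') $ i $ i)) \<le>
        (\<Sum>i\<in>UNIV. a $ i * (\<Sum>k\<in>UNIV. w i k * d $ k))"
      by (intro sum_mono mult_left_mono entry a)
    also have "\<dots> \<le> (\<Sum>i\<in>UNIV. a $ i * d $ \<pi> i)" by (rule \<pi>(2)) fact
    finally show "(\<Sum>i\<in>UNIV. a $ i * Re ((p' ** (p ** dg (\<chi> i. complex_of_real (d $ i)) ** q) ** q') $ i $ i)) \<le>
       (\<Sum>i\<in>UNIV. a $ i * d $ \<pi> i)" .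
  qed
qed

text \<open>Jensen's inequality: each functional in the supremum is linear in the matrix and so
  commutes with the integral.\<close>

lemma dual_norm_integral_le:
  fixes f :: "real \<Rightarrow> complex^'n^'n"
  assumes f: "f integrable_on S" and df: "(\<lambda>t. dual_norm a (f t)) integrable_on S"
  shows "dual_norm a (integral S f) \<le> integral S (\<lambda>t. dual_norm a (f t))"
proof (rule dual_norm_least)
  fix p q :: "complex^'n^'n" assume pq: "p \<in> unitary_group" "q \<in> unitary_group"
  define L where "L m = (\<Sum>i\<in>UNIV. a $ i * Re ((p ** m ** q) $ i $ i))" for m
  have "linear L"
    unfolding L_def
    by (rule linearI)
      (simp_all add: bounded_bilinear.add_left[OF bounded_bilinear_matrix_mult] bounded_bilinear.add_right[OF bounded_bilinear_matrix_mult]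
        bounded_bilinear.scaleR_left[OF bounded_bilinear_matrix_mult] bounded_bilinear.scaleR_right[OF bounded_bilinear_matrix_mult]
        distrib_left sum.distrib sum_distrib_left mult_ac)
  then have L: "bounded_linear L" by (simp add: linear_conv_bounded_linear)
  have "L (integral S f) = integral S (L \<circ> f)" using integral_linear[OF f L] by simp
  also have "\<dots> \<le> integral S (\<lambda>t. dual_norm a (f t))"
    using integrable_linear[OF f L] df weighted_trace_le_dual_norm[OF pq, of a]
    by (intro integral_le) (auto simp: L_def)
  finally show "(\<Sum>i\<in>UNIV. a $ i * Re ((p ** integral S f ** q) $ i $ i)) \<le> integral S (\<lambda>t. dual_norm a (f t))"
    by (simp add: L_def)
qed

section \<open>Eigenangles of unitary matrices\<close>

definition cis_diag :: "real^'n \<Rightarrow> complex^'n^'n" where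
  "cis_diag \<theta> = dg (\<chi> i. cis (\<theta> $ i))"

definition angles :: "complex^'n^'n \<Rightarrow> complex^'n^'n \<Rightarrow> real^'n \<Rightarrow> bool" where
  "angles g u \<theta> \<longleftrightarrow> u \<in> unitary_group \<and> (\<forall>i. \<bar>\<theta> $ i\<bar> \<le> pi) \<and> g = u ** cis_diag \<theta> ** adj u"

lemma unitary_cis_diag: "cis_diag \<theta> \<in> unitary_group"
  unfolding cis_diag_def by (rule unitary_dg) simp

lemma angles_exist:
  assumes g: "g \<in> unitary_group"
  obtains u \<theta> where "angles g u \<theta>"
proof -
  obtain u c where u: "u \<in> unitary_group" and g': "g = u ** dg c ** adj u"
    using normal_spectral_theorem[of g] g by (auto simp: unitary_adj_mult unitary_mult_adj)
  have "dg c = adj u ** g ** u"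
    unfolding g' by (simp add: matrix_mul_assoc[symmetric] unitary_cancel[OF u] unitary_adj_mult[OF u])
  then have "dg c \<in> unitary_group" using u g by (simp add: unitary_mult unitary_adj)
  have c: "norm (c $ i) = 1" for i
  proof -
    have "(\<Sum>j\<in>UNIV. (norm (dg c $ i $ j))\<^sup>2) = (norm (c $ i))\<^sup>2"
      by (simp add: if_distrib[of norm] if_distrib[of "\<lambda>x. x\<^sup>2"] cong: if_cong)
    with unitary_row_sum[OF \<open>dg c \<in> unitary_group\<close>, of i] show ?thesis by (simp add: power2_eq_1_iff)
      (metis norm_ge_zero not_one_le_zero neg_0_le_iff_le)
  qed
  have "cis (Arg (c $ i)) = c $ i" for i
  proof -
    have "c $ i \<noteq> 0" using c[of i] by auto
    from cis_Arg[OF this] show ?thesis by (simp add: sgn_div_norm c)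
  qed
  then have "angles g u (\<chi> i. Arg (c $ i))"
    using u g' Arg_bounded by (auto simp: angles_def cis_diag_def abs_le_iff less_imp_le minus_le_iff)
  then show thesis by (rule that)
qed

lemma angles_permute:
  fixes g u :: "complex^'n^'n" and \<theta> :: "real^'n"
  assumes "angles g u \<theta>" "bij \<pi>"
  shows "angles g (\<chi> i j. u $ i $ \<pi> j) (\<chi> i. \<theta> $ \<pi> i)"
  unfolding angles_def
proof (intro conjI allI)
  let ?v = "\<chi> i j. u $ i $ \<pi> j"
  have re: "(\<Sum>k\<in>UNIV. f (\<pi> k)) = (\<Sum>k\<in>UNIV. f k)" for f :: "'n \<Rightarrow> complex"
    using assms(2) by (rule sum.reindex_bij_betw)
  have u: "u \<in> unitary_group" using assms(1) by (simp add: angles_def)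
  have "?v ** adj ?v = mat 1"
    using unitary_mult_adj[OF u] re[of "\<lambda>k. u $ _ $ k * cnj (u $ _ $ k)"]
    by (simp add: vec_eq_iff matrix_matrix_mult_def)
  then show "?v \<in> unitary_group" unfolding unitary_group_def using matrix_left_right_inverse by blast
  show "\<bar>(\<chi> i. \<theta> $ \<pi> i) $ i\<bar> \<le> pi" for i using assms(1) by (simp add: angles_def)
  have "g = u ** cis_diag \<theta> ** adj u" using assms(1) by (simp add: angles_def)
  then show "g = ?v ** cis_diag (\<chi> i. \<theta> $ \<pi> i) ** adj ?v"
    using re[of "\<lambda>k. u $ _ $ k * cis (\<theta> $ k) * cnj (u $ _ $ k)"]
    by (simp add: vec_eq_iff mult_dg_mult_nth cis_diag_def)
qed

section \<open>Perturbation of eigenangles\<close>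

lemma abs_sin_minus_le: "\<bar>sin x - x\<bar> \<le> x\<^sup>2 / 2" for x :: real
  using Maclaurin_sin_bound[of x 2] by (simp add: numeral_2_eq_2 sin_coeff_def lessThan_Suc power2_eq_square)

text \<open>Taylor's formula gives \<open>sin x \<ge> x - x ^ 3 / 6\<close>, and
  \<open>x \<le> pi / 2 < 2\<close> makes \<open>x ^ 3 \<le> 4 * x\<close>.\<close>

lemma sin_ge_third: "0 \<le> x \<Longrightarrow> x \<le> pi / 2 \<Longrightarrow> x / 3 \<le> sin x" for x :: real
proof -
  assume x: "0 \<le> x" "x \<le> pi / 2"
  have "\<bar>sin x - x\<bar> \<le> x ^ 3 / 6"
    using Maclaurin_sin_bound[of x 3] x by (simp add: numeral_3_eq_3 sin_coeff_def lessThan_Suc fact_numeral divide_simps)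
  moreover have "x ^ 3 \<le> 4 * x"
  proof -
    have "x * x \<le> 2 * 2" using x pi_less_4 by (intro mult_mono) auto
    then have "x * (x * x) \<le> x * 4" using x by (intro mult_left_mono) auto
    then show ?thesis by (simp add: power3_eq_cube mult_ac)
  qed
  ultimately show ?thesis by linarith
qed

lemma norm_cis_diff_square: "(norm (cis x - cis y))\<^sup>2 = (2 * sin ((x - y) / 2))\<^sup>2"
proof -
  have "(norm (cis x - cis y))\<^sup>2 = 2 - 2 * cos (x - y)"
    unfolding cmod_power2 using sin_cos_squared_add[of x] sin_cos_squared_add[of y]
    by (simp add: power2_eq_square cos_diff algebra_simps)
  also have "cos (x - y) = 1 - 2 * (sin ((x - y) / 2))\<^sup>2"
    using cos_double_sin[of "(x - y) / 2"] unfolding mult_2 field_sum_of_halves .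
  finally show ?thesis by (simp add: power2_eq_square)
qed

text \<open>A first-order upper bound for the distance to \<open>1\<close> on the circle, valid also near the cut
  point \<open>-1\<close>, where this distance is not differentiable but has a maximum.\<close>

lemma angle_first_order:
  assumes \<theta>: "\<bar>\<theta>\<bar> \<le> pi"
  obtains C where "C \<ge> 0" "\<And>\<phi>. \<bar>\<phi>\<bar> \<le> pi \<Longrightarrow>
    \<bar>\<phi>\<bar> \<le> \<bar>\<theta>\<bar> - (if \<phi> \<ge> 0 then 1 else -1) * sin (\<theta> - \<phi>) + C * (norm (cis \<theta> - cis \<phi>))\<^sup>2"
proof (cases "\<bar>\<theta>\<bar> = pi")
  case True
  have "\<bar>\<phi>\<bar> \<le> \<bar>\<theta>\<bar> - (if \<phi> \<ge> 0 then 1 else -1) * sin (\<theta> - \<phi>) + 0 * (norm (cis \<theta> - cis \<phi>))\<^sup>2"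
    if \<phi>: "\<bar>\<phi>\<bar> \<le> pi" for \<phi>
  proof -
    \<comment> \<open>At the cut point the claim reduces to sin |\<phi>| \<le> \<pi> - |\<phi>|,
      with no quadratic term.\<close>
    have "sin (\<theta> - \<phi>) = sin \<phi>" proof -
      have "\<theta> = pi \<or> \<theta> = - pi" using True by linarith
      then show ?thesis by (auto simp: sin_diff)
    qed
    moreover have "sin \<bar>\<phi>\<bar> \<le> pi - \<bar>\<phi>\<bar>" using sin_x_le_x[of "pi - \<bar>\<phi>\<bar>"] \<phi> by simp
    ultimately show ?thesis using True by (auto simp: abs_if split: if_splits)
  qed
  then show thesis by (intro that[of 0]) auto
next
  case False
  define \<eta> where "\<eta> = pi - \<bar>\<theta>\<bar>"
  have \<eta>: "\<eta> > 0" "\<eta> \<le> pi" using False \<theta> by (auto simp: \<eta>_def)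
  \<comment> \<open>Slope of a line below the sine on \<open>[0, pi - \<eta> / 2]\<close>: beyond
    \<open>pi / 2\<close> one has \<open>k * x \<le> \<eta> / 6 \<le> (pi - x) / 3\<close>, and
    \<open>sin_ge_third\<close> applies to \<open>pi - x\<close>.\<close>
  define k where "k = \<eta> / (6 * pi)"
  have k: "k > 0" using \<eta> by (simp add: k_def)
  have sin_ge: "k * x \<le> sin x" if x: "0 \<le> x" "x \<le> pi - \<eta> / 2" for x
  proof (cases "x \<le> pi / 2")
    case True
    have "k * x \<le> (1 / 3) * x" using x(1) \<eta> by (intro mult_right_mono) (auto simp: k_def divide_simps)
    also have "\<dots> \<le> sin x" using sin_ge_third[OF x(1) True] by simp
    finally show ?thesis .
  next
    case False
    have "k * x \<le> k * pi" using x \<eta> k by (intro mult_left_mono) auto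
    also have "\<dots> = \<eta> / 6" by (simp add: k_def)
    also have "\<dots> \<le> (pi - x) / 3" using x by simp
    also have "\<dots> \<le> sin (pi - x)" using x False \<eta> by (intro sin_ge_third) auto
    finally show ?thesis by simp
  qed
  show thesis
  \<comment> \<open>For \<open>\<delta> = \<theta> - \<phi>\<close> the squared chord is at least
    \<open>k\<^sup>2 * \<delta>\<^sup>2\<close>, while the error of \<open>sin \<delta>\<close>
    against \<delta> is at most \<open>\<delta>\<^sup>2 / 2\<close>; the ratio is this
    constant.\<close>
  proof (rule that[of "1 / (2 * k\<^sup>2)"])
    show "0 \<le> 1 / (2 * k\<^sup>2)" by simp
    fix \<phi> assume \<phi>: "\<bar>\<phi>\<bar> \<le> pi"
    define \<delta> where "\<delta> = \<theta> - \<phi>"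
    have "\<bar>\<delta>\<bar> \<le> \<bar>\<theta>\<bar> + \<bar>\<phi>\<bar>" unfolding \<delta>_def by (rule abs_triangle_ineq4)
    then have "\<bar>\<delta>\<bar> / 2 \<le> pi - \<eta> / 2" using \<phi> by (simp add: \<eta>_def field_simps)
    then have "k * (\<bar>\<delta>\<bar> / 2) \<le> sin (\<bar>\<delta>\<bar> / 2)" by (intro sin_ge) auto
    then have "(k * (\<bar>\<delta>\<bar> / 2))\<^sup>2 \<le> (sin (\<bar>\<delta>\<bar> / 2))\<^sup>2" using k by (intro power_mono) auto
    also have "\<dots> = (sin (\<delta> / 2))\<^sup>2" by (simp add: abs_if)
    finally have "k\<^sup>2 * \<delta>\<^sup>2 \<le> (norm (cis \<theta> - cis \<phi>))\<^sup>2"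
      unfolding norm_cis_diff_square by (simp add: \<delta>_def power_mult_distrib power_divide)
    then have chord: "\<delta>\<^sup>2 / 2 \<le> 1 / (2 * k\<^sup>2) * (norm (cis \<theta> - cis \<phi>))\<^sup>2" using k by (simp add: field_simps)
    define s :: real where "s = (if \<phi> \<ge> 0 then 1 else -1)"
    have s: "\<bar>s\<bar> = 1" by (simp add: s_def)
    have "\<bar>\<phi>\<bar> = s * \<theta> - s * \<delta>" by (simp add: s_def \<delta>_def)
    also have "\<dots> = s * \<theta> - s * sin \<delta> + s * (sin \<delta> - \<delta>)" by (simp add: algebra_simps)
    also have "s * \<theta> \<le> \<bar>\<theta>\<bar>"
      using abs_ge_self[of \<theta>] abs_ge_minus_self[of \<theta>] by (simp add: s_def)
    also have "s * (sin \<delta> - \<delta>) \<le> \<delta>\<^sup>2 / 2"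
    proof -
      have "s * (sin \<delta> - \<delta>) \<le> \<bar>sin \<delta> - \<delta>\<bar>" unfolding s_def by (simp add: abs_if)
      with abs_sin_minus_le[of \<delta>] show ?thesis by linarith
    qed
    finally show "\<bar>\<phi>\<bar> \<le> \<bar>\<theta>\<bar> - (if \<phi> \<ge> 0 then 1 else -1) * sin (\<theta> - \<phi>) + 1 / (2 * k\<^sup>2) * (norm (cis \<theta> - cis \<phi>))\<^sup>2"
      using chord by (simp add: s_def[symmetric] \<delta>_def[symmetric])
  qed
qed

text \<open>The scalar estimate is averaged with the squared moduli of the entries of
  \<open>W = adj v ** u\<close>, which compares the two eigenbases. The sine terms become diagonal
  entries of \<open>g' - g\<close> between unitary factors, hence are bounded by
  \<open>dual_norm\<close>; the quadratic terms add up to the squared Frobenius norm.\<close>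

lemma angles_compare_weights:
  fixes a :: "real^'n"
  assumes a: "\<And>i. 0 \<le> a $ i" and g: "angles g u \<theta>"
  obtains C where "C \<ge> 0" "\<And>g' v \<phi>. angles g' v \<phi> \<Longrightarrow> (\<Sum>i\<in>UNIV. a $ i * \<bar>\<phi> $ i\<bar>) \<le>
     (\<Sum>i\<in>UNIV. a $ i * (\<Sum>m\<in>UNIV. (norm ((adj v ** u) $ i $ m))\<^sup>2 * \<bar>\<theta> $ m\<bar>)) + dual_norm a (g' - g) + C * (norm (g' - g))\<^sup>2"
proof -
  have "\<exists>C\<ge>0. \<forall>\<phi>. \<bar>\<phi>\<bar> \<le> pi \<longrightarrow>
    \<bar>\<phi>\<bar> \<le> \<bar>\<theta> $ m\<bar> - (if \<phi> \<ge> 0 then 1 else -1) * sin (\<theta> $ m - \<phi>) + C * (norm (cis (\<theta> $ m) - cis \<phi>))\<^sup>2" for m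
    using angle_first_order[of "\<theta> $ m"] g unfolding angles_def by metis
  then obtain C0 where C0: "\<And>m. C0 m \<ge> 0" "\<And>m \<phi>. \<bar>\<phi>\<bar> \<le> pi \<Longrightarrow>
    \<bar>\<phi>\<bar> \<le> \<bar>\<theta> $ m\<bar> - (if \<phi> \<ge> 0 then 1 else -1) * sin (\<theta> $ m - \<phi>) + C0 m * (norm (cis (\<theta> $ m) - cis \<phi>))\<^sup>2"
    by metis
  define C where "C = (\<Sum>m\<in>UNIV. C0 m)"
  have C: "C0 m \<le> C" for m unfolding C_def using C0(1) by (intro member_le_sum) auto
  have aS: "a $ i \<le> abs_sum a" for i
    unfolding abs_sum_def using member_le_sum[of i UNIV "\<lambda>i. \<bar>a $ i\<bar>"] a[of i] by auto
  have "C \<ge> 0" using C0(1) C order.trans by blast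
  show thesis
  proof (rule that[of "abs_sum a * C"])
    show "0 \<le> abs_sum a * C" using \<open>C \<ge> 0\<close> abs_sum_nonneg[of a] by simp
    fix g' v :: "complex^'n^'n" and \<phi> :: "real^'n" assume g': "angles g' v \<phi>"
    have u: "u \<in> unitary_group" and v: "v \<in> unitary_group" and \<phi>: "\<bar>\<phi> $ i\<bar> \<le> pi" for i
      using g g' by (auto simp: angles_def)
    have geq: "g = u ** cis_diag \<theta> ** adj u" and g'eq: "g' = v ** cis_diag \<phi> ** adj v"
      using g g' by (auto simp: angles_def)
    define W where "W = adj v ** u"
    have W: "W \<in> unitary_group" unfolding W_def by (intro unitary_mult unitary_adj u v)
    define w where "w i m = (norm (W $ i $ m))\<^sup>2" for i m
    have w: "0 \<le> w i m" "(\<Sum>m\<in>UNIV. w i m) = 1" for i m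
      by (simp_all add: w_def unitary_row_sum[OF W])
    define s :: "'n \<Rightarrow> real" where "s i = (if \<phi> $ i \<ge> 0 then 1 else -1)" for i
    define q where "q i = (\<Sum>m\<in>UNIV. w i m * (norm (cis (\<theta> $ m) - cis (\<phi> $ i)))\<^sup>2)" for i
    have q0: "0 \<le> q i" for i unfolding q_def by (intro sum_nonneg mult_nonneg_nonneg w) auto
    have row: "\<bar>\<phi> $ i\<bar> \<le> (\<Sum>m\<in>UNIV. w i m * \<bar>\<theta> $ m\<bar>) - s i * (\<Sum>m\<in>UNIV. w i m * sin (\<theta> $ m - \<phi> $ i)) + C * q i" for i
    proof -
      have "\<bar>\<phi> $ i\<bar> = (\<Sum>m\<in>UNIV. w i m * \<bar>\<phi> $ i\<bar>)" by (simp add: sum_distrib_right[symmetric] w)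
      also have "\<dots> \<le> (\<Sum>m\<in>UNIV. w i m * (\<bar>\<theta> $ m\<bar> - s i * sin (\<theta> $ m - \<phi> $ i) + C * (norm (cis (\<theta> $ m) - cis (\<phi> $ i)))\<^sup>2))"
      proof (intro sum_mono mult_left_mono w)
        fix m
        have "C0 m * (norm (cis (\<theta> $ m) - cis (\<phi> $ i)))\<^sup>2 \<le> C * (norm (cis (\<theta> $ m) - cis (\<phi> $ i)))\<^sup>2"
          by (intro mult_right_mono C) simp
        with C0(2)[OF \<phi>, of i m]
        show "\<bar>\<phi> $ i\<bar> \<le> \<bar>\<theta> $ m\<bar> - s i * sin (\<theta> $ m - \<phi> $ i) + C * (norm (cis (\<theta> $ m) - cis (\<phi> $ i)))\<^sup>2"
          unfolding s_def by linarith
      qed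
      also have "\<dots> = (\<Sum>m\<in>UNIV. w i m * \<bar>\<theta> $ m\<bar>) - s i * (\<Sum>m\<in>UNIV. w i m * sin (\<theta> $ m - \<phi> $ i)) + C * q i"
        by (simp add: q_def distrib_left right_diff_distrib sum.distrib sum_subtractf sum_distrib_left mult_ac)
      finally show ?thesis .
    qed
    \<comment> \<open>Multiplying row \<open>i\<close> by this unit number turns the imaginary part
      that holds the sines into a real part and supplies the sign \<open>s i\<close>. As
      \<open>dg c\<close> is unitary, it can be absorbed into the supremum.\<close>
    define c where "c = (\<chi> i. complex_of_real (s i) * (- \<i>) * cis (- \<phi> $ i))"
    have cU: "dg c \<in> unitary_group" by (rule unitary_dg) (simp add: c_def norm_mult s_def)
    have trace: "- s i * (\<Sum>m\<in>UNIV. w i m * sin (\<theta> $ m - \<phi> $ i)) = Re (((dg c ** adj v) ** (g' - g) ** v) $ i $ i)" for i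
    proof -
      have "adj v ** g ** v = W ** cis_diag \<theta> ** adj W"
        unfolding geq W_def by (simp add: adj_mult matrix_mul_assoc)
      then have 1: "(adj v ** g ** v) $ i $ i = (\<Sum>m\<in>UNIV. complex_of_real (w i m) * cis (\<theta> $ m))"
        by (simp add: cis_diag_def mult_dg_mult_nth w_def cmod_square mult_ac)
      have "adj v ** g' ** v = cis_diag \<phi>"
        unfolding g'eq by (simp add: matrix_mul_assoc[symmetric] unitary_cancel[OF v] unitary_adj_mult[OF v])
      then have 2: "(adj v ** g' ** v) $ i $ i = cis (\<phi> $ i)" by (simp add: cis_diag_def)
      have "((dg c ** adj v) ** (g' - g) ** v) $ i $ i = c $ i * ((adj v ** g' ** v) $ i $ i - (adj v ** g ** v) $ i $ i)"
        by (simp add: matrix_mul_assoc[symmetric] dg_mult_nth right_diff_distrib bounded_bilinear.diff_left[OF bounded_bilinear_matrix_mult]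
            bounded_bilinear.diff_right[OF bounded_bilinear_matrix_mult])
      also have "Re \<dots> = s i * Im (cis (- \<phi> $ i) * (cis (\<phi> $ i) - (\<Sum>m\<in>UNIV. complex_of_real (w i m) * cis (\<theta> $ m))))"
        unfolding 1 2 by (simp add: c_def mult_ac)
      also have "cis (- \<phi> $ i) * (cis (\<phi> $ i) - (\<Sum>m\<in>UNIV. complex_of_real (w i m) * cis (\<theta> $ m))) =
          1 - (\<Sum>m\<in>UNIV. complex_of_real (w i m) * cis (\<theta> $ m - \<phi> $ i))"
        by (simp add: right_diff_distrib cis_mult sum_distrib_left mult.left_commute[of "cis _"])
      finally show ?thesis by simp
    qed
    \<comment> \<open>Taken between the two eigenbases, the difference of the matrices has as
      entries those of \<open>W\<close> times chords of the circle.\<close>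
    have quad: "(\<Sum>i\<in>UNIV. q i) = (norm (g' - g))\<^sup>2"
    proof -
      have "adj v ** (g - g') ** u = W ** cis_diag \<theta> - cis_diag \<phi> ** W"
        unfolding geq g'eq W_def
        by (simp add: bounded_bilinear.diff_left[OF bounded_bilinear_matrix_mult] bounded_bilinear.diff_right[OF bounded_bilinear_matrix_mult]
            matrix_mul_assoc[symmetric] unitary_cancel[OF v] unitary_adj_mult[OF u])
      then have "(adj v ** (g - g') ** u) $ i $ m = (W ** cis_diag \<theta> - cis_diag \<phi> ** W) $ i $ m" for i m
        by (simp only:)
      then have "(adj v ** (g - g') ** u) $ i $ m = W $ i $ m * (cis (\<theta> $ m) - cis (\<phi> $ i))" for i m
        by (simp add: cis_diag_def mult_dg_nth dg_mult_nth algebra_simps)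
      then have "(norm (adj v ** (g - g') ** u))\<^sup>2 = (\<Sum>i\<in>UNIV. q i)"
        unfolding norm_matrix_square by (simp add: q_def w_def norm_mult power_mult_distrib)
      then show ?thesis
        by (simp add: norm_mult_unitary[OF u] norm_unitary_mult[OF unitary_adj[OF v]] norm_minus_commute)
    qed
    have "(\<Sum>i\<in>UNIV. a $ i * \<bar>\<phi> $ i\<bar>) \<le> (\<Sum>i\<in>UNIV. a $ i * (\<Sum>m\<in>UNIV. w i m * \<bar>\<theta> $ m\<bar>)
        + a $ i * Re (((dg c ** adj v) ** (g' - g) ** v) $ i $ i) + abs_sum a * C * q i)"
    proof (rule sum_mono)
      fix i
      have "a $ i * \<bar>\<phi> $ i\<bar> \<le> a $ i * ((\<Sum>m\<in>UNIV. w i m * \<bar>\<theta> $ m\<bar>) + Re (((dg c ** adj v) ** (g' - g) ** v) $ i $ i) + C * q i)"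
        using row[of i] trace[of i] by (intro mult_left_mono a) linarith
      moreover have "a $ i * (C * q i) \<le> abs_sum a * (C * q i)"
        using q0 \<open>C \<ge> 0\<close> aS by (intro mult_right_mono) auto
      ultimately show "a $ i * \<bar>\<phi> $ i\<bar> \<le> a $ i * (\<Sum>m\<in>UNIV. w i m * \<bar>\<theta> $ m\<bar>)
        + a $ i * Re (((dg c ** adj v) ** (g' - g) ** v) $ i $ i) + abs_sum a * C * q i"
        by (simp add: distrib_left mult.assoc)
    qed
    also have "\<dots> = (\<Sum>i\<in>UNIV. a $ i * (\<Sum>m\<in>UNIV. w i m * \<bar>\<theta> $ m\<bar>)) +
        (\<Sum>i\<in>UNIV. a $ i * Re (((dg c ** adj v) ** (g' - g) ** v) $ i $ i)) + abs_sum a * C * (norm (g' - g))\<^sup>2"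
      by (simp add: sum.distrib sum_distrib_left[symmetric] quad)
    also have "(\<Sum>i\<in>UNIV. a $ i * Re (((dg c ** adj v) ** (g' - g) ** v) $ i $ i)) \<le> dual_norm a (g' - g)"
      by (intro weighted_trace_le_dual_norm unitary_mult cU unitary_adj v)
    finally show "(\<Sum>i\<in>UNIV. a $ i * \<bar>\<phi> $ i\<bar>) \<le>
     (\<Sum>i\<in>UNIV. a $ i * (\<Sum>m\<in>UNIV. (norm ((adj v ** u) $ i $ m))\<^sup>2 * \<bar>\<theta> $ m\<bar>)) + dual_norm a (g' - g) + abs_sum a * C * (norm (g' - g))\<^sup>2"
      by (simp add: w_def W_def)
  qed
qed

text \<open>The averages of |\<theta>| are replaced by a rearrangement that does not depend on
  \<open>g'\<close>. By \<open>angles_permute\<close> it belongs again to a diagonalisation of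
  \<open>g\<close>.\<close>

lemma angles_compare:
  fixes a :: "real^'n"
  assumes a: "\<And>i. 0 \<le> a $ i" and g: "angles g u \<theta>"
  obtains C \<pi> where "C \<ge> 0" "bij \<pi>" "\<And>g' v \<phi>. angles g' v \<phi> \<Longrightarrow> (\<Sum>i\<in>UNIV. a $ i * \<bar>\<phi> $ i\<bar>) \<le>
     (\<Sum>i\<in>UNIV. a $ i * \<bar>\<theta> $ \<pi> i\<bar>) + dual_norm a (g' - g) + C * (norm (g' - g))\<^sup>2"
proof -
  obtain C where C: "C \<ge> 0" "\<And>g' v \<phi>. angles g' v \<phi> \<Longrightarrow> (\<Sum>i\<in>UNIV. a $ i * \<bar>\<phi> $ i\<bar>) \<le>
     (\<Sum>i\<in>UNIV. a $ i * (\<Sum>m\<in>UNIV. (norm ((adj v ** u) $ i $ m))\<^sup>2 * \<bar>\<theta> $ m\<bar>)) + dual_norm a (g' - g) + C * (norm (g' - g))\<^sup>2"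
    by (rule angles_compare_weights[OF a g]) blast
  obtain \<pi> where \<pi>: "bij \<pi>" "\<And>w. doubly_stochastic w \<Longrightarrow>
    (\<Sum>i\<in>UNIV. a $ i * (\<Sum>j\<in>UNIV. w i j * \<bar>\<theta> $ j\<bar>)) \<le> (\<Sum>i\<in>UNIV. a $ i * \<bar>\<theta> $ \<pi> i\<bar>)"
    by (rule doubly_stochastic_rearrangement[of "\<lambda>i. a $ i" "\<lambda>i. \<bar>\<theta> $ i\<bar>"]) blast
  show thesis
  proof (rule that[OF C(1) \<pi>(1)])
    fix g' v :: "complex^'n^'n" and \<phi> :: "real^'n" assume g': "angles g' v \<phi>"
    have "adj v ** u \<in> unitary_group" using g g' by (auto simp: angles_def unitary_mult unitary_adj)
    then have "doubly_stochastic (\<lambda>i m. (norm ((adj v ** u) $ i $ m))\<^sup>2)"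
      by (simp add: doubly_stochastic_def unitary_row_sum unitary_column_sum)
    from \<pi>(2)[OF this] C(2)[OF g']
    show "(\<Sum>i\<in>UNIV. a $ i * \<bar>\<phi> $ i\<bar>) \<le>
     (\<Sum>i\<in>UNIV. a $ i * \<bar>\<theta> $ \<pi> i\<bar>) + dual_norm a (g' - g) + C * (norm (g' - g))\<^sup>2" by linarith
  qed
qed

section \<open>The angle norm as a continuous function on the unitary group\<close>

definition angle_norm :: "real^'n \<Rightarrow> complex^'n^'n \<Rightarrow> real" where
  "angle_norm a g = Sup {(\<Sum>i\<in>UNIV. a $ i * \<bar>\<theta> $ i\<bar>) | u \<theta>. angles g u \<theta>}"

context
  fixes a :: "real^'n"
  assumes a: "\<And>i. 0 \<le> a $ i"
begin

lemma angles_le_angle_norm: "angles g u \<theta> \<Longrightarrow> (\<Sum>i\<in>UNIV. a $ i * \<bar>\<theta> $ i\<bar>) \<le> angle_norm a g"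
  unfolding angle_norm_def
proof (rule cSup_upper)
  show "bdd_above {(\<Sum>i\<in>UNIV. a $ i * \<bar>\<theta> $ i\<bar>) | u \<theta>. angles g u \<theta>}"
    using a by (intro bdd_aboveI[of _ "\<Sum>i\<in>UNIV. a $ i * pi"])
      (auto simp: angles_def intro!: sum_mono mult_left_mono)
qed blast

lemma angle_norm_least:
  assumes "g \<in> unitary_group" "\<And>u \<theta>. angles g u \<theta> \<Longrightarrow> (\<Sum>i\<in>UNIV. a $ i * \<bar>\<theta> $ i\<bar>) \<le> B"
  shows "angle_norm a g \<le> B"
proof -
  obtain u \<theta> where "angles g u \<theta>" using angles_exist[OF assms(1)] by blast
  then show ?thesis unfolding angle_norm_def using assms(2) by (intro cSup_least) blast+
qed

lemma angle_norm_local: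
  assumes g: "g \<in> unitary_group" and \<epsilon>: "\<epsilon> > 0"
  obtains \<delta> where "\<delta> > 0" "\<And>g'. g' \<in> unitary_group \<Longrightarrow> norm (g' - g) < \<delta> \<Longrightarrow>
    angle_norm a g' \<le> angle_norm a g + dual_norm a (g' - g) + \<epsilon> * norm (g' - g)"
proof -
  obtain u \<theta> where u: "angles g u \<theta>" using angles_exist[OF g] by blast
  obtain C \<pi> where C: "C \<ge> 0" "bij \<pi>" "\<And>g' v \<phi>. angles g' v \<phi> \<Longrightarrow> (\<Sum>i\<in>UNIV. a $ i * \<bar>\<phi> $ i\<bar>) \<le>
     (\<Sum>i\<in>UNIV. a $ i * \<bar>\<theta> $ \<pi> i\<bar>) + dual_norm a (g' - g) + C * (norm (g' - g))\<^sup>2"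
    by (rule angles_compare[OF a u]) blast
  have \<pi>: "(\<Sum>i\<in>UNIV. a $ i * \<bar>\<theta> $ \<pi> i\<bar>) \<le> angle_norm a g"
    using angles_le_angle_norm[OF angles_permute[OF u C(2)]] by simp
  show thesis
  proof (rule that[of "\<epsilon> / (C + 1)"])
    show "0 < \<epsilon> / (C + 1)" using \<epsilon> C(1) by simp
    fix g' assume g': "g' \<in> unitary_group" "norm (g' - g) < \<epsilon> / (C + 1)"
    have "C * norm (g' - g) \<le> (C + 1) * norm (g' - g)" by (intro mult_right_mono) auto
    also have "\<dots> \<le> \<epsilon>" using g'(2) C(1) by (simp add: field_simps)
    finally have "C * (norm (g' - g))\<^sup>2 \<le> \<epsilon> * norm (g' - g)"
      using mult_right_mono[of "C * norm (g' - g)" \<epsilon> "norm (g' - g)"] by (simp add: power2_eq_square mult_ac)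
    with C(3) \<pi> show "angle_norm a g' \<le> angle_norm a g + dual_norm a (g' - g) + \<epsilon> * norm (g' - g)"
      by (intro angle_norm_least[OF g'(1)]) force
  qed
qed

text \<open>\<open>angle_norm_local\<close> bounds nearby values from above only. For the other
  half, diagonalisations of a sequence tending to \<open>g\<close> converge along a subsequence to
  one of \<open>g\<close>, and \<open>angles_compare\<close> with \<open>g' = g\<close> shows that
  this limit, up to a permutation, realises the supremum.\<close>

lemma angle_norm_lower_semicontinuous:
  assumes g: "g \<in> unitary_group" and \<epsilon>: "\<epsilon> > 0"
  shows "\<exists>\<delta>>0. \<forall>g'\<in>unitary_group. norm (g' - g) < \<delta> \<longrightarrow> angle_norm a g < angle_norm a g' + \<epsilon>"
proof (rule ccontr)
  assume "\<not> ?thesis"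
  then have "\<exists>g'\<in>unitary_group. norm (g' - g) < \<delta> \<and> angle_norm a g' + \<epsilon> \<le> angle_norm a g" if "\<delta> > 0" for \<delta>
    using that by (meson not_less)
  then have "\<exists>g'\<in>unitary_group. norm (g' - g) < inverse (Suc n) \<and> angle_norm a g' + \<epsilon> \<le> angle_norm a g" for n
    by simp
  then obtain h where h: "\<And>n. h n \<in> unitary_group" "\<And>n. norm (h n - g) < inverse (Suc n)"
      "\<And>n. angle_norm a (h n) + \<epsilon> \<le> angle_norm a g" by metis
  have "\<exists>u \<theta>. angles (h n) u \<theta>" for n using angles_exist[OF h(1)] by metis
  then obtain u \<theta> where u: "\<And>n. angles (h n) (u n) (\<theta> n)" by metis
  let ?K = "(unitary_group :: (complex^'n^'n) set) \<times> cbox (\<chi> i. - pi) (\<chi> i. pi)"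
  have "seq_compact ?K" by (intro compact_imp_seq_compact compact_Times compact_unitary_group compact_cbox)
  moreover have "\<forall>n. (u n, \<theta> n) \<in> ?K"
    using u by (auto simp: angles_def mem_box_cart abs_le_iff minus_le_iff)
  ultimately obtain l r where l: "l \<in> ?K" and r: "strict_mono r" "((\<lambda>n. (u n, \<theta> n)) \<circ> r) \<longlonglongrightarrow> l"
    by (rule seq_compactE)
  define v \<psi> where "v = fst l" and "\<psi> = snd l"
  have lim: "(\<lambda>n. u (r n)) \<longlonglongrightarrow> v" "(\<lambda>n. \<theta> (r n)) \<longlonglongrightarrow> \<psi>"
    using tendsto_fst[OF r(2)] tendsto_snd[OF r(2)] by (simp_all add: v_def \<psi>_def o_def)
  have cis_lim: "(\<lambda>n. cis_diag (\<theta> (r n))) \<longlonglongrightarrow> cis_diag \<psi>"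
    unfolding cis_diag_def dg_def
    by (intro vec_tendstoI) (auto simp: cis_conv_exp intro!: tendsto_intros lim)
  have "(\<lambda>n. u (r n) ** cis_diag (\<theta> (r n)) ** adj (u (r n))) \<longlonglongrightarrow> v ** cis_diag \<psi> ** adj v"
    by (intro tendsto_intros lim cis_lim)
  moreover have "(\<lambda>n. h (r n)) \<longlonglongrightarrow> g"
  proof -
    have "h \<longlonglongrightarrow> g"
    proof (rule LIM_zero_cancel, rule Lim_null_comparison)
      show "\<forall>\<^sub>F n in sequentially. norm (h n - g) \<le> inverse (Suc n)" using h(2) by (simp add: less_imp_le)
      show "(\<lambda>n. inverse (real (Suc n))) \<longlonglongrightarrow> 0" by (rule LIMSEQ_inverse_real_of_nat)
    qed
    from LIMSEQ_subseq_LIMSEQ[OF this r(1)] show ?thesis by (simp add: o_def)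
  qed
  moreover have "u (r n) ** cis_diag (\<theta> (r n)) ** adj (u (r n)) = h (r n)" for n
    using u[of "r n"] by (simp add: angles_def)
  ultimately have "g = v ** cis_diag \<psi> ** adj v" using LIMSEQ_unique by fastforce
  with l have ang: "angles g v \<psi>"
    by (auto simp: angles_def v_def \<psi>_def mem_box_cart abs_le_iff minus_le_iff)
  have perm: "(\<Sum>i\<in>UNIV. a $ i * \<bar>\<psi> $ \<pi> i\<bar>) \<le> angle_norm a g - \<epsilon>" if \<pi>: "bij \<pi>" for \<pi>
  proof (rule tendsto_upperbound)
    show "(\<lambda>n. \<Sum>i\<in>UNIV. a $ i * \<bar>\<theta> (r n) $ \<pi> i\<bar>) \<longlonglongrightarrow> (\<Sum>i\<in>UNIV. a $ i * \<bar>\<psi> $ \<pi> i\<bar>)"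
      by (intro tendsto_intros tendsto_vec_nth lim)
    have "(\<Sum>i\<in>UNIV. a $ i * \<bar>\<theta> (r n) $ \<pi> i\<bar>) \<le> angle_norm a g - \<epsilon>" for n
      using angles_le_angle_norm[OF angles_permute[OF u[of "r n"] \<pi>]] h(3)[of "r n"] by simp
    then show "\<forall>\<^sub>F n in sequentially. (\<Sum>i\<in>UNIV. a $ i * \<bar>\<theta> (r n) $ \<pi> i\<bar>) \<le> angle_norm a g - \<epsilon>" by simp
  qed simp
  obtain C \<pi> where C: "C \<ge> 0" "bij \<pi>" "\<And>g' v \<phi>. angles g' v \<phi> \<Longrightarrow> (\<Sum>i\<in>UNIV. a $ i * \<bar>\<phi> $ i\<bar>) \<le>
     (\<Sum>i\<in>UNIV. a $ i * \<bar>\<psi> $ \<pi> i\<bar>) + dual_norm a (g' - g) + C * (norm (g' - g))\<^sup>2"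
    by (rule angles_compare[OF a ang]) blast
  have "dual_norm a 0 = 0" using abs_dual_norm_le[of a 0] by simp
  then have "angle_norm a g \<le> (\<Sum>i\<in>UNIV. a $ i * \<bar>\<psi> $ \<pi> i\<bar>)"
    using C(3)[of g] by (intro angle_norm_least[OF g]) force
  with perm[OF C(2)] \<epsilon> show False by simp
qed

lemma continuous_on_angle_norm: "continuous_on unitary_group (angle_norm a)"
  unfolding continuous_on_iff
proof (intro ballI allI impI)
  fix g :: "complex^'n^'n" and \<epsilon> :: real assume g: "g \<in> unitary_group" and \<epsilon>: "\<epsilon> > 0"
  obtain \<delta>1 where \<delta>1: "\<delta>1 > 0" "\<And>g'. g' \<in> unitary_group \<Longrightarrow> norm (g' - g) < \<delta>1 \<Longrightarrow>
    angle_norm a g' \<le> angle_norm a g + dual_norm a (g' - g) + 1 * norm (g' - g)"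
    by (rule angle_norm_local[OF g zero_less_one]) blast
  obtain \<delta>2 where \<delta>2: "\<delta>2 > 0" "\<And>g'. g' \<in> unitary_group \<Longrightarrow> norm (g' - g) < \<delta>2 \<Longrightarrow> angle_norm a g < angle_norm a g' + \<epsilon>"
    using angle_norm_lower_semicontinuous[OF g \<epsilon>] by blast
  define K where "K = abs_sum a + 1"
  have K: "K > 0" using abs_sum_nonneg[of a] by (simp add: K_def)
  show "\<exists>d>0. \<forall>g'\<in>unitary_group. dist g' g < d \<longrightarrow> dist (angle_norm a g') (angle_norm a g) < \<epsilon>"
  proof (intro exI[of _ "min (\<epsilon> / K) (min \<delta>1 \<delta>2)"] conjI ballI impI)
    show "0 < min (\<epsilon> / K) (min \<delta>1 \<delta>2)" using \<epsilon> K \<delta>1(1) \<delta>2(1) by simp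
    fix g' assume g': "g' \<in> unitary_group" "dist g' g < min (\<epsilon> / K) (min \<delta>1 \<delta>2)"
    then have "norm (g' - g) * K < \<epsilon>" using K by (simp add: dist_norm pos_less_divide_eq)
    then have "dual_norm a (g' - g) + norm (g' - g) < \<epsilon>"
      using abs_dual_norm_le[of a "g' - g"] by (simp add: K_def algebra_simps)
    then show "dist (angle_norm a g') (angle_norm a g) < \<epsilon>"
      using \<delta>1(2)[OF g'(1)] \<delta>2(2)[OF g'(1)] g'(2) by (simp add: dist_norm dist_real_def abs_less_iff)
  qed
qed

end

section \<open>Growth along absolutely continuous curves\<close>

text \<open>The last point at which \<open>f\<close> is at most \<open>f a\<close> exists by
  compactness, and the comparison to its right shows that it cannot precede
  \<open>b\<close>.\<close>

lemma continuous_nonincreasing_right: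
  fixes f :: "real \<Rightarrow> real"
  assumes ab: "a \<le> b" and f: "continuous_on {a..b} f"
    and loc: "\<And>t. a \<le> t \<Longrightarrow> t < b \<Longrightarrow> \<exists>\<delta>>0. \<forall>t'. t < t' \<and> t' < t + \<delta> \<and> t' \<le> b \<longrightarrow> f t' \<le> f t"
  shows "f b \<le> f a"
proof (rule ccontr)
  assume nb: "\<not> ?thesis"
  define K where "K = {t \<in> {a..b}. f t \<le> f a}"
  have "closed K" unfolding K_def
    by (rule continuous_on_closed_Collect_le[OF f continuous_on_const closed_atLeastAtMost])
  moreover have "bounded K" by (rule bounded_subset[OF bounded_closed_interval[of a b]]) (auto simp: K_def)
  ultimately have "compact K" by (simp add: compact_eq_bounded_closed)
  moreover have "a \<in> K" using ab by (simp add: K_def)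
  ultimately obtain c where c: "c \<in> K" "\<And>t. t \<in> K \<Longrightarrow> t \<le> c"
    using compact_attains_sup[of K] by blast
  have "c < b" using c(1) nb by (auto simp: K_def less_le)
  with loc[of c] c(1) obtain \<delta> where \<delta>: "\<delta> > 0" "\<And>t'. c < t' \<Longrightarrow> t' < c + \<delta> \<Longrightarrow> t' \<le> b \<Longrightarrow> f t' \<le> f c"
    by (auto simp: K_def)
  define t where "t = min b (c + \<delta> / 2)"
  have "c < t" "t < c + \<delta>" "t \<le> b" using \<delta>(1) \<open>c < b\<close> by (auto simp: t_def min_def)
  with \<delta>(2)[of t] c(1) have "t \<in> K" by (auto simp: K_def)
  with c(2)[of t] \<open>c < t\<close> show False by simp
qed

lemma integrable_on_real_mult:
  fixes f :: "real \<Rightarrow> real"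
  shows "f integrable_on S \<Longrightarrow> (\<lambda>t. c * f t) integrable_on S"
  using integrable_cmul[of f S c] by simp

lemma integrable_on_norm:
  fixes f :: "real \<Rightarrow> 'e::euclidean_space"
  shows "f absolutely_integrable_on S \<Longrightarrow> (\<lambda>t. norm (f t)) integrable_on S"
  using set_lebesgue_integral_eq_integral(1)[OF absolutely_integrable_norm[of S f]] by (simp add: o_def)

lemma absolutely_integrable_continuous_compose:
  fixes f :: "real \<Rightarrow> 'e::euclidean_space" and M :: "'e \<Rightarrow> real"
  assumes f: "f absolutely_integrable_on {a..b}" and M: "continuous_on UNIV M" and bound: "\<And>x. \<bar>M x\<bar> \<le> C * norm x"
  shows "(\<lambda>t. M (f t)) absolutely_integrable_on {a..b}"
proof (rule measurable_bounded_by_integrable_imp_absolutely_integrable)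
  have "f \<in> borel_measurable (lebesgue_on {a..b})"
    using absolutely_integrable_measurable[of "{a..b}" f] f by simp
  then show "(\<lambda>t. M (f t)) \<in> borel_measurable (lebesgue_on {a..b})"
    by (rule measurable_compose) (rule borel_measurable_continuous_onI[OF M])
  show "(\<lambda>t. C * norm (f t)) integrable_on {a..b}"
    by (intro integrable_on_real_mult integrable_on_norm f)
qed (use bound in auto)

text \<open>A growth principle: \<open>M\<close> of a chord controls \<open>F\<close> to first
  order, and \<open>M\<close> satisfies Jensen's inequality. It serves the angle norm with
  \<open>dual_norm\<close> and the distances between columns with the Frobenius norm.\<close>

locale curve_growth =
  fixes S :: "'e::euclidean_space set" and F M :: "'e \<Rightarrow> real" and C :: real
  assumes F: "continuous_on S F" and M: "continuous_on UNIV M" and bound: "\<And>x. \<bar>M x\<bar> \<le> C * norm x"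
    and jensen: "\<And>f a b. f integrable_on {a..b::real} \<Longrightarrow> (\<lambda>t. M (f t)) integrable_on {a..b} \<Longrightarrow>
      M (integral {a..b} f) \<le> integral {a..b} (\<lambda>t. M (f t))"
    and local: "\<And>g \<epsilon>. g \<in> S \<Longrightarrow> \<epsilon> > 0 \<Longrightarrow> \<exists>\<delta>>0. \<forall>g'\<in>S. norm (g' - g) < \<delta> \<longrightarrow>
      F g' \<le> F g + M (g' - g) + \<epsilon> * norm (g' - g)"
begin

lemma integrable_speed:
  assumes "abs_continuous a b \<gamma>" "a \<le> b"
  shows "(\<lambda>t. M (vector_derivative \<gamma> (at t))) absolutely_integrable_on {a..b}"
  by (rule absolutely_integrable_continuous_compose[OF abs_continuous_fundamental_theorem(2)[OF assms] M bound])

text \<open>Subtracting the integral of \<open>M\<close> of the velocity, plus \<epsilon> times its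
  norm, makes \<open>F\<close> along the curve locally nonincreasing to the right, for Jensen bounds
  \<open>M\<close> of a chord by the integral of \<open>M\<close> over the arc.\<close>

lemma growth:
  assumes ac: "abs_continuous a b \<gamma>" and ab: "a \<le> b" and \<gamma>: "\<gamma> ` {a..b} \<subseteq> S"
  shows "F (\<gamma> b) \<le> F (\<gamma> a) + integral {a..b} (\<lambda>t. M (vector_derivative \<gamma> (at t)))"
proof -
  define v where "v t = vector_derivative \<gamma> (at t)" for t
  note ftc = abs_continuous_fundamental_theorem[OF ac ab, folded v_def]
  have iv: "v integrable_on {a..b}" and inv: "(\<lambda>t. norm (v t)) integrable_on {a..b}"
    using ftc(2) integrable_on_norm[OF ftc(2)] by (auto simp: set_lebesgue_integral_eq_integral(1))
  have iM: "(\<lambda>t. M (v t)) integrable_on {a..b}"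
    using integrable_speed[OF ac ab, folded v_def] by (simp add: set_lebesgue_integral_eq_integral(1))
  define L where "L = integral {a..b} (\<lambda>t. norm (v t))"
  have "F (\<gamma> b) \<le> F (\<gamma> a) + integral {a..b} (\<lambda>t. M (v t)) + \<epsilon> * L" if \<epsilon>: "\<epsilon> > 0" for \<epsilon>
  proof -
    define h where "h t = M (v t) + \<epsilon> * norm (v t)" for t
    have ih: "h integrable_on {a..b}" unfolding h_def
      by (intro integrable_add iM integrable_on_real_mult inv)
    define f where "f t = F (\<gamma> t) - integral {a..t} h" for t
    have "f b \<le> f a"
    proof (rule continuous_nonincreasing_right[OF ab])
      show "continuous_on {a..b} f" unfolding f_def
        by (intro continuous_intros continuous_on_compose2[OF F abs_continuous_imp_continuous_on[OF ac] \<gamma>] indefinite_integral_continuous_1 ih)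
      fix t assume t: "a \<le> t" "t < b"
      have "\<gamma> t \<in> S" using \<gamma> t by auto
      from local[OF this \<epsilon>] obtain \<delta> where \<delta>: "\<delta> > 0"
        "\<And>g'. g' \<in> S \<Longrightarrow> norm (g' - \<gamma> t) < \<delta> \<Longrightarrow> F g' \<le> F (\<gamma> t) + M (g' - \<gamma> t) + \<epsilon> * norm (g' - \<gamma> t)" by blast
      obtain d where d: "d > 0" "\<And>t'. t' \<in> {a..b} \<Longrightarrow> dist t' t < d \<Longrightarrow> dist (\<gamma> t') (\<gamma> t) < \<delta>"
        using abs_continuous_imp_continuous_on[OF ac] t \<delta>(1) unfolding continuous_on_iff
        by (metis atLeastAtMost_iff less_imp_le)
      show "\<exists>\<delta>>0. \<forall>t'. t < t' \<and> t' < t + \<delta> \<and> t' \<le> b \<longrightarrow> f t' \<le> f t"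
      proof (intro exI[of _ d] conjI allI impI d(1))
        fix t' assume t': "t < t' \<and> t' < t + d \<and> t' \<le> b"
        have sub: "{t..t'} \<subseteq> {a..b}" using t t' by auto
        have "norm (\<gamma> t' - \<gamma> t) < \<delta>" using d(2)[of t'] t t' by (auto simp: dist_norm)
        moreover have "\<gamma> t' \<in> S" using \<gamma> t t' by auto
        ultimately have *: "F (\<gamma> t') \<le> F (\<gamma> t) + M (\<gamma> t' - \<gamma> t) + \<epsilon> * norm (\<gamma> t' - \<gamma> t)" by (intro \<delta>(2))
        have inc: "\<gamma> t' - \<gamma> t = integral {t..t'} v" using ftc(3)[of t t'] t t' by (simp add: integral_unique)
        have int: "v integrable_on {t..t'}" "(\<lambda>t. M (v t)) integrable_on {t..t'}" "(\<lambda>t. norm (v t)) integrable_on {t..t'}"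
          using iv iM inv sub by (auto intro: integrable_on_subinterval)
        have "M (\<gamma> t' - \<gamma> t) \<le> integral {t..t'} (\<lambda>t. M (v t))"
          unfolding inc by (rule jensen[OF int(1,2)])
        moreover have "norm (\<gamma> t' - \<gamma> t) \<le> integral {t..t'} (\<lambda>t. norm (v t))"
          unfolding inc by (rule integral_norm_bound_integral[OF int(1,3)]) simp
        moreover have "integral {t..t'} h = integral {t..t'} (\<lambda>t. M (v t)) + \<epsilon> * integral {t..t'} (\<lambda>t. norm (v t))"
          unfolding h_def using int by (simp add: Henstock_Kurzweil_Integration.integral_add integrable_on_real_mult)
        moreover have "integral {a..t} h + integral {t..t'} h = integral {a..t'} h"
          using t t' sub by (intro Henstock_Kurzweil_Integration.integral_combine integrable_on_subinterval[OF ih]) auto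
        ultimately show "f t' \<le> f t"
          using * mult_left_mono[of "norm (\<gamma> t' - \<gamma> t)" "integral {t..t'} (\<lambda>t. norm (v t))" \<epsilon>] \<epsilon>
          unfolding f_def by linarith
      qed
    qed
    moreover have "integral {a..b} h = integral {a..b} (\<lambda>t. M (v t)) + \<epsilon> * L"
      unfolding h_def L_def using iM inv by (simp add: Henstock_Kurzweil_Integration.integral_add integrable_on_real_mult)
    ultimately show ?thesis by (simp add: f_def)
  qed
  note less = this
  have "L \<ge> 0" unfolding L_def by (rule Henstock_Kurzweil_Integration.integral_nonneg[OF inv]) simp
  have "F (\<gamma> b) \<le> F (\<gamma> a) + integral {a..b} (\<lambda>t. M (v t)) + e" if "e > 0" for e
  proof -
    have "e / (L + 1) > 0" using that \<open>L \<ge> 0\<close> by simp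
    from less[OF this] have "F (\<gamma> b) \<le> F (\<gamma> a) + integral {a..b} (\<lambda>t. M (v t)) + e / (L + 1) * L" .
    also have "e / (L + 1) * L \<le> e" using that \<open>L \<ge> 0\<close> by (simp add: field_simps)
    finally show ?thesis by simp
  qed
  then show ?thesis unfolding v_def by (rule field_le_epsilon)
qed

end

lemma angle_norm_curve_growth:
  fixes a :: "real^'n"
  assumes a: "\<And>i. 0 \<le> a $ i"
  shows "curve_growth unitary_group (angle_norm a) (dual_norm a) (abs_sum a)"
proof
  show "continuous_on unitary_group (angle_norm a)" by (rule continuous_on_angle_norm[OF a])
  show "continuous_on UNIV (dual_norm a)" by (rule continuous_on_dual_norm)
  show "\<bar>dual_norm a x\<bar> \<le> abs_sum a * norm x" for x by (rule abs_dual_norm_le)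
  show "dual_norm a (integral {c..b} f) \<le> integral {c..b} (\<lambda>t. dual_norm a (f t))"
    if "f integrable_on {c..b}" "(\<lambda>t. dual_norm a (f t)) integrable_on {c..b}" for f :: "real \<Rightarrow> complex^'n^'n" and c b
    using that by (rule dual_norm_integral_le)
  show "\<exists>\<delta>>0. \<forall>g'\<in>unitary_group. norm (g' - g) < \<delta> \<longrightarrow>
      angle_norm a g' \<le> angle_norm a g + dual_norm a (g' - g) + \<epsilon> * norm (g' - g)"
    if "g \<in> unitary_group" "\<epsilon> > 0" for g :: "complex^'n^'n" and \<epsilon>
    using angle_norm_local[OF a that] by metis
qed

lemma angles_le_dual_length:
  fixes a :: "real^'n"
  assumes a: "\<And>i. 0 \<le> a $ i" and ac: "abs_continuous s t \<gamma>" and st: "s \<le> t"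
    and \<gamma>: "\<gamma> ` {s..t} \<subseteq> unitary_group" and start: "\<gamma> s = mat 1" and ang: "angles (\<gamma> t) u \<theta>"
  shows "(\<Sum>i\<in>UNIV. a $ i * \<bar>\<theta> $ i\<bar>) \<le> integral {s..t} (\<lambda>r. dual_norm a (vector_derivative \<gamma> (at r)))"
proof -
  \<comment> \<open>Comparison with the zero angles shows that every diagonalisation of the identity
    has weighted sum at most 0, so the growth starts from 0.\<close>
  have one: "angles (mat 1) (mat 1) (0 :: real^'n)"
    by (simp add: angles_def unitary_mat_1 cis_diag_def dg_1)
  obtain C \<pi> where C: "\<And>g' v \<phi>. angles g' v \<phi> \<Longrightarrow> (\<Sum>i\<in>UNIV. a $ i * \<bar>\<phi> $ i\<bar>) \<le>
     (\<Sum>i\<in>UNIV. a $ i * \<bar>(0 :: real^'n) $ \<pi> i\<bar>) + dual_norm a (g' - mat 1) + C * (norm (g' - mat 1))\<^sup>2"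
    by (rule angles_compare[OF a one]) blast
  have "dual_norm a 0 = 0" using abs_dual_norm_le[of a 0] by simp
  then have "angle_norm a (mat 1) \<le> 0"
    by (intro angle_norm_least[OF a unitary_mat_1]) (use C in force)
  moreover have "(\<Sum>i\<in>UNIV. a $ i * \<bar>\<theta> $ i\<bar>) \<le> angle_norm a (\<gamma> t)" by (rule angles_le_angle_norm[OF a ang])
  ultimately show ?thesis
    using curve_growth.growth[OF angle_norm_curve_growth[OF a] ac st \<gamma>] start by simp
qed

section \<open>Shortest curves for the Frobenius norm\<close>

text \<open>The great-circle distance, for unit vectors of a real space; complex columns are
  regarded as real vectors of twice the dimension.\<close>

definition sphere_angle :: "'e::euclidean_space \<Rightarrow> 'e \<Rightarrow> real" where
  "sphere_angle x y = arccos (x \<bullet> y)"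

context
  fixes x y :: "'e::euclidean_space"
  assumes x: "norm x = 1" and y: "norm y = 1"
begin

lemma inner_unit_bounds: "-1 \<le> x \<bullet> y" "x \<bullet> y \<le> 1"
  using Cauchy_Schwarz_ineq2[of x y] x y by (auto simp: abs_le_iff)

lemma sphere_angle_bounds: "0 \<le> sphere_angle x y" "sphere_angle x y \<le> pi"
  unfolding sphere_angle_def using inner_unit_bounds by (auto intro: arccos_lbound arccos_ubound)

lemma cos_sphere_angle: "cos (sphere_angle x y) = x \<bullet> y"
  unfolding sphere_angle_def using inner_unit_bounds by simp

lemma norm_diff_sphere_angle: "norm (x - y) = 2 * sin (sphere_angle x y / 2)"
proof (rule power2_eq_imp_eq)
  have "(norm (x - y))\<^sup>2 = 2 - 2 * cos (sphere_angle x y)"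
    using x y by (simp add: power2_norm_eq_inner inner_diff_left inner_diff_right inner_commute cos_sphere_angle norm_eq_1)
  also have "cos (sphere_angle x y) = 1 - 2 * (sin (sphere_angle x y / 2))\<^sup>2"
    using cos_double_sin[of "sphere_angle x y / 2"] unfolding mult_2 field_sum_of_halves .
  finally show "(norm (x - y))\<^sup>2 = (2 * sin (sphere_angle x y / 2))\<^sup>2" by (simp add: power2_eq_square)
  show "0 \<le> 2 * sin (sphere_angle x y / 2)"
    using sphere_angle_bounds by (intro mult_nonneg_nonneg sin_ge_zero) auto
qed simp

end

text \<open>The parts of \<open>x\<close> and \<open>z\<close> orthogonal to \<open>y\<close> have
  norms \<open>sin \<alpha>\<close> and \<open>sin \<beta>\<close>; Cauchy-Schwarz for these parts
  compares \<open>cos (\<alpha> + \<beta>)\<close> with \<open>x \<bullet> z\<close>.\<close>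

lemma sphere_angle_triangle:
  assumes x: "norm x = 1" and y: "norm y = 1" and z: "norm z = 1"
  shows "sphere_angle x z \<le> sphere_angle x y + sphere_angle y z"
proof (cases "sphere_angle x y + sphere_angle y z \<le> pi")
  case True
  define \<alpha> \<beta> where "\<alpha> = sphere_angle x y" and "\<beta> = sphere_angle y z"
  have c: "cos \<alpha> = x \<bullet> y" "cos \<beta> = y \<bullet> z"
    unfolding \<alpha>_def \<beta>_def using x y z by (simp_all add: cos_sphere_angle)
  have b: "0 \<le> \<alpha>" "\<alpha> \<le> pi" "0 \<le> \<beta>" "\<beta> \<le> pi"
    unfolding \<alpha>_def \<beta>_def using x y z by (simp_all add: sphere_angle_bounds)
  define x' z' where "x' = x - (x \<bullet> y) *\<^sub>R y" and "z' = z - (y \<bullet> z) *\<^sub>R y"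
  have yy: "y \<bullet> y = 1" "x \<bullet> x = 1" "z \<bullet> z = 1" using x y z by (simp_all add: norm_eq_1)
  have nx: "norm x' = sin \<alpha>" "norm z' = sin \<beta>"
  proof -
    have "(norm x')\<^sup>2 = (sin \<alpha>)\<^sup>2" "(norm z')\<^sup>2 = (sin \<beta>)\<^sup>2"
      unfolding sin_squared_eq c power2_norm_eq_inner x'_def z'_def
      by (simp_all add: inner_diff_left inner_diff_right yy inner_commute power2_eq_square)
    then show "norm x' = sin \<alpha>" "norm z' = sin \<beta>"
      using b by (auto intro: power2_eq_imp_eq sin_ge_zero)
  qed
  have "cos (\<alpha> + \<beta>) = cos \<alpha> * cos \<beta> - norm x' * norm z'" by (simp add: cos_add nx)
  also have "\<dots> \<le> cos \<alpha> * cos \<beta> + x' \<bullet> z'" using Cauchy_Schwarz_ineq2[of x' z'] by (simp add: abs_le_iff)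
  also have "\<dots> = x \<bullet> z" by (simp add: x'_def z'_def c inner_diff_left inner_diff_right yy inner_commute)
  finally have "arccos (x \<bullet> z) \<le> arccos (cos (\<alpha> + \<beta>))"
    using inner_unit_bounds[OF x z] by (intro arccos_le_arccos) auto
  also have "\<dots> = \<alpha> + \<beta>" using b True by (intro arccos_cos) (auto simp: \<alpha>_def \<beta>_def)
  finally show ?thesis by (simp add: sphere_angle_def \<alpha>_def \<beta>_def)
next
  case False
  then show ?thesis using sphere_angle_bounds[OF x z] by simp
qed

lemma sphere_angle_commute: "sphere_angle x y = sphere_angle y x"
  by (simp add: sphere_angle_def inner_commute)

lemma sphere_angle_le_chord:
  assumes "\<epsilon> > 0"
  obtains \<delta> where "\<delta> > 0" "\<And>x y :: 'e::euclidean_space. norm x = 1 \<Longrightarrow> norm y = 1 \<Longrightarrow> norm (x - y) < \<delta> \<Longrightarrow>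
     sphere_angle x y \<le> (1 + \<epsilon>) * norm (x - y)"
proof -
  define e where "e = min \<epsilon> 1"
  have e: "e > 0" "e \<le> \<epsilon>" "e \<le> 1" using assms by (auto simp: e_def)
  show thesis
  \<comment> \<open>A chord below \<open>e / 6\<close> gives \<open>h \<le> e / 4\<close> by
    \<open>sin_ge_third\<close>, then \<open>h - sin h \<le> h * (e / 8)\<close>; finally
    \<open>(1 + e) * (1 - e / 8) \<ge> 1\<close> because \<open>e \<le> 1\<close>.\<close>
  proof (rule that[of "e / 6"])
    show "0 < e / 6" using e by simp
    fix x y :: 'e assume xy: "norm x = 1" "norm y = 1" "norm (x - y) < e / 6"
    define h where "h = sphere_angle x y / 2"
    have h: "0 \<le> h" "h \<le> pi / 2" using sphere_angle_bounds[OF xy(1,2)] by (auto simp: h_def)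
    have chord: "norm (x - y) = 2 * sin h" using norm_diff_sphere_angle[OF xy(1,2)] by (simp add: h_def)
    have "h \<le> e / 4" using sin_ge_third[OF h] xy(3) chord by simp
    have "h - sin h \<le> h\<^sup>2 / 2" using abs_sin_minus_le[of h] by linarith
    also have "\<dots> \<le> h * (e / 8)" using \<open>h \<le> e / 4\<close> h(1) mult_left_mono[of h "e / 4" h] by (simp add: power2_eq_square)
    finally have "h * (1 - e / 8) \<le> sin h" by (simp add: algebra_simps)
    then have "(1 + e) * (h * (1 - e / 8)) \<le> (1 + e) * sin h" using e by (intro mult_left_mono) auto
    moreover have "h * 1 \<le> h * ((1 + e) * (1 - e / 8))"
    proof (rule mult_left_mono[OF _ h(1)])
      have "e * e \<le> e * 1" using e by (intro mult_left_mono) auto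
      then show "1 \<le> (1 + e) * (1 - e / 8)" using e by (simp add: algebra_simps)
    qed
    ultimately have "h \<le> (1 + e) * sin h" by (simp add: mult_ac)
    also have "\<dots> \<le> (1 + \<epsilon>) * sin h" using e h by (intro mult_right_mono) (auto intro: sin_ge_zero)
    finally show "sphere_angle x y \<le> (1 + \<epsilon>) * norm (x - y)" by (simp add: chord h_def)
  qed
qed

text \<open>Its Euclidean norm is the distance in the product of the column spheres, whose
  Riemannian metric is the Frobenius norm.\<close>

definition column_angles :: "complex^'n^'n \<Rightarrow> complex^'n^'n \<Rightarrow> real^'n" where
  "column_angles g h = (\<chi> j. sphere_angle (column j g) (column j h))"

lemma norm_column_unitary: "u \<in> unitary_group \<Longrightarrow> norm (column j u) = 1"
  using unitary_column_sum[of u j] by (simp add: norm_vec_def L2_set_def column_def)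

lemma norm_columns: "norm x = L2_set (\<lambda>j. norm (column j x)) UNIV" for x :: "complex^'n^'n"
proof (rule power2_eq_imp_eq)
  show "(norm x)\<^sup>2 = (L2_set (\<lambda>j. norm (column j x)) UNIV)\<^sup>2"
    unfolding norm_matrix_square
    by (subst sum.swap) (simp add: L2_set_def norm_vec_def column_def sum_nonneg)
qed auto

text \<open>Triangle inequality on each sphere, then in the Euclidean norm over the columns; for
  close columns an arc exceeds its chord by a factor of at most
  \<open>1 + \<epsilon>\<close>.\<close>

lemma column_angles_lipschitz:
  fixes P :: "complex^'n^'n"
  assumes P: "P \<in> unitary_group" and "\<epsilon> > 0"
  obtains \<delta> where "\<delta> > 0" "\<And>g h. g \<in> unitary_group \<Longrightarrow> h \<in> unitary_group \<Longrightarrow> norm (h - g) < \<delta> \<Longrightarrow>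
    norm (column_angles P h) \<le> norm (column_angles P g) + norm (h - g) + \<epsilon> * norm (h - g)"
proof -
  obtain \<delta> where \<delta>: "\<delta> > 0" "\<And>x y :: complex^'n. norm x = 1 \<Longrightarrow> norm y = 1 \<Longrightarrow> norm (x - y) < \<delta> \<Longrightarrow>
     sphere_angle x y \<le> (1 + \<epsilon>) * norm (x - y)"
    using sphere_angle_le_chord[OF \<open>\<epsilon> > 0\<close>, where 'e = "complex^'n"] by blast
  show thesis
  proof (rule that[OF \<delta>(1)])
    fix g h :: "complex^'n^'n" assume gh: "g \<in> unitary_group" "h \<in> unitary_group" and close: "norm (h - g) < \<delta>"
    have step: "sphere_angle (column j g) (column j h) \<le> (1 + \<epsilon>) * norm (column j (h - g))" for j
    proof -
      have cd: "column j (h - g) = column j h - column j g" by (simp add: column_def vec_eq_iff)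
      have "norm (column j (h - g)) \<le> norm (h - g)"
        unfolding norm_columns[of "h - g"] by (rule member_le_L2_set) auto
      then show ?thesis
        using \<delta>(2)[OF norm_column_unitary[OF gh(1)] norm_column_unitary[OF gh(2)], of j j] close
        unfolding cd by (simp add: norm_minus_commute)
    qed
    have nn: "0 \<le> sphere_angle (column j P) (column j h)" for j
      using sphere_angle_bounds(1) norm_column_unitary P gh by blast
    have "norm (column_angles P h) = L2_set (\<lambda>j. sphere_angle (column j P) (column j h)) UNIV"
      using nn by (simp add: norm_vec_def column_angles_def)
    also have "\<dots> \<le> L2_set (\<lambda>j. sphere_angle (column j P) (column j g) + (1 + \<epsilon>) * norm (column j (h - g))) UNIV"
    proof (rule L2_set_mono[OF _ nn])
      fix j
      show "sphere_angle (column j P) (column j h) \<le> sphere_angle (column j P) (column j g) + (1 + \<epsilon>) * norm (column j (h - g))"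
        using sphere_angle_triangle[of "column j P" "column j g" "column j h"] step[of j] norm_column_unitary P gh by force
    qed
    also have "\<dots> \<le> L2_set (\<lambda>j. sphere_angle (column j P) (column j g)) UNIV + L2_set (\<lambda>j. (1 + \<epsilon>) * norm (column j (h - g))) UNIV"
      by (rule L2_set_triangle_ineq)
    also have "L2_set (\<lambda>j. sphere_angle (column j P) (column j g)) UNIV = norm (column_angles P g)"
    proof -
      have "0 \<le> sphere_angle (column j P) (column j g)" for j
        using sphere_angle_bounds(1) norm_column_unitary P gh by blast
      then show ?thesis by (simp add: norm_vec_def column_angles_def)
    qed
    also have "L2_set (\<lambda>j. (1 + \<epsilon>) * norm (column j (h - g))) UNIV = (1 + \<epsilon>) * norm (h - g)"
      unfolding norm_columns[of "h - g"] using \<open>\<epsilon> > 0\<close> by (simp add: L2_set_right_distrib)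
    finally show "norm (column_angles P h) \<le> norm (column_angles P g) + norm (h - g) + \<epsilon> * norm (h - g)"
      by (simp add: algebra_simps)
  qed
qed

text \<open>The sign 1 bounds the distance covered from an initial point \<open>P\<close>; the sign
  -1 bounds the distance still to go to a final point \<open>P\<close>, without reversing the
  curve.\<close>

lemma column_angles_curve_growth:
  fixes P :: "complex^'n^'n"
  assumes P: "P \<in> unitary_group" and s: "s \<in> {1, -1}"
  shows "curve_growth unitary_group (\<lambda>g. s * norm (column_angles P g)) norm 1"
proof
  show loc: "\<exists>\<delta>>0. \<forall>g'\<in>unitary_group. norm (g' - g) < \<delta> \<longrightarrow>
      s * norm (column_angles P g') \<le> s * norm (column_angles P g) + norm (g' - g) + \<epsilon> * norm (g' - g)"
    if g: "g \<in> unitary_group" and \<epsilon>: "\<epsilon> > 0" for g :: "complex^'n^'n" and \<epsilon>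
  proof -
    obtain \<delta> where \<delta>: "\<delta> > 0" "\<And>g h. g \<in> unitary_group \<Longrightarrow> h \<in> unitary_group \<Longrightarrow> norm (h - g) < \<delta> \<Longrightarrow>
      norm (column_angles P h) \<le> norm (column_angles P g) + norm (h - g) + \<epsilon> * norm (h - g)"
      using column_angles_lipschitz[OF P \<epsilon>] by blast
    show ?thesis
    proof (intro exI[of _ \<delta>] conjI ballI impI \<delta>(1))
      fix h :: "complex^'n^'n" assume h: "h \<in> unitary_group" "norm (h - g) < \<delta>"
      show "s * norm (column_angles P h) \<le> s * norm (column_angles P g) + norm (h - g) + \<epsilon> * norm (h - g)"
        using s \<delta>(2)[OF g h] \<delta>(2)[OF h(1) g] h(2) by (auto simp: norm_minus_commute)
    qed
  qed
  have "continuous_on unitary_group (\<lambda>g. column_angles P g)"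
    unfolding column_angles_def sphere_angle_def
  proof (intro continuous_on_vec_lambda continuous_on_arccos)
    show "continuous_on unitary_group (\<lambda>x. column i P \<bullet> column i x)" for i
      unfolding column_def by (intro continuous_intros)
    show "\<forall>x\<in>unitary_group. -1 \<le> column i P \<bullet> column i x \<and> column i P \<bullet> column i x \<le> 1" for i
      using inner_unit_bounds norm_column_unitary P by blast
  qed
  then show "continuous_on unitary_group (\<lambda>g. s * norm (column_angles P g))" by (intro continuous_intros)
  show "norm (integral {a..b} f) \<le> integral {a..b} (\<lambda>t. norm (f t))"
    if "f integrable_on {a..b}" "(\<lambda>t. norm (f t)) integrable_on {a..b}" for f :: "real \<Rightarrow> complex^'n^'n" and a b
    using that by (rule integral_norm_bound_integral) simp
qed (auto intro: continuous_intros)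

text \<open>Column j has to move from a unit vector to its multiple by
  \<open>cis (\<theta> $ j)\<close>, at spherical distance \<open>\<bar>\<theta> $ j\<bar>\<close>.
  The two length bounds force equality in the triangle inequalities and in Cauchy-Schwarz, so each
  column has covered the fraction \<open>l\<close> of its way.\<close>

lemma frobenius_shortest_curve:
  fixes \<gamma> :: "real \<Rightarrow> complex^'n^'n" and \<theta> :: "real^'n"
  assumes ac: "abs_continuous a b \<gamma>" and \<gamma>: "\<gamma> ` {a..b} \<subseteq> unitary_group"
    and ends: "\<gamma> a = mat 1" "\<gamma> b = cis_diag \<theta>" and \<theta>: "\<And>i. \<bar>\<theta> $ i\<bar> < pi" "\<theta> \<noteq> 0"
    and t: "a \<le> t" "t \<le> b"
    and l: "integral {a..t} (\<lambda>t. norm (vector_derivative \<gamma> (at t))) \<le> l * norm \<theta>"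
    and r: "integral {t..b} (\<lambda>t. norm (vector_derivative \<gamma> (at t))) \<le> (1 - l) * norm \<theta>"
  shows "\<gamma> t = cis_diag (l *\<^sub>R \<theta>)"
proof -
  define P where "P = cis_diag \<theta>"
  have P: "P \<in> unitary_group" by (simp add: P_def unitary_cis_diag)
  have gt: "\<gamma> t \<in> unitary_group" using \<gamma> t by auto
  define T d d' where "T = (\<chi> i. \<bar>\<theta> $ i\<bar>)" and "d = column_angles (mat 1) (\<gamma> t)" and "d' = column_angles P (\<gamma> t)"
  have self: "column_angles g g = 0" if "g \<in> unitary_group" for g :: "complex^'n^'n"
    using norm_column_unitary[OF that] by (simp add: column_angles_def sphere_angle_def vec_eq_iff norm_eq_1)
  have nT: "norm T = norm \<theta>" by (simp add: norm_vec_def T_def)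
  have sub: "\<gamma> ` {a..t} \<subseteq> unitary_group" "\<gamma> ` {t..b} \<subseteq> unitary_group" using \<gamma> t by auto
  have "norm d \<le> l * norm T"
    using curve_growth.growth[OF column_angles_curve_growth[OF unitary_mat_1, of 1] abs_continuous_subinterval[OF ac order.refl t(2)] t(1) sub(1)]
      l ends(1) self[OF unitary_mat_1] by (simp add: d_def nT)
  have "norm d' \<le> (1 - l) * norm T"
    using curve_growth.growth[OF column_angles_curve_growth[OF P, of "-1"] abs_continuous_subinterval[OF ac t(1) order.refl] t(2) sub(2)]
      r ends(2) self[OF P] by (simp add: d'_def nT P_def)
  have tri: "T $ j \<le> d $ j + d' $ j" for j
  proof -
    have "column j (mat 1) \<bullet> column j P = cos (\<theta> $ j)"
      by (simp add: column_def inner_vec_def mat_def P_def cis_diag_def inner_complex_def if_distrib if_distribR cong: if_cong)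
    then have "sphere_angle (column j (mat 1)) (column j P) = T $ j"
      using \<theta>(1)[of j] arccos_cos[of "\<bar>\<theta> $ j\<bar>"] by (simp add: sphere_angle_def T_def)
    then show ?thesis
      using sphere_angle_triangle[OF norm_column_unitary[OF unitary_mat_1] norm_column_unitary[OF gt] norm_column_unitary[OF P], of j j j]
      by (simp add: d_def d'_def column_angles_def sphere_angle_commute)
  qed
  \<comment> \<open>Pairing with \<open>T\<close> leaves no slack between the coordinatewise
    triangle inequalities and the norm bounds on \<open>d\<close> and \<open>d'\<close>.\<close>
  have "T \<bullet> T \<le> T \<bullet> (d + d')"
    unfolding inner_vec_def
  proof (rule sum_mono)
    fix j show "T $ j \<bullet> T $ j \<le> T $ j \<bullet> (d + d') $ j"
      using mult_left_mono[OF tri[of j], of "T $ j"] by (simp add: T_def)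
  qed
  then have "T \<bullet> T \<le> T \<bullet> d + T \<bullet> d'" by (simp add: inner_add_right)
  moreover have "T \<bullet> d \<le> norm T * norm d" "T \<bullet> d' \<le> norm T * norm d'" by (rule norm_cauchy_schwarz)+
  moreover have "norm T * norm d \<le> l * (T \<bullet> T)" "norm T * norm d' \<le> (1 - l) * (T \<bullet> T)"
    using mult_left_mono[OF \<open>norm d \<le> l * norm T\<close>, of "norm T"] mult_left_mono[OF \<open>norm d' \<le> (1 - l) * norm T\<close>, of "norm T"]
    by (simp_all add: power2_norm_eq_inner[symmetric] power2_eq_square mult_ac)
  ultimately have eq: "T \<bullet> d = l * (T \<bullet> T)" "T \<bullet> d' = (1 - l) * (T \<bullet> T)"
    by (simp_all add: algebra_simps)
  have par: "y = c *\<^sub>R T" if y: "norm y \<le> c * norm T" and Ty: "T \<bullet> y = c * (T \<bullet> T)" for y c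
  proof -
    have "y \<bullet> y \<le> (c * norm T)\<^sup>2" unfolding power2_norm_eq_inner[symmetric] using y by (intro power_mono) auto
    also have "\<dots> = c * c * (T \<bullet> T)" by (simp add: power_mult_distrib power2_norm_eq_inner) (simp add: power2_eq_square)
    finally have "(y - c *\<^sub>R T) \<bullet> (y - c *\<^sub>R T) \<le> 0"
      using Ty by (simp add: inner_diff_left inner_diff_right inner_commute algebra_simps)
    then show ?thesis by (metis inner_eq_zero_iff inner_ge_zero order_antisym eq_iff_diff_eq_0)
  qed
  have d: "d = l *\<^sub>R T" "d' = (1 - l) *\<^sub>R T"
    using par \<open>norm d \<le> l * norm T\<close> \<open>norm d' \<le> (1 - l) * norm T\<close> eq by blast+
  \<comment> \<open>The distance to the initial column gives the real part of the entry, the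
    distance to the final column its component along \<open>cis (\<theta> $ j)\<close>. Together
    they determine the entry unless \<open>sin (\<theta> $ j) = 0\<close>, that is
    \<open>\<theta> $ j = 0\<close>; then the real part 1 leaves no room for an imaginary
    part.\<close>
  have diag: "\<gamma> t $ j $ j = cis (l * \<theta> $ j)" for j
  proof -
    define \<alpha> \<beta> where "\<alpha> = Re (\<gamma> t $ j $ j)" and "\<beta> = Im (\<gamma> t $ j $ j)"
    have "column j (mat 1) \<bullet> column j (\<gamma> t) = \<alpha>"
      by (simp add: column_def inner_vec_def mat_def inner_complex_def if_distrib if_distribR \<alpha>_def cong: if_cong)
    then have "cos (d $ j) = \<alpha>"
      using cos_sphere_angle[OF norm_column_unitary[OF unitary_mat_1] norm_column_unitary[OF gt], of j j]
      by (simp add: d_def column_angles_def)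
    then have A: "\<alpha> = cos (l * \<theta> $ j)" by (auto simp: d T_def abs_if split: if_splits)
    have "column j P \<bullet> column j (\<gamma> t) = cos (\<theta> $ j) * \<alpha> + sin (\<theta> $ j) * \<beta>"
      by (simp add: column_def inner_vec_def P_def cis_diag_def inner_complex_def if_distrib if_distribR \<alpha>_def \<beta>_def cong: if_cong)
    then have "cos (d' $ j) = cos (\<theta> $ j) * \<alpha> + sin (\<theta> $ j) * \<beta>"
      using cos_sphere_angle[OF norm_column_unitary[OF P] norm_column_unitary[OF gt], of j j]
      by (simp add: d'_def column_angles_def)
    then have "cos ((1 - l) * \<theta> $ j) = cos (\<theta> $ j) * \<alpha> + sin (\<theta> $ j) * \<beta>"
      by (auto simp: d T_def abs_if split: if_splits)
    moreover have "cos ((1 - l) * \<theta> $ j) = cos (\<theta> $ j) * cos (l * \<theta> $ j) + sin (\<theta> $ j) * sin (l * \<theta> $ j)"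
      using cos_diff[of "\<theta> $ j" "l * \<theta> $ j"] by (simp add: algebra_simps)
    ultimately have "sin (\<theta> $ j) * (\<beta> - sin (l * \<theta> $ j)) = 0" using A by (simp add: algebra_simps)
    moreover have "\<beta> = sin (l * \<theta> $ j)" if "sin (\<theta> $ j) = 0"
    proof -
      have "\<theta> $ j = 0" using that \<theta>(1)[of j] sin_eq_0_pi[of "\<theta> $ j"] by (auto simp: abs_less_iff)
      moreover from this A have "\<alpha> = 1" by simp
      moreover have "\<alpha>\<^sup>2 + \<beta>\<^sup>2 \<le> 1"
        using unitary_entry_le_1[OF gt, of j j] power_mono[of "norm (\<gamma> t $ j $ j)" 1 2]
        by (simp add: cmod_power2 \<alpha>_def \<beta>_def)
      ultimately show ?thesis by simp
    qed
    ultimately have "\<beta> = sin (l * \<theta> $ j)" by auto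
    with A show ?thesis by (simp add: complex_eq_iff \<alpha>_def \<beta>_def)
  qed
  \<comment> \<open>A diagonal entry of modulus 1 exhausts the unit column.\<close>
  have "\<gamma> t $ i $ j = 0" if "i \<noteq> j" for i j
  proof -
    have "(\<Sum>k\<in>UNIV. (norm (\<gamma> t $ k $ j))\<^sup>2) = 1" by (rule unitary_column_sum[OF gt])
    then have "(\<Sum>k\<in>UNIV - {j}. (norm (\<gamma> t $ k $ j))\<^sup>2) = 0"
      by (subst (asm) sum.remove[of _ j]) (auto simp: diag)
    then show ?thesis using that by (subst (asm) sum_nonneg_eq_0_iff) auto
  qed
  then show ?thesis by (simp add: vec_eq_iff cis_diag_def diag)
qed

section \<open>Symmetric norms\<close>

locale symmetric_gauge =
  fixes \<Phi> :: "real^'n \<Rightarrow> real"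
  assumes symmetric: "symmetric_norm \<Phi>"
begin

lemma Phi_nonneg: "0 \<le> \<Phi> x"
  and Phi_eq_0: "\<Phi> x = 0 \<longleftrightarrow> x = 0"
  and Phi_scaleR: "\<Phi> (c *\<^sub>R x) = \<bar>c\<bar> * \<Phi> x"
  and Phi_triangle: "\<Phi> (x + y) \<le> \<Phi> x + \<Phi> y"
  and Phi_permute: "bij \<pi> \<Longrightarrow> \<Phi> (\<chi> i. x $ \<pi> i) = \<Phi> x"
  and Phi_sign: "(\<And>i. \<epsilon> i \<in> {1, -1}) \<Longrightarrow> \<Phi> (\<chi> i. \<epsilon> i * x $ i) = \<Phi> x"
  using symmetric unfolding symmetric_norm_def is_norm_def by simp_all

lemma Phi_pos: "x \<noteq> 0 \<Longrightarrow> 0 < \<Phi> x"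
  using Phi_nonneg[of x] Phi_eq_0[of x] by (simp add: less_le)

lemma Phi_abs: "\<Phi> (\<chi> i. \<bar>x $ i\<bar>) = \<Phi> x"
proof -
  have "(\<chi> i. \<bar>x $ i\<bar>) = (\<chi> i. (if x $ i \<ge> 0 then 1 else -1) * x $ i)" by (simp add: vec_eq_iff)
  then show ?thesis using Phi_sign[of "\<lambda>i. if x $ i \<ge> 0 then 1 else -1" x] by simp
qed

text \<open>A supporting functional of the unit ball of \<Phi> in the direction \<open>e\<close>.
  Nonnegative coordinates are asked for because the angle norm takes nonnegative weights.\<close>

definition norming :: "real^'n \<Rightarrow> real^'n \<Rightarrow> bool" where
  "norming a e \<longleftrightarrow> (\<forall>i. 0 \<le> a $ i) \<and> (\<forall>w. a \<bullet> w \<le> \<Phi> w) \<and> a \<bullet> e = \<Phi> e"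

text \<open>Hahn-Banach, by separating \<open>e\<close> from the open ball of radius
  \<open>\<Phi> e\<close>. Replacing the coordinates by their absolute values respects the bound by
  the sign invariance of \<Phi>, and does not lower the value at the nonnegative vector
  \<open>e\<close>.\<close>

lemma norming_exists:
  assumes e: "\<And>i. 0 \<le> e $ i" and "e \<noteq> 0"
  obtains a where "norming a e"
proof -
  have pos: "\<Phi> e > 0" by (rule Phi_pos) fact
  define S where "S = (\<lambda>w. e + (-1) *\<^sub>R w) ` {w. \<Phi> w < \<Phi> e}"
  have "convex {w. \<Phi> w < \<Phi> e}"
  proof (rule convexI)
    fix x y and u v :: real assume xy: "x \<in> {w. \<Phi> w < \<Phi> e}" "y \<in> {w. \<Phi> w < \<Phi> e}" and uv: "0 \<le> u" "0 \<le> v" "u + v = 1"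
    have "\<Phi> (u *\<^sub>R x + v *\<^sub>R y) \<le> u * \<Phi> x + v * \<Phi> y"
      using Phi_triangle[of "u *\<^sub>R x" "v *\<^sub>R y"] uv by (simp add: Phi_scaleR)
    also have "\<dots> < \<Phi> e" using xy uv by (auto intro: convex_bound_lt)
    finally show "u *\<^sub>R x + v *\<^sub>R y \<in> {w. \<Phi> w < \<Phi> e}" by simp
  qed
  then have convS: "convex S" unfolding S_def by (rule convex_affinity)
  have "0 \<notin> S" by (auto simp: S_def)
  obtain b where b: "b \<noteq> 0" "\<And>x. x \<in> S \<Longrightarrow> 0 \<le> b \<bullet> x"
    using separating_hyperplane_set_0[OF convS \<open>0 \<notin> S\<close>] by metis
  have le: "b \<bullet> w \<le> b \<bullet> e" if "\<Phi> w < \<Phi> e" for w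
    using b(2)[of "e - w"] that by (auto simp: S_def inner_diff_right)
  \<comment> \<open>A small positive multiple of \<open>b\<close> lies in the ball and pairs
    positively with \<open>b\<close>.\<close>
  have be: "b \<bullet> e > 0"
  proof -
    define r where "r = \<Phi> e / (2 * \<Phi> b)"
    have "\<Phi> b > 0" using b(1) by (rule Phi_pos)
    then have r: "r > 0" using pos by (simp add: r_def)
    have "\<Phi> (r *\<^sub>R b) = \<Phi> e / 2" using r \<open>\<Phi> b > 0\<close> by (simp add: Phi_scaleR) (simp add: r_def)
    then have "b \<bullet> (r *\<^sub>R b) \<le> b \<bullet> e" using pos by (intro le) simp
    moreover have "b \<bullet> (r *\<^sub>R b) > 0" using r b(1) by simp
    ultimately show ?thesis by linarith
  qed
  define a' where "a' = (\<Phi> e / (b \<bullet> e)) *\<^sub>R b"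
  have a'e: "a' \<bullet> e = \<Phi> e" using be by (simp add: a'_def)
  have a'_le: "a' \<bullet> w \<le> \<Phi> w" for w
  proof (cases "w = 0")
    case False
    then have w: "\<Phi> w > 0" by (rule Phi_pos)
    have "a' \<bullet> w \<le> \<Phi> w + \<epsilon>" if "\<epsilon> > 0" for \<epsilon>
    proof -
      define r where "r = \<Phi> e / (\<Phi> w + \<epsilon>)"
      have r: "r > 0" using pos w that by (simp add: r_def)
      have "\<Phi> (r *\<^sub>R w) < \<Phi> e" using r pos w that by (simp add: Phi_scaleR) (simp add: r_def field_simps)
      then have "r * (b \<bullet> w) \<le> b \<bullet> e" using le[of "r *\<^sub>R w"] by simp
      then have "\<Phi> e * (b \<bullet> w) \<le> (b \<bullet> e) * (\<Phi> w + \<epsilon>)" using w that by (simp add: r_def field_simps)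
      then show ?thesis using be by (simp add: a'_def field_simps)
    qed
    then show ?thesis by (rule field_le_epsilon)
  qed (simp add: Phi_nonneg)
  define a :: "real^'n" where "a = (\<chi> i. \<bar>a' $ i\<bar>)"
  have a_le: "a \<bullet> w \<le> \<Phi> w" for w
  proof -
    define \<epsilon> :: "'n \<Rightarrow> real" where "\<epsilon> i = (if a' $ i \<ge> 0 then 1 else -1)" for i
    have "a \<bullet> w = a' \<bullet> (\<chi> i. \<epsilon> i * w $ i)"
      unfolding inner_vec_def by (intro sum.cong) (auto simp: a_def \<epsilon>_def)
    also have "\<dots> \<le> \<Phi> (\<chi> i. \<epsilon> i * w $ i)" by (rule a'_le)
    also have "\<dots> = \<Phi> w" by (rule Phi_sign) (simp add: \<epsilon>_def)
    finally show ?thesis .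
  qed
  have "a' \<bullet> e \<le> a \<bullet> e"
    unfolding inner_vec_def by (intro sum_mono) (auto simp: a_def intro!: mult_right_mono e)
  with a_le[of e] a'e have "norming a e"
    unfolding norming_def using a_le by (auto simp: a_def)
  then show thesis by (rule that)
qed

text \<open>Scaled to norm 1, both \<open>e\<close> and \<open>d\<close> lie on the face of the unit
  ball where \<open>a\<close> equals 1, and this face contains their segment.\<close>

lemma strictly_convex_norming_unique:
  assumes strict: "strictly_convex_norm \<Phi>" and a: "norming a e" and "e \<noteq> 0" and d: "a \<bullet> d = \<Phi> d"
  shows "d = (\<Phi> d / \<Phi> e) *\<^sub>R e"
proof (cases "d = 0")
  case False
  have pos: "\<Phi> e > 0" "\<Phi> d > 0" using False \<open>e \<noteq> 0\<close> by (simp_all add: Phi_pos)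
  define x y where "x = (1 / \<Phi> e) *\<^sub>R e" and "y = (1 / \<Phi> d) *\<^sub>R d"
  have xy: "\<Phi> x = 1" "\<Phi> y = 1" "a \<bullet> x = 1" "a \<bullet> y = 1"
    using pos a d by (simp_all add: x_def y_def Phi_scaleR norming_def)
  have "closed_segment x y \<subseteq> {z. \<Phi> z = 1}"
  proof
    fix z assume "z \<in> closed_segment x y"
    then obtain u where u: "0 \<le> u" "u \<le> 1" "z = (1 - u) *\<^sub>R x + u *\<^sub>R y" by (auto simp: in_segment)
    have "\<Phi> z \<le> (1 - u) * \<Phi> x + u * \<Phi> y"
      using Phi_triangle[of "(1 - u) *\<^sub>R x" "u *\<^sub>R y"] u by (simp add: Phi_scaleR)
    moreover have "a \<bullet> z = 1" using u xy by (simp add: inner_add_right)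
    moreover have "a \<bullet> z \<le> \<Phi> z" using a by (simp add: norming_def)
    ultimately show "z \<in> {z. \<Phi> z = 1}" using xy by simp
  qed
  with strict have "x = y" unfolding strictly_convex_norm_def by blast
  then have "d = \<Phi> d *\<^sub>R x" using pos by (simp add: y_def)
  then show ?thesis by (simp add: x_def)
qed (simp add: Phi_eq_0)

text \<open>Von Neumann's inequality leaves a pairing of \<open>a\<close> with permuted singular
  numbers, and \<Phi> ignores the permutation.\<close>

lemma dual_norm_le_Phi:
  assumes a: "norming a e" and pq: "p \<in> unitary_group" "q \<in> unitary_group" and d: "\<And>i. 0 \<le> d $ i"
  shows "dual_norm a (p ** dg (\<chi> i. complex_of_real (d $ i)) ** q) \<le> \<Phi> d"
proof -
  have "\<And>i. 0 \<le> a $ i" using a by (simp add: norming_def)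
  then obtain \<pi> where \<pi>: "bij \<pi>" "dual_norm a (p ** dg (\<chi> i. complex_of_real (d $ i)) ** q) \<le> (\<Sum>i\<in>UNIV. a $ i * d $ \<pi> i)"
    using dual_norm_svd_le[of a d] d pq by metis
  note \<pi>(2)
  also have "(\<Sum>i\<in>UNIV. a $ i * d $ \<pi> i) = a \<bullet> (\<chi> i. d $ \<pi> i)" by (simp add: inner_vec_def)
  also have "\<dots> \<le> \<Phi> d" using a Phi_permute[OF \<pi>(1), of d] by (simp add: norming_def) (metis)
  finally show ?thesis .
qed

text \<open>Equality makes some permutation of \<open>d\<close> a multiple of \<open>e\<close>. The
  permutation is unknown, so only the Euclidean norm, which does not see it, is recorded.\<close>

lemma dual_norm_eq_Phi:
  assumes strict: "strictly_convex_norm \<Phi>" and a: "norming a e" and "e \<noteq> 0"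
    and pq: "p \<in> unitary_group" "q \<in> unitary_group" and d: "\<And>i. 0 \<le> d $ i"
    and eq: "dual_norm a (p ** dg (\<chi> i. complex_of_real (d $ i)) ** q) = \<Phi> d"
  shows "norm d = \<Phi> d / \<Phi> e * norm e"
proof -
  have a0: "\<And>i. 0 \<le> a $ i" using a by (simp add: norming_def)
  then obtain \<pi> where \<pi>: "bij \<pi>" "dual_norm a (p ** dg (\<chi> i. complex_of_real (d $ i)) ** q) \<le> (\<Sum>i\<in>UNIV. a $ i * d $ \<pi> i)"
    using dual_norm_svd_le[of a d] d pq by metis
  define d' where "d' = (\<chi> i. d $ \<pi> i)"
  have "\<Phi> d' = \<Phi> d" unfolding d'_def by (rule Phi_permute[OF \<pi>(1)])
  moreover have "\<Phi> d \<le> a \<bullet> d'" using \<pi>(2) eq by (simp add: inner_vec_def d'_def)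
  moreover have "a \<bullet> d' \<le> \<Phi> d'" using a by (simp add: norming_def)
  ultimately have "d' = (\<Phi> d / \<Phi> e) *\<^sub>R e"
    using strictly_convex_norming_unique[OF strict a \<open>e \<noteq> 0\<close>, of d'] by simp
  moreover have "norm d' = norm d"
    unfolding norm_vec_def L2_set_def d'_def using sum.reindex_bij_betw[OF \<pi>(1), of "\<lambda>i. (norm (d $ i))\<^sup>2"] by simp
  ultimately show ?thesis using Phi_nonneg[of d] Phi_nonneg[of e] by simp
qed

end

section \<open>Singular numbers\<close>

text \<open>The functional calculus does not depend on the diagonalisation, as
  \<open>adj v ** u\<close> has nonzero entries only where the eigenvalues agree. This resolves the
  definite descriptions in \<open>matrix_abs\<close> and \<open>matrix_powr\<close>, and later makes
  logarithms of real matrices real.\<close>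

lemma dg_functional_calculus:
  assumes u: "u \<in> unitary_group" and v: "v \<in> unitary_group"
    and eq: "u ** dg c ** adj u = v ** dg d ** adj v"
  shows "u ** dg (\<chi> i. f (c $ i)) ** adj u = v ** dg (\<chi> i. f (d $ i)) ** adj v"
proof -
  define W where "W = adj v ** u"
  have "W ** dg c = adj v ** (u ** dg c ** adj u) ** u"
    by (simp add: W_def matrix_mul_assoc[symmetric] unitary_adj_mult[OF u])
  also have "\<dots> = dg d ** W"
    unfolding eq by (simp add: W_def matrix_mul_assoc[symmetric] unitary_cancel[OF v])
  finally have "W $ i $ j * c $ j = d $ i * W $ i $ j" for i j
    by (metis mult_dg_nth dg_mult_nth)
  then have "W $ i $ j = 0 \<or> c $ j = d $ i" for i j by (metis mult.commute mult_cancel_left)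
  then have "W ** dg (\<chi> i. f (c $ i)) = dg (\<chi> i. f (d $ i)) ** W"
    by (simp add: vec_eq_iff mult_dg_nth dg_mult_nth) (metis mult.commute)
  then have "v ** (W ** dg (\<chi> i. f (c $ i))) ** adj u = v ** (dg (\<chi> i. f (d $ i)) ** W) ** adj u" by simp
  then show ?thesis
    by (simp add: W_def matrix_mul_assoc[symmetric] unitary_cancel[OF v] unitary_mult_adj[OF u])
qed

lemma positive_semidef_dg:
  assumes q: "q \<in> unitary_group" and d: "\<And>i. 0 \<le> d $ i"
  shows "positive_semidef (q ** dg (\<chi> i. complex_of_real (d $ i)) ** adj q)"
  unfolding positive_semidef_def
proof (intro conjI allI)
  let ?D = "dg (\<chi> i. complex_of_real (d $ i))"
  show "adj (q ** ?D ** adj q) = q ** ?D ** adj q" by (simp add: adj_mult adj_dg matrix_mul_assoc)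
  fix w
  define z where "z = adj q *v w"
  have "hip ((q ** ?D ** adj q) *v w) w = hip (?D *v z) z"
    by (simp add: matrix_vector_mul_assoc[symmetric] hip_matrix[of q] z_def)
  also have "\<dots> = (\<Sum>i\<in>UNIV. complex_of_real (d $ i) * (z $ i * cnj (z $ i)))"
    by (simp add: hip_def matrix_vector_mult_def if_distrib[of "\<lambda>x. x * _"] mult.assoc cong: if_cong)
  also have "Re \<dots> = (\<Sum>i\<in>UNIV. d $ i * (norm (z $ i))\<^sup>2)"
    by (simp add: cmod_square[symmetric] flip: of_real_power)
  also have "\<dots> \<ge> 0" by (intro sum_nonneg mult_nonneg_nonneg d) simp
  finally show "0 \<le> w \<bullet> ((q ** ?D ** adj q) *v w)" by (simp add: Re_hip inner_commute)
qed

lemma positive_semidef_spectral: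
  assumes "positive_semidef y"
  obtains w d where "w \<in> unitary_group" "\<And>i. 0 \<le> d $ i" "y = w ** dg (\<chi> i. complex_of_real (d $ i)) ** adj w"
proof -
  have y: "adj y = y" "\<And>z. 0 \<le> z \<bullet> (y *v z)" using assms by (auto simp: positive_semidef_def)
  obtain w c where w: "w \<in> unitary_group" "y = w ** dg c ** adj w" using normal_spectral_theorem[of y] y by metis
  have yc: "adj w ** y ** w = dg c"
    unfolding w(2) by (simp add: matrix_mul_assoc[symmetric] unitary_cancel[OF w(1)] unitary_adj_mult[OF w(1)])
  have "adj (dg c) = dg c" unfolding yc[symmetric] by (simp add: adj_mult y matrix_mul_assoc)
  then have "cnj (c $ i) = c $ i" for i by (metis adj_nth dg_nth)
  then have c: "c $ i = complex_of_real (Re (c $ i))" for i by (simp add: complex_eq_iff)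
  have "0 \<le> Re (c $ i)" for i
  proof -
    have "hip (y *v column i w) (column i w) = (adj w ** y ** w) $ i $ i"
      by (simp add: hip_def matrix_matrix_mult_def matrix_vector_mult_def column_def sum_distrib_right sum_distrib_left mult_ac)
        (subst sum.swap, simp add: mult_ac)
    then have "Re (c $ i) = (y *v column i w) \<bullet> column i w" unfolding yc by (simp add: Re_hip[symmetric])
    then show ?thesis using y(2)[of "column i w"] by (simp add: inner_commute)
  qed
  then show thesis using that[of w "\<chi> i. Re (c $ i)"] w c by (simp add: vec_eq_iff dg_def) 
qed

lemma matrix_abs_svd:
  assumes p: "p \<in> unitary_group" and q: "q \<in> unitary_group" and d: "\<And>i. 0 \<le> d $ i"
  shows "matrix_abs (p ** dg (\<chi> i. complex_of_real (d $ i)) ** q) = adj q ** dg (\<chi> i. complex_of_real (d $ i)) ** q"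
  unfolding matrix_abs_def
proof (rule the_equality)
  let ?D = "dg (\<chi> i. complex_of_real (d $ i))"
  let ?x = "p ** ?D ** q"
  have q': "adj q \<in> unitary_group" using q by (rule unitary_adj)
  have xx: "adj ?x ** ?x = adj q ** dg (\<chi> i. complex_of_real (d $ i) * complex_of_real (d $ i)) ** q"
    by (simp add: adj_mult adj_dg matrix_mul_assoc[symmetric] unitary_cancel[OF p])
      (simp add: matrix_mul_assoc dg_mult_dg)
  show "positive_semidef (adj q ** ?D ** q) \<and> adj q ** ?D ** q ** (adj q ** ?D ** q) = adj ?x ** ?x"
    unfolding xx using positive_semidef_dg[OF q' d]
    by (simp add: matrix_mul_assoc[symmetric] unitary_cancel[OF q]) (simp add: matrix_mul_assoc dg_mult_dg)
  fix y assume y: "positive_semidef y \<and> y ** y = adj ?x ** ?x"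
  then obtain w e where w: "w \<in> unitary_group" "\<And>i. 0 \<le> e $ i" "y = w ** dg (\<chi> i. complex_of_real (e $ i)) ** adj w"
    using positive_semidef_spectral by blast
  have "y ** y = w ** dg (\<chi> i. complex_of_real (e $ i) * complex_of_real (e $ i)) ** adj w"
    unfolding w(3) by (simp add: matrix_mul_assoc[symmetric] unitary_cancel[OF w(1)]) (simp add: matrix_mul_assoc dg_mult_dg)
  with y xx have "w ** dg (\<chi> i. complex_of_real (e $ i) * complex_of_real (e $ i)) ** adj w =
      adj q ** dg (\<chi> i. complex_of_real (d $ i) * complex_of_real (d $ i)) ** adj (adj q)" by simp
  \<comment> \<open>Uniqueness of the positive square root: applying the square root function to the
    squares recovers \<open>y\<close>.\<close>
  from dg_functional_calculus[OF w(1) q' this, of "\<lambda>z. complex_of_real (sqrt (Re z))"]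
  show "y = adj q ** ?D ** q" using w(2) d by (simp add: w(3))
qed

text \<open>The conjugation by \<open>q\<close> is carried out over the polynomial ring, where
  \<open>mat [:0, 1:]\<close> is central.\<close>

lemma charpoly_unitary_diag:
  assumes q: "q \<in> unitary_group"
  shows "charpoly (q ** dg c ** adj q) = (\<Prod>i\<in>UNIV. [:- (c $ i), 1:])"
proof -
  define C where "C = (map_matrix (\<lambda>c. [:c:]) :: complex^'a^'a \<Rightarrow> complex poly^'a^'a)"
  have C_nth: "C x $ i $ j = [:x $ i $ j:]" for x i j by (simp add: C_def map_matrix_def)
  have C_sum: "[:sum f A:] = (\<Sum>k\<in>A. [:f k:])" for f :: "'a \<Rightarrow> complex" and A
  proof (induction A rule: infinite_finite_induct)
    case (insert x F)
    have "[:f x + sum f F:] = [:f x:] + [:sum f F:]" by simp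
    then show ?case using insert by (simp del: add_pCons)
  qed simp_all
  have C_mult: "C (x ** y) = C x ** C y" for x y
    by (simp add: vec_eq_iff C_nth matrix_matrix_mult_def C_sum mult.commute)
  have C_1: "C (mat 1) = mat 1" by (simp add: vec_eq_iff C_nth mat_def one_pCons)
  have X_comm: "mat [:0, 1:] ** A = A ** mat [:0, 1:]" for A :: "complex poly^'a^'a"
    by (simp add: vec_eq_iff matrix_matrix_mult_def mat_def if_distrib if_distribR mult.commute cong: if_cong)
  have "C q ** (mat [:0, 1:] - C (dg c)) ** C (adj q) =
      C q ** mat [:0, 1:] ** C (adj q) - C q ** C (dg c) ** C (adj q)"
    by (simp add: vec_eq_iff matrix_matrix_mult_def right_diff_distrib left_diff_distrib sum_subtractf)
  also have "C q ** mat [:0, 1:] ** C (adj q) = mat [:0, 1:] ** C (q ** adj q)"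
    by (simp add: X_comm[symmetric] C_mult matrix_mul_assoc)
  also have "\<dots> = mat [:0, 1:]" by (simp add: unitary_mult_adj[OF q] C_1)
  also have "C q ** C (dg c) ** C (adj q) = C (q ** dg c ** adj q)" by (simp add: C_mult)
  finally have "charpoly (q ** dg c ** adj q) = det (C q ** (mat [:0, 1:] - C (dg c)) ** C (adj q))"
    by (simp add: charpoly_def C_def)
  also have "\<dots> = det (C q ** C (adj q)) * det (mat [:0, 1:] - C (dg c))" by (simp add: det_mul mult_ac)
  also have "det (C q ** C (adj q)) = 1" by (simp add: C_mult[symmetric] unitary_mult_adj[OF q] C_1)
  also have "det (mat [:0, 1:] - C (dg c)) = (\<Prod>i\<in>UNIV. (mat [:0, 1:] - C (dg c)) $ i $ i)"
    by (rule det_diagonal) (simp add: mat_def C_nth)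
  also have "\<dots> = (\<Prod>i\<in>UNIV. [:- (c $ i), 1:])" by (simp add: mat_def C_nth)
  finally show ?thesis by simp
qed

text \<open>The bridge from the multiset of eigenvalues of |x| to diagonal matrices: unitary factors
  around a nonnegative diagonal exhibit the singular numbers in any order.\<close>

lemma singular_numbers_svd:
  assumes p: "p \<in> unitary_group" and q: "q \<in> unitary_group" and d: "\<And>i. 0 \<le> d $ i"
  shows "singular_numbers (p ** dg (\<chi> i. complex_of_real (d $ i)) ** q) = image_mset (($) d) (mset_set UNIV)"
proof -
  have "proots (\<Prod>i\<in>A. [:- complex_of_real (d $ i), 1:]) = image_mset (\<lambda>i. complex_of_real (d $ i)) (mset_set A)" if "finite A" for A
    using that
  proof induction
    case (insert i A)
    have "(\<Prod>i\<in>A. [:- complex_of_real (d $ i), 1:]) \<noteq> 0" using insert(1) by simp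
    then show ?case using insert by (simp add: proots_mult del: mult_pCons_left)
  qed simp
  then show ?thesis
    using charpoly_unitary_diag[OF unitary_adj[OF q], of "\<chi> i. complex_of_real (d $ i)"]
    by (simp add: singular_numbers_def matrix_abs_svd[OF p q d] multiset.map_comp o_def)
qed

lemma matrix_powr_diag:
  assumes d: "\<And>i. 0 \<le> d $ i"
  shows "matrix_powr (diag d) p = diag (\<chi> i. d $ i powr p)"
  unfolding matrix_powr_def
proof (rule the_equality)
  have diag: "diag e = dg (\<chi> i. complex_of_real (e $ i))" for e :: "real^'a" by (simp add: vec_eq_iff diag_def)
  show "\<exists>u\<in>unitary_group. \<exists>e. (\<forall>i. 0 \<le> e $ i) \<and> diag d = u ** diag e ** adj u \<and>
      diag (\<chi> i. d $ i powr p) = u ** diag (\<chi> i. e $ i powr p) ** adj u"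
    using d by (intro bexI[of _ "mat 1"] exI[of _ d]) (simp_all add: unitary_mat_1)
  fix z assume "\<exists>u\<in>unitary_group. \<exists>e. (\<forall>i. 0 \<le> e $ i) \<and> diag d = u ** diag e ** adj u \<and> z = u ** diag (\<chi> i. e $ i powr p) ** adj u"
  then obtain u e where u: "u \<in> unitary_group" "diag d = u ** diag e ** adj u" "z = u ** diag (\<chi> i. e $ i powr p) ** adj u" by blast
  then have "u ** dg (\<chi> i. complex_of_real (e $ i)) ** adj u = mat 1 ** dg (\<chi> i. complex_of_real (d $ i)) ** adj (mat 1)"
    by (simp add: diag)
  from dg_functional_calculus[OF u(1) unitary_mat_1 this, of "\<lambda>z. complex_of_real (Re z powr p)"]
  show "z = diag (\<chi> i. d $ i powr p)" using u(3) by (simp add: diag)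
qed

lemma schatten_norm_diag:
  assumes d: "\<And>i. 0 \<le> d $ i"
  shows "schatten_norm p (diag d) = (\<Sum>i\<in>UNIV. d $ i powr p) powr (1 / p)"
proof -
  have diag: "diag d = dg (\<chi> i. complex_of_real (d $ i))" by (simp add: vec_eq_iff diag_def)
  have "matrix_abs (diag d) = diag d"
    using matrix_abs_svd[OF unitary_mat_1 unitary_mat_1 d] by (simp add: diag)
  then show ?thesis
    unfolding schatten_norm_def \<open>matrix_abs (diag d) = diag d\<close> matrix_powr_diag[OF d]
    by (simp add: trace_def diag_def)
qed

section \<open>The matrix exponential\<close>

lemma matrix_pow_unitary_diag:
  assumes u: "u \<in> unitary_group"
  shows "matrix_pow (u ** dg c ** adj u) k = u ** dg (\<chi> i. c $ i ^ k) ** adj u"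
proof (induction k)
  case 0
  then show ?case by (simp add: dg_1 unitary_mult_adj[OF u])
next
  case (Suc k)
  have "dg c ** (adj u ** (u ** (dg (\<chi> i. c $ i ^ k) ** adj u))) = dg (\<chi> i. c $ i ^ Suc k) ** adj u"
    by (simp add: unitary_cancel[OF u] matrix_mul_assoc dg_mult_dg)
  then show ?case unfolding matrix_pow.simps Suc by (simp only: matrix_mul_assoc[symmetric])
qed

text \<open>Stated with \<open>sums\<close> and not only as a value, since convergence is what
  allows a real exponential series to be compared with its complexification.\<close>

lemma matrix_exp_sums_unitary_diag:
  assumes u: "u \<in> unitary_group"
  shows "(\<lambda>k. matrix_pow (u ** dg c ** adj u) k /\<^sub>R fact k) sums (u ** dg (\<chi> i. exp (c $ i)) ** adj u)"
proof -
  define T where "T z = u ** dg z ** adj u" for z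
  have "linear T"
    unfolding T_def
    by (rule linearI)
      (simp_all add: vec_eq_iff mult_dg_mult_nth distrib_left distrib_right sum.distrib scaleR_sum_right)
  then have T: "bounded_linear T" by (simp add: linear_conv_bounded_linear)
  have "(\<lambda>k. \<chi> i. c $ i ^ k /\<^sub>R fact k) sums (\<chi> i. exp (c $ i))"
    unfolding sums_def
    by (rule vec_tendstoI) (use exp_converges[of "c $ _"] in \<open>simp add: sums_def\<close>)
  from bounded_linear.sums[OF T this] have "(\<lambda>k. T (\<chi> i. c $ i ^ k /\<^sub>R fact k)) sums T (\<chi> i. exp (c $ i))" .
  moreover have "T (\<chi> i. c $ i ^ k /\<^sub>R fact k) = matrix_pow (u ** dg c ** adj u) k /\<^sub>R fact k" for k
  proof -
    have "(\<chi> i. c $ i ^ k /\<^sub>R fact k) = (1 / fact k) *\<^sub>R (\<chi> i. c $ i ^ k)" by (simp add: vec_eq_iff divide_inverse)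
    moreover have "matrix_pow (u ** dg c ** adj u) k = T (\<chi> i. c $ i ^ k)"
      unfolding T_def by (rule matrix_pow_unitary_diag[OF u])
    ultimately show ?thesis
      by (simp add: linear_scale[OF \<open>linear T\<close>] divide_inverse)
  qed
  ultimately show ?thesis by (simp add: T_def)
qed

lemma matrix_exp_unitary_diag:
  assumes u: "u \<in> unitary_group"
  shows "matrix_exp (u ** dg c ** adj u) = u ** dg (\<chi> i. exp (c $ i)) ** adj u"
  unfolding matrix_exp_def using matrix_exp_sums_unitary_diag[OF u] by (rule sums_unique[symmetric])

definition imag_diag :: "real^'n \<Rightarrow> complex^'n^'n" where
  "imag_diag \<theta> = dg (\<chi> i. \<i> * complex_of_real (\<theta> $ i))"

lemma matrix_exp_imag_diag:
  "u \<in> unitary_group \<Longrightarrow> matrix_exp (u ** imag_diag \<theta> ** adj u) = u ** cis_diag \<theta> ** adj u"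
  by (simp add: imag_diag_def matrix_exp_unitary_diag cis_diag_def cis_conv_exp)

lemma skew_hermitian_spectral:
  assumes x: "adj x = - x"
  obtains u \<theta> where "u \<in> unitary_group" "x = u ** imag_diag \<theta> ** adj u"
proof -
  have "x ** adj x = adj x ** x" by (simp add: x vec_eq_iff matrix_matrix_mult_def)
  then obtain u c where u: "u \<in> unitary_group" "x = u ** dg c ** adj u"
    by (rule normal_spectral_theorem)
  have xc: "adj u ** x ** u = dg c"
    unfolding u(2) by (simp add: matrix_mul_assoc[symmetric] unitary_cancel[OF u(1)] unitary_adj_mult[OF u(1)])
  have "adj (dg c) = adj u ** (- x) ** u" unfolding xc[symmetric] by (simp add: adj_mult x matrix_mul_assoc)
  also have "\<dots> = - dg c" unfolding xc[symmetric] by (simp add: vec_eq_iff matrix_matrix_mult_def sum_negf)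
  finally have neg: "adj (dg c) = - dg c" .
  have "Re (c $ i) = 0" for i
    using arg_cong[OF neg, of "\<lambda>m. Re (m $ i $ i)"] by simp
  then have "c $ i = \<i> * complex_of_real (Im (c $ i))" for i by (simp add: complex_eq_iff)
  then have "dg c = imag_diag (\<chi> i. Im (c $ i))" unfolding imag_diag_def by (simp add: vec_eq_iff)
  with u(2) show thesis using that[OF u(1), of "\<chi> i. Im (c $ i)"] by simp
qed

section \<open>Groups with an invariant norm\<close>

lemma has_integral_0_negligible:
  fixes f :: "'e::euclidean_space \<Rightarrow> real"
  assumes f: "\<And>x. 0 \<le> f x" and int: "(f has_integral 0) S"
  shows "negligible {x\<in>S. f x \<noteq> 0}"
proof -
  define g where "g x = (if x \<in> S then f x else 0)" for x
  have "(g has_integral 0) UNIV" unfolding g_def using int by (simp only: has_integral_restrict_UNIV)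
  then have "g \<in> lebesgue \<rightarrow>\<^sub>M borel" "integral\<^sup>N lebesgue g = 0"
    using has_integral_iff_nn_integral_lebesgue[of g 0] f by (auto simp: g_def)
  then have "AE x in lebesgue. g x \<le> 0"
    using nn_integral_0_iff_AE[of "\<lambda>x. ennreal (g x)" lebesgue] by (simp add: ennreal_eq_0_iff)
  then have "AE x in lebesgue. x \<notin> {x. g x \<noteq> 0}"
  proof (rule eventually_mono)
    fix x assume "g x \<le> 0"
    moreover have "0 \<le> g x" using f by (simp add: g_def)
    ultimately show "x \<notin> {x. g x \<noteq> 0}" by simp
  qed
  moreover have "{x. g x \<noteq> 0} \<in> sets lebesgue"
    using \<open>g \<in> lebesgue \<rightarrow>\<^sub>M borel\<close> measurable_sets[of g lebesgue borel "- {0}"] by (simp add: vimage_def)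
  ultimately have "{x. g x \<noteq> 0} \<in> null_sets lebesgue" by (simp add: AE_iff_null_sets)
  moreover have "{x. g x \<noteq> 0} = {x\<in>S. f x \<noteq> 0}" by (auto simp: g_def)
  ultimately show ?thesis by (simp add: negligible_iff_null_sets)
qed

lemma norm_dg: "norm (dg c) = norm c"
proof -
  have "(norm (dg c))\<^sup>2 = (norm c)\<^sup>2"
    unfolding norm_matrix_square
    by (simp add: if_distrib[of norm] if_distrib[of "\<lambda>x. x\<^sup>2"] norm_vec_def L2_set_def sum_nonneg cong: if_cong)
  then show ?thesis by simp
qed

lemma norm_of_real_vec: "norm (\<chi> i. complex_of_real (d $ i)) = norm d"
  by (simp add: norm_vec_def)

lemma bounded_linear_matrix_mult_left:
  "bounded_linear (\<lambda>x :: 'a::{real_normed_field,euclidean_space}^'n^'n. g ** x)"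
  by (rule linear_conv_bounded_linear[THEN iffD1], rule linearI)
    (simp_all add: vec_eq_iff matrix_matrix_mult_def distrib_left sum.distrib scaleR_sum_right)

lemma abs_continuous_lipschitz:
  assumes K: "\<And>s t. a \<le> s \<Longrightarrow> s \<le> t \<Longrightarrow> t \<le> b \<Longrightarrow> norm (\<gamma> t - \<gamma> s) \<le> K * (t - s)"
  shows "abs_continuous a b \<gamma>"
  unfolding abs_continuous_packing
proof (intro allI impI)
  fix \<epsilon> :: real assume \<epsilon>: "\<epsilon> > 0"
  define C where "C = \<bar>K\<bar> + 1"
  have C: "C > 0" by (simp add: C_def)
  show "\<exists>\<delta>>0. \<forall>m s t. packing a b m s t \<and> (\<Sum>k<m. t k - s k) < \<delta> \<longrightarrow> (\<Sum>k<m. norm (\<gamma> (t k) - \<gamma> (s k))) < \<epsilon>"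
  proof (intro exI[of _ "\<epsilon> / C"] conjI allI impI)
    show "0 < \<epsilon> / C" using \<epsilon> C by simp
    fix m s t assume p: "packing a b m s t \<and> (\<Sum>k<m. t k - s k) < \<epsilon> / C"
    have "(\<Sum>k<m. norm (\<gamma> (t k) - \<gamma> (s k))) \<le> (\<Sum>k<m. C * (t k - s k))"
    proof (rule sum_mono)
      fix k assume "k \<in> {..<m}"
      then have st: "a \<le> s k" "s k \<le> t k" "t k \<le> b" using p by (auto simp: packing_def)
      have "K * (t k - s k) \<le> C * (t k - s k)" using st by (intro mult_right_mono) (auto simp: C_def)
      with K[OF st] show "norm (\<gamma> (t k) - \<gamma> (s k)) \<le> C * (t k - s k)" by simp
    qed
    also have "\<dots> = C * (\<Sum>k<m. t k - s k)" by (simp add: sum_distrib_left)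
    also have "\<dots> < \<epsilon>" using p C by (simp add: field_simps)
    finally show "(\<Sum>k<m. norm (\<gamma> (t k) - \<gamma> (s k))) < \<epsilon>" .
  qed
qed

lemma cis_diag_lipschitz: "norm (cis_diag (t *\<^sub>R \<theta>) - cis_diag (s *\<^sub>R \<theta>)) \<le> norm \<theta> * \<bar>t - s\<bar>"
proof -
  have c: "norm (cis x - cis y) \<le> \<bar>x - y\<bar>" for x y
  proof (rule power2_le_imp_le)
    have "\<bar>sin ((x - y) / 2)\<bar> \<le> \<bar>(x - y) / 2\<bar>" by (rule abs_sin_x_le_abs_x)
    then have "(2 * sin ((x - y) / 2))\<^sup>2 \<le> (x - y)\<^sup>2"
      using power_mono[of "\<bar>sin ((x - y) / 2)\<bar>" "\<bar>(x - y) / 2\<bar>" 2] by (simp add: power_mult_distrib power_divide)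
    then show "(norm (cis x - cis y))\<^sup>2 \<le> \<bar>x - y\<bar>\<^sup>2" by (simp add: norm_cis_diff_square)
  qed simp
  have "cis_diag (t *\<^sub>R \<theta>) - cis_diag (s *\<^sub>R \<theta>) = dg (\<chi> i. cis (t * \<theta> $ i) - cis (s * \<theta> $ i))"
    by (simp add: cis_diag_def vec_eq_iff)
  also have "norm \<dots> \<le> norm ((t - s) *\<^sub>R \<theta>)"
    unfolding norm_dg unfolding norm_vec_def
  proof (rule L2_set_mono)
    fix i
    show "norm ((\<chi> i. cis (t * \<theta> $ i) - cis (s * \<theta> $ i)) $ i) \<le> norm (((t - s) *\<^sub>R \<theta>) $ i)"
      using c[of "t * \<theta> $ i" "s * \<theta> $ i"] by (simp add: left_diff_distrib)
  qed simp
  finally show ?thesis by (simp add: mult.commute)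
qed

lemma cis_diag_has_vector_derivative:
  fixes \<theta> :: "real^'n"
  shows "((\<lambda>t. cis_diag (t *\<^sub>R \<theta>)) has_vector_derivative (imag_diag \<theta> ** cis_diag (t *\<^sub>R \<theta>))) (at t)"
proof -
  \<comment> \<open>\<open>dg\<close> is written as a sum of bounded linear maps of one entry each,
    so that the derivative is taken entry by entry.\<close>
  define e where "e i z = dg (axis i z)" for i :: 'n and z
  have e: "bounded_linear (e i)" for i
    unfolding e_def by (rule linear_conv_bounded_linear[THEN iffD1], rule linearI) (auto simp: vec_eq_iff axis_def)
  have e_nth: "e i z $ j $ k = (if i = j then (if j = k then z else 0) else 0)" for i j k z
    by (simp add: e_def axis_def)
  have sum: "dg c = (\<Sum>i\<in>UNIV. e i (c $ i))" for c
    unfolding vec_eq_iff sum_component e_nth by simp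
  have "((\<lambda>t. cis (t * x)) has_vector_derivative (\<i> * x * cis (t * x))) (at t)" for x t :: real
    unfolding cis_conv_exp
    by (auto intro!: derivative_eq_intros has_vector_derivative_real_field simp: mult_ac)
  then have "((\<lambda>t. \<Sum>i\<in>UNIV. e i (cis (t * \<theta> $ i))) has_vector_derivative (\<Sum>i\<in>UNIV. e i (\<i> * \<theta> $ i * cis (t * \<theta> $ i)))) (at t)"
    by (intro has_vector_derivative_sum bounded_linear.has_vector_derivative[OF e])
  then show ?thesis unfolding cis_diag_def imag_diag_def dg_mult_dg unfolding sum by simp
qed

text \<open>The common setting of both groups. \<open>log_exists\<close> stops short of angles
  \<pi>: in SO(2) the matrix -1, diagonalised by \<open>u = mat 1\<close> with both angles \<pi>,
  would get a non-real logarithm. \<open>emb_diag\<close> provides matrices on which \<Phi> can be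
  read off from \<open>N\<close>.\<close>

locale invariant_norm_group = symmetric_gauge \<Phi> for \<Phi> :: "real^'n \<Rightarrow> real" +
  fixes emb :: "'a::{real_normed_field,euclidean_space}^'n^'n \<Rightarrow> complex^'n^'n"
    and G L :: "('a^'n^'n) set" and N :: "'a^'n^'n \<Rightarrow> real"
  assumes linear_emb: "linear emb" and norm_emb: "norm (emb x) = norm x"
    and emb_mult: "emb (x ** y) = emb x ** emb y" and emb_1: "emb (mat 1) = mat 1"
    and emb_diag: "\<exists>x. emb x = dg (\<chi> i. complex_of_real (d $ i))"
    and G_unitary: "g \<in> G \<Longrightarrow> emb g \<in> unitary_group"
    and G_1: "mat 1 \<in> G" and G_mult: "g \<in> G \<Longrightarrow> h \<in> G \<Longrightarrow> g ** h \<in> G" and G_inv: "g \<in> G \<Longrightarrow> matrix_inv g \<in> G"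
    and inv: "g \<in> G \<Longrightarrow> matrix_inv g ** g = mat 1" "g \<in> G \<Longrightarrow> g ** matrix_inv g = mat 1"
    and L_scaleR: "x \<in> L \<Longrightarrow> r *\<^sub>R x \<in> L" and L_0: "0 \<in> L"
    and L_skew: "x \<in> L \<Longrightarrow> adj (emb x) = - emb x"
    and exp_in_G: "x \<in> L \<Longrightarrow> matrix_exp x \<in> G" and emb_exp: "x \<in> L \<Longrightarrow> emb (matrix_exp x) = matrix_exp (emb x)"
    and log_exists: "g \<in> G \<Longrightarrow> u \<in> unitary_group \<Longrightarrow> (\<And>i. \<bar>\<theta> $ i\<bar> < pi) \<Longrightarrow> emb g = u ** cis_diag \<theta> ** adj u \<Longrightarrow>
      \<exists>x\<in>L. emb x = u ** imag_diag \<theta> ** adj u"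
    and N_norm: "is_norm (*\<^sub>R) N"
    and N_svd: "p \<in> unitary_group \<Longrightarrow> q \<in> unitary_group \<Longrightarrow> (\<And>i. 0 \<le> d $ i) \<Longrightarrow>
      emb x = p ** dg (\<chi> i. complex_of_real (d $ i)) ** q \<Longrightarrow> N x = \<Phi> d"
begin

lemma N_nonneg: "0 \<le> N x" and N_eq_0: "N x = 0 \<longleftrightarrow> x = 0"
  and N_scaleR: "N (c *\<^sub>R x) = \<bar>c\<bar> * N x" and N_triangle: "N (x + y) \<le> N x + N y"
  using N_norm unfolding is_norm_def by simp_all

lemma bounded_linear_emb: "bounded_linear emb"
  using linear_emb by (simp add: linear_conv_bounded_linear)

lemma emb_inj: "emb x = emb y \<Longrightarrow> x = y"
  using norm_emb[of "x - y"] by (simp add: linear_diff[OF linear_emb])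

lemma continuous_on_N: "continuous_on UNIV N"
proof (rule convex_on_continuous[OF open_UNIV])
  show "convex_on UNIV N"
  proof (rule convex_onI)
    fix t :: real and x y assume t: "0 < t" "t < 1"
    show "N ((1 - t) *\<^sub>R x + t *\<^sub>R y) \<le> (1 - t) * N x + t * N y"
      using N_triangle[of "(1 - t) *\<^sub>R x" "t *\<^sub>R y"] t by (simp add: N_scaleR)
  qed simp
qed

lemma N_bound:
  obtains C where "\<And>x. \<bar>N x\<bar> \<le> C * norm x"
proof -
  obtain C where "\<forall>y\<in>N ` sphere 0 1. norm y \<le> C"
    using compact_imp_bounded[OF compact_continuous_image[OF continuous_on_subset[OF continuous_on_N] compact_sphere[of 0 1]]]
    unfolding bounded_iff by auto
  then have C: "N x \<le> C" if "x \<in> sphere 0 1" for x using that by (auto simp: abs_le_iff)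
  have "\<bar>N x\<bar> \<le> C * norm x" for x
  proof (cases "x = 0")
    case False
    then have "N ((1 / norm x) *\<^sub>R x) \<le> C" by (intro C) simp
    with False show ?thesis using N_nonneg[of x] by (simp add: N_scaleR field_simps)
  qed (use N_eq_0[of 0] in simp)
  then show thesis by (rule that)
qed

lemma N_lower_bound:
  obtains K where "K > 0" "\<And>x. norm x \<le> K * N x"
proof -
  have "(sphere 0 1 :: ('a^'n^'n) set) \<noteq> {}" by simp
  then obtain z where z: "z \<in> sphere 0 1" "\<And>x. x \<in> sphere 0 1 \<Longrightarrow> N z \<le> N x"
    using continuous_attains_inf[OF compact_sphere _ continuous_on_subset[OF continuous_on_N], of 0 1] by auto
  have "N z > 0" using z(1) N_nonneg[of z] N_eq_0[of z] by (auto simp: less_le)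
  show thesis
  proof (rule that[of "1 / N z"])
    show "0 < 1 / N z" using \<open>N z > 0\<close> by simp
    fix x show "norm x \<le> 1 / N z * N x"
    proof (cases "x = 0")
      case False
      then have "N z \<le> N ((1 / norm x) *\<^sub>R x)" by (intro z(2)) simp
      with False \<open>N z > 0\<close> show ?thesis by (simp add: N_scaleR field_simps)
    qed (simp add: N_nonneg)
  qed
qed

lemma emb_svd:
  obtains p q d where "p \<in> unitary_group" "q \<in> unitary_group" "\<And>i. 0 \<le> d $ i"
    "emb x = p ** dg (\<chi> i. complex_of_real (d $ i)) ** q" "N x = \<Phi> d" "norm x = norm d"
proof -
  obtain p q d where pq: "p \<in> unitary_group" "q \<in> unitary_group" "\<And>i. 0 \<le> d $ i"
    "emb x = p ** dg (\<chi> i. complex_of_real (d $ i)) ** q" by (rule singular_value_decomposition[of "emb x"]) blast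
  moreover have "N x = \<Phi> d" by (rule N_svd[OF pq])
  moreover have "norm x = norm d"
    unfolding norm_emb[symmetric] pq(4)
    by (simp add: norm_mult_unitary[OF pq(2)] norm_unitary_mult[OF pq(1)] norm_dg norm_of_real_vec)
  ultimately show thesis by (rule that)
qed

text \<open>Group elements embed as unitary factors and are absorbed into the singular value
  decomposition.\<close>

lemma N_mult_left: "g \<in> G \<Longrightarrow> N (g ** x) = N x"
  and N_mult_right: "g \<in> G \<Longrightarrow> N (x ** g) = N x"
proof -
  assume g: "g \<in> G"
  obtain p q d where pq: "p \<in> unitary_group" "q \<in> unitary_group" "\<And>i. 0 \<le> d $ i"
    "emb x = p ** dg (\<chi> i. complex_of_real (d $ i)) ** q" "N x = \<Phi> d" by (rule emb_svd[of x]) blast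
  have "N (g ** x) = \<Phi> d"
    by (rule N_svd[OF unitary_mult[OF G_unitary[OF g] pq(1)] pq(2,3)]) (simp add: emb_mult pq(4) matrix_mul_assoc)
  moreover have "N (x ** g) = \<Phi> d"
    by (rule N_svd[OF pq(1) unitary_mult[OF pq(2) G_unitary[OF g]] pq(3)]) (simp add: emb_mult pq(4) matrix_mul_assoc)
  ultimately show "N (g ** x) = N x" "N (x ** g) = N x" using pq(5) by simp_all
qed

text \<open>Splitting off the phases of the diagonal entries turns the spectral decomposition into a
  singular value decomposition with singular numbers
  \<open>\<bar>\<theta> $ i\<bar>\<close>.\<close>

lemma N_imag_diag:
  assumes u: "u \<in> unitary_group" and x: "emb x = u ** imag_diag \<theta> ** adj u"
  shows "N x = \<Phi> \<theta>"
proof -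
  define c where "c = (\<chi> i. \<i> * (if \<theta> $ i \<ge> 0 then 1 else - 1))"
  define d where "d = (\<chi> i. \<bar>\<theta> $ i\<bar>)"
  have "dg c \<in> unitary_group" by (rule unitary_dg) (simp add: c_def norm_mult)
  moreover have "imag_diag \<theta> = dg c ** dg (\<chi> i. complex_of_real (d $ i))"
    by (simp add: imag_diag_def dg_mult_dg vec_eq_iff c_def d_def)
  ultimately have "N x = \<Phi> d"
    by (intro N_svd[OF unitary_mult[OF u] unitary_adj[OF u]]) (simp_all add: x matrix_mul_assoc d_def)
  then show ?thesis by (simp add: d_def Phi_abs)
qed

lemma lie_algebra_spectral:
  assumes "x \<in> L"
  obtains u \<theta> where "u \<in> unitary_group" "emb x = u ** imag_diag \<theta> ** adj u" "N x = \<Phi> \<theta>"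
    "\<And>t. emb (matrix_exp (t *\<^sub>R x)) = u ** cis_diag (t *\<^sub>R \<theta>) ** adj u"
proof -
  obtain u \<theta> where u: "u \<in> unitary_group" "emb x = u ** imag_diag \<theta> ** adj u"
    using skew_hermitian_spectral[OF L_skew[OF assms]] by blast
  have "emb (matrix_exp (t *\<^sub>R x)) = u ** cis_diag (t *\<^sub>R \<theta>) ** adj u" for t
  proof -
    have "emb (t *\<^sub>R x) = u ** imag_diag (t *\<^sub>R \<theta>) ** adj u"
      unfolding linear_scale[OF linear_emb] u(2)
      by (simp add: vec_eq_iff imag_diag_def mult_dg_mult_nth scaleR_sum_right)
        (simp add: scaleR_conv_of_real mult_ac)
    then show ?thesis
      by (simp add: emb_exp[OF L_scaleR[OF assms]] matrix_exp_imag_diag[OF u(1)])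
  qed
  with u N_imag_diag[OF u] show thesis by (intro that)
qed

lemma dual_norm_le_N: "norming a e \<Longrightarrow> dual_norm a (emb v) \<le> N v"
  using dual_norm_le_Phi emb_svd[of v] by metis

lemma dual_norm_eq_N:
  assumes "strictly_convex_norm \<Phi>" "norming a e" "e \<noteq> 0" "dual_norm a (emb v) = N v"
  shows "norm v = N v / \<Phi> e * norm e"
  using dual_norm_eq_Phi[OF assms(1-3)] assms(4) emb_svd[of v] by metis

subsection \<open>Lengths of curves\<close>

lemma N_speed_integrable:
  assumes "abs_continuous a b \<gamma>" "a \<le> b"
  shows "(\<lambda>t. N (vector_derivative \<gamma> (at t))) absolutely_integrable_on {a..b}"
    "(\<lambda>t. N (vector_derivative \<gamma> (at t))) integrable_on {a..b}"
proof -
  obtain C where "\<And>x. \<bar>N x\<bar> \<le> C * norm x" by (rule N_bound) blast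
  then show "(\<lambda>t. N (vector_derivative \<gamma> (at t))) absolutely_integrable_on {a..b}"
    by (rule absolutely_integrable_continuous_compose[OF abs_continuous_fundamental_theorem(2)[OF assms] continuous_on_N])
  then show "(\<lambda>t. N (vector_derivative \<gamma> (at t))) integrable_on {a..b}"
    by (rule set_lebesgue_integral_eq_integral(1))
qed

lemma curve_length_nonneg: "abs_continuous a b \<gamma> \<Longrightarrow> 0 \<le> curve_length N a b \<gamma>"
proof (cases "a \<le> b")
  case True
  assume "abs_continuous a b \<gamma>"
  then show ?thesis unfolding curve_length_def
    by (intro Henstock_Kurzweil_Integration.integral_nonneg N_speed_integrable(2) True N_nonneg)
qed (simp add: curve_length_def)

lemma curve_length_combine:
  assumes "abs_continuous a b \<gamma>" "a \<le> c" "c \<le> b"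
  shows "curve_length N a c \<gamma> + curve_length N c b \<gamma> = curve_length N a b \<gamma>"
  unfolding curve_length_def using assms
  by (intro Henstock_Kurzweil_Integration.integral_combine N_speed_integrable) auto

text \<open>Where the curve is not differentiable \<open>vector_derivative\<close> is an unspecified
  value, so it is known to commute with \<open>T\<close> only off a null set.\<close>

lemma speed_bounded_linear:
  fixes \<gamma> :: "real \<Rightarrow> 'e::euclidean_space" and T :: "'e \<Rightarrow> 'f::euclidean_space"
  assumes ac: "abs_continuous a b \<gamma>" and ab: "a \<le> b" and T: "bounded_linear T"
  obtains Z where "negligible Z"
    "\<And>t. t \<in> {a..b} - Z \<Longrightarrow> vector_derivative (\<lambda>t. T (\<gamma> t)) (at t) = T (vector_derivative \<gamma> (at t))"
proof (rule that[of "{t\<in>{a<..<b}. \<not> \<gamma> differentiable (at t)} \<union> {a, b}"])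
  show "negligible ({t\<in>{a<..<b}. \<not> \<gamma> differentiable (at t)} \<union> {a, b})"
    by (intro negligible_Un abs_continuous_fundamental_theorem(1)[OF ac ab]) auto
  fix t assume "t \<in> {a..b} - ({t\<in>{a<..<b}. \<not> \<gamma> differentiable (at t)} \<union> {a, b})"
  then have "\<gamma> differentiable (at t)" by auto
  then have "(\<gamma> has_vector_derivative vector_derivative \<gamma> (at t)) (at t)" by (simp add: vector_derivative_works)
  from bounded_linear.has_vector_derivative[OF T this]
  show "vector_derivative (\<lambda>t. T (\<gamma> t)) (at t) = T (vector_derivative \<gamma> (at t))" by (rule vector_derivative_at)
qed

lemma curve_length_translate:
  assumes ac: "abs_continuous a b \<gamma>" and ab: "a \<le> b" and g: "g \<in> G"
  shows "curve_length N a b (\<lambda>t. g ** \<gamma> t) = curve_length N a b \<gamma>"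
proof -
  obtain Z where Z: "negligible Z" "\<And>t. t \<in> {a..b} - Z \<Longrightarrow>
      vector_derivative (\<lambda>t. g ** \<gamma> t) (at t) = g ** vector_derivative \<gamma> (at t)"
    using speed_bounded_linear[OF ac ab bounded_linear_matrix_mult_left[of g]] by blast
  show ?thesis unfolding curve_length_def
    by (rule integral_spike[OF Z(1)]) (simp add: Z(2) N_mult_left[OF g])
qed

text \<open>The length as seen by a norming functional. It is kept apart from the
  \<open>N\<close>-length because the gap between the two decides the strictly convex case.\<close>

lemma dual_length_le:
  assumes ac: "abs_continuous a b \<gamma>" and ab: "a \<le> b" and \<gamma>: "\<gamma> ` {a..b} \<subseteq> G" "\<gamma> a = mat 1"
    and ang: "angles (emb (\<gamma> b)) w \<theta>" and nrm: "norming n (\<chi> i. \<bar>\<theta> $ i\<bar>)"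
  shows "\<Phi> \<theta> \<le> integral {a..b} (\<lambda>t. dual_norm n (emb (vector_derivative \<gamma> (at t))))"
    and "(\<lambda>t. dual_norm n (emb (vector_derivative \<gamma> (at t)))) integrable_on {a..b}"
proof -
  have n0: "\<And>i. 0 \<le> n $ i" using nrm by (simp add: norming_def)
  note ace = abs_continuous_bounded_linear[OF bounded_linear_emb ac]
  obtain Z where Z: "negligible Z" "\<And>t. t \<in> {a..b} - Z \<Longrightarrow>
      vector_derivative (\<lambda>t. emb (\<gamma> t)) (at t) = emb (vector_derivative \<gamma> (at t))"
    using speed_bounded_linear[OF ac ab bounded_linear_emb] by blast
  have "(\<lambda>t. dual_norm n (vector_derivative (\<lambda>t. emb (\<gamma> t)) (at t))) absolutely_integrable_on {a..b}"
    by (rule curve_growth.integrable_speed[OF angle_norm_curve_growth[OF n0] ace ab])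
  then have "(\<lambda>t. dual_norm n (vector_derivative (\<lambda>t. emb (\<gamma> t)) (at t))) integrable_on {a..b}"
    by (rule set_lebesgue_integral_eq_integral(1))
  then show "(\<lambda>t. dual_norm n (emb (vector_derivative \<gamma> (at t)))) integrable_on {a..b}"
    by (rule integrable_spike[OF _ Z(1)]) (simp add: Z(2))
  have "\<Phi> \<theta> = (\<Sum>i\<in>UNIV. n $ i * \<bar>\<theta> $ i\<bar>)"
    using nrm by (simp add: norming_def inner_vec_def Phi_abs)
  also have "\<dots> \<le> integral {a..b} (\<lambda>t. dual_norm n (vector_derivative (\<lambda>t. emb (\<gamma> t)) (at t)))"
    by (rule angles_le_dual_length[OF n0 ace ab _ _ ang]) (use \<gamma> G_unitary in \<open>auto simp: emb_1\<close>)
  also have "\<dots> = integral {a..b} (\<lambda>t. dual_norm n (emb (vector_derivative \<gamma> (at t))))"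
    by (rule integral_spike[OF Z(1)]) (simp add: Z(2))
  finally show "\<Phi> \<theta> \<le> integral {a..b} (\<lambda>t. dual_norm n (emb (vector_derivative \<gamma> (at t))))" .
qed

lemma abs_vec_eq_0: "(\<chi> i. \<bar>\<theta> $ i\<bar>) = 0 \<longleftrightarrow> \<theta> = (0 :: real^'n)"
  by (simp add: vec_eq_iff)

text \<open>A norming functional of |\<theta>| recovers \<open>\<Phi> \<theta>\<close> from the
  angles of the endpoint, and its dual norm never exceeds \<open>N\<close>. The case \<theta> = 0 is
  split off since \<open>norming_exists\<close> asks for a nonzero vector.\<close>

lemma length_ge_Phi_from_1:
  assumes ac: "abs_continuous a b \<gamma>" and ab: "a \<le> b" and \<gamma>: "\<gamma> ` {a..b} \<subseteq> G" "\<gamma> a = mat 1"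
    and ang: "angles (emb (\<gamma> b)) w \<theta>"
  shows "\<Phi> \<theta> \<le> curve_length N a b \<gamma>"
proof (cases "\<theta> = 0")
  case True
  then show ?thesis using curve_length_nonneg[OF ac] Phi_eq_0[of 0] by simp
next
  case False
  then obtain n where n: "norming n (\<chi> i. \<bar>\<theta> $ i\<bar>)"
    using norming_exists[of "\<chi> i. \<bar>\<theta> $ i\<bar>"] abs_vec_eq_0[of \<theta>] by auto
  have "\<Phi> \<theta> \<le> integral {a..b} (\<lambda>t. dual_norm n (emb (vector_derivative \<gamma> (at t))))"
    by (rule dual_length_le(1)[OF ac ab \<gamma> ang n])
  also have "\<dots> \<le> curve_length N a b \<gamma>" unfolding curve_length_def
    by (intro integral_le dual_length_le(2)[OF ac ab \<gamma> ang n] N_speed_integrable(2)[OF ac ab] dual_norm_le_N[OF n])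
  finally show ?thesis .
qed

lemma abs_continuous_translate:
  "abs_continuous a b \<gamma> \<Longrightarrow> abs_continuous a b (\<lambda>t. g ** \<gamma> t)" for \<gamma> :: "real \<Rightarrow> 'a^'n^'n"
  using abs_continuous_bounded_linear[OF bounded_linear_matrix_mult_left] by blast

lemma connecting_curve_translate:
  assumes "connecting_curve G u v a b \<gamma>" "g \<in> G"
  shows "connecting_curve G (g ** u) (g ** v) a b (\<lambda>t. g ** \<gamma> t)"
  using assms unfolding connecting_curve_def by (auto intro: abs_continuous_translate G_mult)

lemma connecting_curve_normalize:
  assumes c: "connecting_curve G u v a b \<gamma>"
  shows "u \<in> G" "connecting_curve G (mat 1) (matrix_inv u ** v) a b (\<lambda>t. matrix_inv u ** \<gamma> t)"
    "curve_length N a b (\<lambda>t. matrix_inv u ** \<gamma> t) = curve_length N a b \<gamma>"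
proof -
  show u: "u \<in> G" using c unfolding connecting_curve_def by auto
  show "connecting_curve G (mat 1) (matrix_inv u ** v) a b (\<lambda>t. matrix_inv u ** \<gamma> t)"
    using connecting_curve_translate[OF c G_inv[OF u]] inv(1)[OF u] by simp
  show "curve_length N a b (\<lambda>t. matrix_inv u ** \<gamma> t) = curve_length N a b \<gamma>"
    using c by (intro curve_length_translate G_inv[OF u]) (auto simp: connecting_curve_def)
qed

lemma length_ge_Phi:
  assumes c: "connecting_curve G u v a b \<gamma>" and ang: "angles (emb (matrix_inv u ** v)) w \<theta>"
  shows "\<Phi> \<theta> \<le> curve_length N a b \<gamma>"
proof -
  note n = connecting_curve_normalize[OF c]
  have "\<Phi> \<theta> \<le> curve_length N a b (\<lambda>t. matrix_inv u ** \<gamma> t)"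
    by (rule length_ge_Phi_from_1) (use n(2) ang in \<open>auto simp: connecting_curve_def\<close>)
  with n(3) show ?thesis by simp
qed

subsection \<open>One-parameter subgroups\<close>

context
  fixes u x assumes u: "u \<in> G" and x: "x \<in> L"
begin

lemma exp_curve_in_G: "u ** matrix_exp (t *\<^sub>R x) \<in> G"
  by (intro G_mult u exp_in_G L_scaleR x)

text \<open>The derivative is taken in the eigenbasis over the complex matrices; the linear left
  inverse \<open>R\<close> of \<open>emb\<close> carries it back.\<close>

lemma exp_curve_has_vector_derivative:
  "((\<lambda>t. u ** matrix_exp (t *\<^sub>R x)) has_vector_derivative (u ** (x ** matrix_exp (t *\<^sub>R x)))) (at t)"
proof -
  obtain w \<theta> where w: "w \<in> unitary_group" "emb x = w ** imag_diag \<theta> ** adj w"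
    "\<And>t. emb (matrix_exp (t *\<^sub>R x)) = w ** cis_diag (t *\<^sub>R \<theta>) ** adj w"
    using lie_algebra_spectral[OF x] by metis
  have T: "bounded_linear (\<lambda>m. w ** m ** adj w)"
    using bounded_linear_compose[OF bounded_bilinear.bounded_linear_left[OF bounded_bilinear_matrix_mult] bounded_bilinear.bounded_linear_right[OF bounded_bilinear_matrix_mult]] .
  obtain R where R: "linear R" "\<And>x. R (emb x) = x"
    using linear_injective_left_inverse[OF linear_emb] emb_inj by (metis injI comp_apply id_apply)
  have "((\<lambda>t. emb (matrix_exp (t *\<^sub>R x))) has_vector_derivative (w ** (imag_diag \<theta> ** cis_diag (t *\<^sub>R \<theta>)) ** adj w)) (at t)"
    unfolding w(3) by (rule bounded_linear.has_vector_derivative[OF T cis_diag_has_vector_derivative])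
  moreover have "w ** (imag_diag \<theta> ** cis_diag (t *\<^sub>R \<theta>)) ** adj w = emb (x ** matrix_exp (t *\<^sub>R x))"
    by (simp add: emb_mult w(2,3) matrix_mul_assoc[symmetric] unitary_cancel[OF w(1)])
  ultimately have "((\<lambda>t. emb (matrix_exp (t *\<^sub>R x))) has_vector_derivative emb (x ** matrix_exp (t *\<^sub>R x))) (at t)" by simp
  from bounded_linear.has_vector_derivative[OF R(1)[unfolded linear_conv_bounded_linear] this]
  have "((\<lambda>t. matrix_exp (t *\<^sub>R x)) has_vector_derivative (x ** matrix_exp (t *\<^sub>R x))) (at t)" by (simp add: R(2))
  from bounded_linear.has_vector_derivative[OF bounded_linear_matrix_mult_left[of u] this] show ?thesis .
qed

lemma exp_curve_abs_continuous: "abs_continuous a b (\<lambda>t. u ** matrix_exp (t *\<^sub>R x))"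
proof (rule abs_continuous_translate)
  obtain w \<theta> where w: "w \<in> unitary_group" "\<And>t. emb (matrix_exp (t *\<^sub>R x)) = w ** cis_diag (t *\<^sub>R \<theta>) ** adj w"
    using lie_algebra_spectral[OF x] by metis
  show "abs_continuous a b (\<lambda>t. matrix_exp (t *\<^sub>R x))"
  proof (rule abs_continuous_lipschitz)
    fix s t :: real assume st: "s \<le> t"
    have "norm (matrix_exp (t *\<^sub>R x) - matrix_exp (s *\<^sub>R x)) = norm (w ** (cis_diag (t *\<^sub>R \<theta>) - cis_diag (s *\<^sub>R \<theta>)) ** adj w)"
      unfolding norm_emb[symmetric, of "_ - _"] linear_diff[OF linear_emb] w(2)
      by (simp add: bounded_bilinear.diff_left[OF bounded_bilinear_matrix_mult] bounded_bilinear.diff_right[OF bounded_bilinear_matrix_mult])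
    also have "\<dots> \<le> norm \<theta> * (t - s)"
      using cis_diag_lipschitz[of t \<theta> s] st by (simp add: norm_mult_unitary[OF unitary_adj[OF w(1)]] norm_unitary_mult[OF w(1)])
    finally show "norm (matrix_exp (t *\<^sub>R x) - matrix_exp (s *\<^sub>R x)) \<le> norm \<theta> * (t - s)" .
  qed
qed

lemma exp_curve_length:
  assumes "a \<le> b"
  shows "curve_length N a b (\<lambda>t. u ** matrix_exp (t *\<^sub>R x)) = (b - a) * N x"
proof -
  have "N (vector_derivative (\<lambda>t. u ** matrix_exp (t *\<^sub>R x)) (at t)) = N x" for t
    unfolding vector_derivative_at[OF exp_curve_has_vector_derivative]
    by (simp add: N_mult_left[OF u] N_mult_right[OF exp_in_G[OF L_scaleR[OF x]]])
  then show ?thesis using assms by (simp add: curve_length_def)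
qed

lemma exp_curve_shift: "u ** matrix_exp (t *\<^sub>R x) = (u ** matrix_exp (s *\<^sub>R x)) ** matrix_exp ((t - s) *\<^sub>R x)"
proof (rule emb_inj)
  obtain w \<theta> where w: "w \<in> unitary_group" "\<And>t. emb (matrix_exp (t *\<^sub>R x)) = w ** cis_diag (t *\<^sub>R \<theta>) ** adj w"
    using lie_algebra_spectral[OF x] by metis
  have "cis_diag (s *\<^sub>R \<theta>) ** cis_diag ((t - s) *\<^sub>R \<theta>) = cis_diag (t *\<^sub>R \<theta>)"
    by (simp add: cis_diag_def dg_mult_dg cis_mult algebra_simps)
  then have "w ** (cis_diag (s *\<^sub>R \<theta>) ** cis_diag ((t - s) *\<^sub>R \<theta>)) ** adj w = w ** cis_diag (t *\<^sub>R \<theta>) ** adj w" by simp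
  then show "emb (u ** matrix_exp (t *\<^sub>R x)) = emb ((u ** matrix_exp (s *\<^sub>R x)) ** matrix_exp ((t - s) *\<^sub>R x))"
    by (simp add: emb_mult w(2) matrix_mul_assoc[symmetric] unitary_cancel[OF w(1)])
qed

lemma exp_curve_0: "u ** matrix_exp (0 *\<^sub>R x) = u"
proof (rule emb_inj)
  obtain w \<theta> where w: "w \<in> unitary_group" "\<And>t. emb (matrix_exp (t *\<^sub>R x)) = w ** cis_diag (t *\<^sub>R \<theta>) ** adj w"
    using lie_algebra_spectral[OF x] by metis
  show "emb (u ** matrix_exp (0 *\<^sub>R x)) = emb u"
    unfolding emb_mult w(2) by (simp add: cis_diag_def dg_1 unitary_mult_adj[OF w(1)])
qed

end

text \<open>The exponential arc has length \<open>N x\<close>, which is exactly the lower bound of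
  \<open>length_ge_Phi\<close>; angles of modulus \<pi> are still allowed here.\<close>

lemma dist_exp:
  assumes u: "u \<in> G" and x: "x \<in> L" and w: "w \<in> unitary_group" "emb x = w ** imag_diag \<theta> ** adj w" and \<theta>: "\<And>i. \<bar>\<theta> $ i\<bar> \<le> pi"
  shows "intrinsic_dist G N u (u ** matrix_exp x) = N x"
    and "connecting_curve G u (u ** matrix_exp x) 0 1 (\<lambda>t. u ** matrix_exp (t *\<^sub>R x))"
proof -
  show c: "connecting_curve G u (u ** matrix_exp x) 0 1 (\<lambda>t. u ** matrix_exp (t *\<^sub>R x))"
    unfolding connecting_curve_def
    using exp_curve_abs_continuous[OF u x] exp_curve_in_G[OF u x] exp_curve_0[OF u x] by auto
  have "matrix_inv u ** (u ** matrix_exp x) = matrix_exp x" by (simp add: matrix_mul_assoc inv(1)[OF u])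
  then have ang: "angles (emb (matrix_inv u ** (u ** matrix_exp x))) w \<theta>"
    using w \<theta> by (simp add: angles_def emb_exp[OF x] matrix_exp_imag_diag)
  show "intrinsic_dist G N u (u ** matrix_exp x) = N x"
    unfolding intrinsic_dist_def
  proof (rule cInf_eq_minimum)
    show "N x \<in> {curve_length N a b \<gamma> |a b \<gamma>. connecting_curve G u (u ** matrix_exp x) a b \<gamma>}"
      using c exp_curve_length[OF u x, of 0 1] by force
    show "N x \<le> y" if "y \<in> {curve_length N a b \<gamma> |a b \<gamma>. connecting_curve G u (u ** matrix_exp x) a b \<gamma>}" for y
      using that length_ge_Phi[OF _ ang] N_imag_diag[OF w] by auto
  qed
qed

theorem exp_curve_geodesic:
  assumes u: "u \<in> G" and x: "x \<in> L"
  shows "geodesic G N UNIV (\<lambda>t. u ** matrix_exp (t *\<^sub>R x))"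
  unfolding geodesic_def
proof (intro conjI ballI allI impI)
  let ?\<gamma> = "\<lambda>t. u ** matrix_exp (t *\<^sub>R x)"
  show "is_interval (UNIV :: real set)" by simp
  show "?\<gamma> ` UNIV \<subseteq> G" using exp_curve_in_G[OF u x] by auto
  show "abs_continuous a b ?\<gamma>" for a b by (rule exp_curve_abs_continuous[OF u x])
  fix t :: real
  obtain w \<theta> where w: "w \<in> unitary_group" "emb x = w ** imag_diag \<theta> ** adj w" "N x = \<Phi> \<theta>"
    using lie_algebra_spectral[OF x] by metis
  \<comment> \<open>The summand 1 keeps \<open>B\<close> positive when \<theta> = 0.\<close>
  define B where "B = norm \<theta> + 1"
  have B: "\<bar>\<theta> $ i\<bar> \<le> B" for i using component_le_norm_cart[of \<theta> i] by (simp add: B_def)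
  have "B > 0" unfolding B_def using norm_ge_zero[of \<theta>] by linarith
  \<comment> \<open>An arc of length \<open>(b - a) * N x\<close> below \<open>N x * pi / B\<close>
    satisfies \<open>(b - a) * B < pi\<close>, so its angles stay within \<pi>. For
    \<open>N x = 0\<close> the curve is constant and any radius will do.\<close>
  define \<epsilon> where "\<epsilon> = (if N x = 0 then 1 else N x * pi / B)"
  show "\<exists>\<epsilon>>0. \<forall>a\<in>UNIV. \<forall>b\<in>UNIV. a \<le> t \<and> t \<le> b \<and> curve_length N a b ?\<gamma> < \<epsilon> \<longrightarrow>
       curve_length N a b ?\<gamma> = intrinsic_dist G N (?\<gamma> a) (?\<gamma> b)"
  proof (intro exI[of _ \<epsilon>] conjI ballI impI)
    show "\<epsilon> > 0" using \<open>B > 0\<close> N_nonneg[of x] by (auto simp: \<epsilon>_def less_le)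
    fix a b :: real assume "a \<le> t \<and> t \<le> b \<and> curve_length N a b ?\<gamma> < \<epsilon>"
    then have ab: "a \<le> b" and len: "(b - a) * N x < \<epsilon>" using exp_curve_length[OF u x, of a b] by auto
    define y where "y = (b - a) *\<^sub>R x"
    have y: "y \<in> L" unfolding y_def by (rule L_scaleR[OF x])
    have ey: "emb y = w ** imag_diag ((b - a) *\<^sub>R \<theta>) ** adj w"
      unfolding y_def linear_scale[OF linear_emb] w(2)
      by (simp add: vec_eq_iff imag_diag_def mult_dg_mult_nth scaleR_sum_right)
        (simp add: scaleR_conv_of_real mult_ac)
    have "\<bar>((b - a) *\<^sub>R \<theta>) $ i\<bar> \<le> pi" for i
    proof (cases "N x = 0")
      case True
      then have "\<theta> = 0" using w(3) Phi_eq_0 by simp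
      then show ?thesis by simp
    next
      case False
      then have "(b - a) * N x < N x * pi / B" using len by (simp add: \<epsilon>_def)
      then have "N x * ((b - a) * B) < N x * pi" using \<open>B > 0\<close> by (simp add: pos_less_divide_eq mult_ac)
      moreover have "N x > 0" using False N_nonneg[of x] by simp
      ultimately have "(b - a) * B < pi" by (simp only: mult_less_cancel_left_pos)
      moreover have "(b - a) * \<bar>\<theta> $ i\<bar> \<le> (b - a) * B" using ab B by (intro mult_left_mono) auto
      ultimately show ?thesis using ab by (simp add: abs_mult)
    qed
    from dist_exp(1)[OF exp_curve_in_G[OF u x] y w(1) ey this, of a]
    show "curve_length N a b ?\<gamma> = intrinsic_dist G N (?\<gamma> a) (?\<gamma> b)"
      using exp_curve_length[OF u x ab] ab N_scaleR[of "b - a" x] exp_curve_shift[OF u x, of b a]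
      by (simp add: y_def)
  qed
qed

subsection \<open>Strictly convex norms\<close>

text \<open>Minimality makes the nonnegative deficit \<open>f\<close> of the dual norm against
  \<open>N\<close> integrate to 0. Where it vanishes, the Frobenius speed is a fixed multiple of the
  \<open>N\<close>-speed, so the fraction of \<open>N\<close>-length covered serves as
  parameter.\<close>

lemma shortest_from_1:
  assumes strict: "strictly_convex_norm \<Phi>"
    and ac: "abs_continuous a b \<gamma>" and ab: "a \<le> b" and \<gamma>: "\<gamma> ` {a..b} \<subseteq> G" "\<gamma> a = mat 1"
    and ang: "angles (emb (\<gamma> b)) w \<theta>" and \<theta>: "\<And>i. \<bar>\<theta> $ i\<bar> < pi" "\<theta> \<noteq> 0"
    and x: "x \<in> L" "emb x = w ** imag_diag \<theta> ** adj w"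
    and len: "curve_length N a b \<gamma> \<le> \<Phi> \<theta>" and t: "a \<le> t" "t \<le> b"
  shows "\<gamma> t = matrix_exp ((curve_length N a t \<gamma> / \<Phi> \<theta>) *\<^sub>R x)"
proof -
  define e where "e = (\<chi> i. \<bar>\<theta> $ i\<bar>)"
  have "e \<noteq> 0" using \<theta>(2) abs_vec_eq_0[of \<theta>] by (simp add: e_def)
  have \<Phi>e: "\<Phi> e = \<Phi> \<theta>" "norm e = norm \<theta>" by (simp_all add: e_def Phi_abs norm_vec_def)
  have pos: "\<Phi> \<theta> > 0" by (rule Phi_pos[OF \<theta>(2)])
  obtain n where n: "norming n e" using norming_exists[of e] \<open>e \<noteq> 0\<close> by (auto simp: e_def)
  define v where "v t = vector_derivative \<gamma> (at t)" for t
  define f where "f t = N (v t) - dual_norm n (emb (v t))" for t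
  note dl = dual_length_le[OF ac ab \<gamma> ang n[unfolded e_def], folded v_def]
  note iN = N_speed_integrable[OF ac ab, folded v_def]
  have f0: "0 \<le> f t" for t using dual_norm_le_N[OF n] by (simp add: f_def)
  have fi: "f integrable_on {a..b}" unfolding f_def by (intro integrable_diff iN dl)
  have "integral {a..b} f = integral {a..b} (\<lambda>t. N (v t)) - integral {a..b} (\<lambda>t. dual_norm n (emb (v t)))"
    unfolding f_def by (rule Henstock_Kurzweil_Integration.integral_diff[OF iN(2) dl(2)])
  then have "integral {a..b} f \<le> 0"
    using dl(1) len unfolding curve_length_def v_def[symmetric] by linarith
  moreover have "0 \<le> integral {a..b} f" by (rule Henstock_Kurzweil_Integration.integral_nonneg[OF fi f0])
  ultimately have "(f has_integral 0) {a..b}" using fi by (simp add: has_integral_iff)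
  then have neg: "negligible {t\<in>{a..b}. f t \<noteq> 0}"
    by (rule has_integral_0_negligible[OF f0])
  have speed: "norm (v t) = N (v t) / \<Phi> \<theta> * norm \<theta>" if "f t = 0" for t
    using dual_norm_eq_N[OF strict n \<open>e \<noteq> 0\<close>, of "v t"] that by (simp add: f_def \<Phi>e)
  have w: "w \<in> unitary_group" and gb: "emb (\<gamma> b) = w ** cis_diag \<theta> ** adj w" using ang by (auto simp: angles_def)
  \<comment> \<open>Passage to the eigenbasis of the endpoint, a Frobenius isometry that makes the
    endpoint diagonal.\<close>
  define T where "T m = adj w ** emb m ** w" for m
  have T: "bounded_linear T"
    unfolding T_def
    by (rule bounded_linear_compose[OF bounded_bilinear.bounded_linear_left[OF bounded_bilinear_matrix_mult]
        bounded_linear_compose[OF bounded_bilinear.bounded_linear_right[OF bounded_bilinear_matrix_mult] bounded_linear_emb]])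
  define \<kappa> where "\<kappa> t = T (\<gamma> t)" for t
  have ac\<kappa>: "abs_continuous a b \<kappa>" unfolding \<kappa>_def by (rule abs_continuous_bounded_linear[OF T ac])
  obtain Z where Z: "negligible Z" "\<And>t. t \<in> {a..b} - Z \<Longrightarrow> vector_derivative \<kappa> (at t) = T (v t)"
    unfolding \<kappa>_def v_def using speed_bounded_linear[OF ac ab T] by blast
  have normT: "norm (T m) = norm m" for m
    by (simp add: T_def norm_mult_unitary[OF w] norm_unitary_mult[OF unitary_adj[OF w]] norm_emb)
  \<comment> \<open>Frobenius length and \<open>N\<close>-length are proportional on every subarc,
    so the bounds required on both sides of \<open>t\<close> can be stated with
    \<open>N\<close>-lengths.\<close>
  have frob: "integral {r..s} (\<lambda>t. norm (vector_derivative \<kappa> (at t))) = curve_length N r s \<gamma> / \<Phi> \<theta> * norm \<theta>"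
    if "a \<le> r" "s \<le> b" for r s
  proof -
    have "integral {r..s} (\<lambda>t. norm (vector_derivative \<kappa> (at t))) = integral {r..s} (\<lambda>t. norm \<theta> / \<Phi> \<theta> * N (v t))"
    proof (rule integral_spike[OF negligible_Un[OF Z(1) neg]])
      fix t assume "t \<in> {r..s} - (Z \<union> {t \<in> {a..b}. f t \<noteq> 0})"
      with that show "norm \<theta> / \<Phi> \<theta> * N (v t) = norm (vector_derivative \<kappa> (at t))"
        using Z(2)[of t] speed[of t] by (simp add: normT)
    qed
    then show ?thesis by (simp add: curve_length_def v_def)
  qed
  have "\<kappa> t = cis_diag ((curve_length N a t \<gamma> / \<Phi> \<theta>) *\<^sub>R \<theta>)"
  proof (rule frobenius_shortest_curve[OF ac\<kappa> _ _ _ \<theta> t])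
    show "\<kappa> ` {a..b} \<subseteq> unitary_group"
      using \<gamma>(1) w by (auto simp: \<kappa>_def T_def intro!: unitary_mult unitary_adj G_unitary)
    show "\<kappa> a = mat 1" by (simp add: \<kappa>_def T_def \<gamma>(2) emb_1 unitary_adj_mult[OF w])
    show "\<kappa> b = cis_diag \<theta>"
      by (simp add: \<kappa>_def T_def gb matrix_mul_assoc[symmetric] unitary_cancel[OF w] unitary_adj_mult[OF w])
    show "integral {a..t} (\<lambda>t. norm (vector_derivative \<kappa> (at t))) \<le> curve_length N a t \<gamma> / \<Phi> \<theta> * norm \<theta>"
      using frob[of a t] t by simp
    have "curve_length N t b \<gamma> / \<Phi> \<theta> \<le> 1 - curve_length N a t \<gamma> / \<Phi> \<theta>"
      using curve_length_combine[OF ac t] len pos by (simp add: field_simps)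
    then show "integral {t..b} (\<lambda>t. norm (vector_derivative \<kappa> (at t))) \<le> (1 - curve_length N a t \<gamma> / \<Phi> \<theta>) * norm \<theta>"
      unfolding frob[OF t(1) order.refl] by (rule mult_right_mono) simp
  qed
  then have "w ** \<kappa> t ** adj w = w ** cis_diag ((curve_length N a t \<gamma> / \<Phi> \<theta>) *\<^sub>R \<theta>) ** adj w" by simp
  also have "w ** \<kappa> t ** adj w = emb (\<gamma> t)"
    by (simp add: \<kappa>_def T_def matrix_mul_assoc[symmetric] unitary_cancel[OF w] unitary_mult_adj[OF w])
  also have "w ** cis_diag (l *\<^sub>R \<theta>) ** adj w = emb (matrix_exp (l *\<^sub>R x))" for l
  proof -
    have "emb (l *\<^sub>R x) = w ** imag_diag (l *\<^sub>R \<theta>) ** adj w"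
      unfolding linear_scale[OF linear_emb] x(2)
      by (simp add: vec_eq_iff imag_diag_def mult_dg_mult_nth scaleR_sum_right)
        (simp add: scaleR_conv_of_real mult_ac)
    then show ?thesis by (simp add: emb_exp[OF L_scaleR[OF x(1)]] matrix_exp_imag_diag[OF w])
  qed
  finally show ?thesis by (rule emb_inj)
qed

lemma zero_length_constant:
  assumes ac: "abs_continuous a b \<gamma>" and "curve_length N a b \<gamma> = 0" and t: "a \<le> t" "t \<le> b"
  shows "\<gamma> t = \<gamma> a"
proof -
  have ab: "a \<le> b" using t by simp
  have "((\<lambda>t. N (vector_derivative \<gamma> (at t))) has_integral 0) {a..b}"
    using N_speed_integrable(2)[OF ac ab] assms(2) by (simp add: curve_length_def has_integral_iff)
  then have neg: "negligible {t\<in>{a..b}. N (vector_derivative \<gamma> (at t)) \<noteq> 0}"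
    by (rule has_integral_0_negligible[OF N_nonneg])
  have "((\<lambda>t. 0) has_integral (\<gamma> t - \<gamma> a)) {a..t}"
    by (rule has_integral_spike[OF neg _ abs_continuous_fundamental_theorem(3)[OF ac ab order.refl t]])
      (use t in \<open>auto simp: N_eq_0\<close>)
  then show ?thesis using has_integral_unique[OF has_integral_0] by fastforce
qed

text \<open>Parametrising by arc length makes two shortest curves comparable. Fixing
  \<open>w\<close> and \<theta> in advance pins down
  \<open>\<Phi> \<theta> *\<^sub>R y\<close>.\<close>

lemma shortest_form:
  assumes strict: "strictly_convex_norm \<Phi>" and c: "connecting_curve G u v a b \<gamma>"
    and len: "curve_length N a b \<gamma> = intrinsic_dist G N u v"
    and ang: "angles (emb (matrix_inv u ** v)) w \<theta>" and \<theta>: "\<And>i. \<bar>\<theta> $ i\<bar> < pi"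
  obtains y where "y \<in> L" "\<And>t. t \<in> {a..b} \<Longrightarrow> \<gamma> t = u ** matrix_exp (curve_length N a t \<gamma> *\<^sub>R y)"
    "curve_length N a b \<gamma> > 0 \<Longrightarrow> N y = 1" "curve_length N a b \<gamma> = \<Phi> \<theta>"
    "emb (\<Phi> \<theta> *\<^sub>R y) = w ** imag_diag \<theta> ** adj w"
proof -
  note nrm = connecting_curve_normalize[OF c]
  define \<eta> where "\<eta> t = matrix_inv u ** \<gamma> t" for t
  have \<eta>: "abs_continuous a b \<eta>" "a \<le> b" "\<eta> ` {a..b} \<subseteq> G" "\<eta> a = mat 1" "\<eta> b = matrix_inv u ** v"
    using nrm(2) by (simp_all add: \<eta>_def[abs_def] connecting_curve_def)
  have w: "w \<in> unitary_group" and e: "emb (matrix_inv u ** v) = w ** cis_diag \<theta> ** adj w" using ang by (auto simp: angles_def)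
  have "v \<in> G" using c unfolding connecting_curve_def by auto
  then have "matrix_inv u ** v \<in> G" by (intro G_mult G_inv nrm(1))
  from log_exists[OF this w \<theta> e] obtain x where x: "x \<in> L" "emb x = w ** imag_diag \<theta> ** adj w" by blast
  have "emb (matrix_inv u ** v) = emb (matrix_exp x)"
    by (simp add: e emb_exp[OF x(1)] x(2) matrix_exp_imag_diag[OF w])
  then have "matrix_inv u ** v = matrix_exp x" by (rule emb_inj)
  then have v: "v = u ** matrix_exp x" by (metis matrix_mul_assoc inv(2)[OF nrm(1)] matrix_mul_lid)
  have Nx: "N x = \<Phi> \<theta>" by (rule N_imag_diag[OF w x(2)])
  have len\<Phi>: "curve_length N a b \<gamma> = \<Phi> \<theta>"
    using len dist_exp(1)[OF nrm(1) x(1) w x(2) less_imp_le[OF \<theta>]] by (simp add: v Nx)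
  have \<gamma>\<eta>: "\<gamma> t = u ** \<eta> t" for t by (simp add: \<eta>_def matrix_mul_assoc inv(2)[OF nrm(1)])
  show thesis
  proof (cases "\<theta> = 0")
    \<comment> \<open>Length 0: the curve is constant, and \<open>y = 0\<close> is a
      placeholder.\<close>
    case True
    then have z: "curve_length N a b \<gamma> = 0" using len\<Phi> Phi_eq_0 by simp
    have ac: "abs_continuous a b \<gamma>" "\<gamma> a = u" using c by (auto simp: connecting_curve_def)
    have "\<gamma> t = u ** matrix_exp (curve_length N a t \<gamma> *\<^sub>R 0)" if "t \<in> {a..b}" for t
      using zero_length_constant[OF ac(1) z, of t] that ac(2) exp_curve_0[OF nrm(1) L_0] by simp
    moreover have "w ** imag_diag (0 :: real^'n) ** adj w = 0" by (simp add: imag_diag_def vec_eq_iff mult_dg_mult_nth)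
    ultimately show thesis using that[of 0] L_0 z len\<Phi> True linear_0[OF linear_emb] by simp
  next
    case False
    have pos: "\<Phi> \<theta> > 0" by (rule Phi_pos[OF False])
    have t: "\<gamma> t = u ** matrix_exp (curve_length N a t \<gamma> *\<^sub>R ((1 / \<Phi> \<theta>) *\<^sub>R x))" if "t \<in> {a..b}" for t
    proof -
      have "curve_length N a t \<eta> = curve_length N a t \<gamma>"
        unfolding \<eta>_def using c that
        by (intro curve_length_translate G_inv nrm(1)) (auto simp: connecting_curve_def intro: abs_continuous_subinterval)
      moreover have "\<eta> t = matrix_exp ((curve_length N a t \<eta> / \<Phi> \<theta>) *\<^sub>R x)"
        by (rule shortest_from_1[OF strict \<eta>(1-4) _ \<theta> False x])
          (use ang len\<Phi> nrm(3) that \<eta>(5) in \<open>simp_all add: \<eta>_def[abs_def]\<close>)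
      ultimately show ?thesis using \<gamma>\<eta>[of t] by simp
    qed
    show thesis
    proof (rule that[of "(1 / \<Phi> \<theta>) *\<^sub>R x"])
      show "(1 / \<Phi> \<theta>) *\<^sub>R x \<in> L" by (rule L_scaleR[OF x(1)])
      show "N ((1 / \<Phi> \<theta>) *\<^sub>R x) = 1" using pos by (simp add: N_scaleR Nx)
      show "emb (\<Phi> \<theta> *\<^sub>R ((1 / \<Phi> \<theta>) *\<^sub>R x)) = w ** imag_diag \<theta> ** adj w" using pos x(2) by simp
    qed (use t len\<Phi> in auto)
  qed
qed

end

section \<open>Uniqueness of shortest curves and the form of geodesics\<close>

lemma continuous_mono_image_interval:
  fixes \<phi> :: "real \<Rightarrow> real"
  assumes "a \<le> b" "continuous_on {a..b} \<phi>" "mono_on {a..b} \<phi>"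
  shows "\<phi> ` {a..b} = {\<phi> a..\<phi> b}"
proof
  show "\<phi> ` {a..b} \<subseteq> {\<phi> a..\<phi> b}" using assms(1) mono_onD[OF assms(3), of a] mono_onD[OF assms(3), of _ b] by auto
  show "{\<phi> a..\<phi> b} \<subseteq> \<phi> ` {a..b}" using IVT'[OF _ _ assms(1,2)] by fastforce
qed

context invariant_norm_group
begin

lemma curve_length_mono: "abs_continuous a b \<gamma> \<Longrightarrow> mono_on {a..b} (\<lambda>t. curve_length N a t \<gamma>)"
proof (rule mono_onI)
  fix s t assume ac: "abs_continuous a b \<gamma>" and st: "s \<in> {a..b}" "t \<in> {a..b}" "s \<le> t"
  have "curve_length N a s \<gamma> + curve_length N s t \<gamma> = curve_length N a t \<gamma>"
    using st by (intro curve_length_combine abs_continuous_subinterval[OF ac]) auto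
  moreover have "0 \<le> curve_length N s t \<gamma>"
    using st by (intro curve_length_nonneg abs_continuous_subinterval[OF ac]) auto
  ultimately show "curve_length N a s \<gamma> \<le> curve_length N a t \<gamma>" by simp
qed

lemma curve_length_continuous: "abs_continuous a b \<gamma> \<Longrightarrow> a \<le> b \<Longrightarrow> continuous_on {a..b} (\<lambda>t. curve_length N a t \<gamma>)"
  unfolding curve_length_def by (intro indefinite_integral_continuous_1 N_speed_integrable)

theorem shortest_curve_exists:
  assumes "u \<in> G" "v \<in> G" and ang: "angles (emb (matrix_inv u ** v)) w \<theta>" and \<theta>: "\<And>i. \<bar>\<theta> $ i\<bar> < pi"
  shows "\<exists>a b \<gamma>. shortest_curve G N u v a b \<gamma>"
proof -
  have w: "w \<in> unitary_group" and e: "emb (matrix_inv u ** v) = w ** cis_diag \<theta> ** adj w" using ang by (auto simp: angles_def)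
  have "matrix_inv u ** v \<in> G" by (intro G_mult G_inv assms)
  from log_exists[OF this w \<theta> e] obtain x where x: "x \<in> L" "emb x = w ** imag_diag \<theta> ** adj w" by blast
  have "emb (matrix_inv u ** v) = emb (matrix_exp x)"
    by (simp add: e emb_exp[OF x(1)] x(2) matrix_exp_imag_diag[OF w])
  then have "matrix_inv u ** v = matrix_exp x" by (rule emb_inj)
  then have v: "v = u ** matrix_exp x" by (metis matrix_mul_assoc inv(2)[OF assms(1)] matrix_mul_lid)
  note d = dist_exp[OF assms(1) x(1) w x(2) less_imp_le[OF \<theta>]]
  have "shortest_curve G N u v 0 1 (\<lambda>t. u ** matrix_exp (t *\<^sub>R x))"
    unfolding shortest_curve_def using d exp_curve_length[OF assms(1) x(1), of 0 1] by (simp add: v)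
  then show ?thesis by blast
qed

theorem shortest_curve_unique:
  assumes strict: "strictly_convex_norm \<Phi>"
    and ang: "angles (emb (matrix_inv u ** v)) w \<theta>" and \<theta>: "\<And>i. \<bar>\<theta> $ i\<bar> < pi"
    and \<gamma>: "shortest_curve G N u v a b \<gamma>" and \<eta>: "shortest_curve G N u v c d \<eta>"
  shows "same_up_to_parameter a b \<gamma> c d \<eta>"
proof -
  have c: "connecting_curve G u v a b \<gamma>" "curve_length N a b \<gamma> = intrinsic_dist G N u v"
      "connecting_curve G u v c d \<eta>" "curve_length N c d \<eta> = intrinsic_dist G N u v"
    using \<gamma> \<eta> by (auto simp: shortest_curve_def)
  obtain y where y: "y \<in> L" "\<And>t. t \<in> {a..b} \<Longrightarrow> \<gamma> t = u ** matrix_exp (curve_length N a t \<gamma> *\<^sub>R y)"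
    "curve_length N a b \<gamma> = \<Phi> \<theta>" "emb (\<Phi> \<theta> *\<^sub>R y) = w ** imag_diag \<theta> ** adj w"
    by (rule shortest_form[OF strict c(1,2) ang \<theta>]) blast
  obtain z where z: "z \<in> L" "\<And>t. t \<in> {c..d} \<Longrightarrow> \<eta> t = u ** matrix_exp (curve_length N c t \<eta> *\<^sub>R z)"
    "curve_length N c d \<eta> = \<Phi> \<theta>" "emb (\<Phi> \<theta> *\<^sub>R z) = w ** imag_diag \<theta> ** adj w"
    by (rule shortest_form[OF strict c(3,4) ang \<theta>]) blast
  have u: "u \<in> G" using connecting_curve_normalize(1)[OF c(1)] .
  have ac: "abs_continuous a b \<gamma>" "a \<le> b" "abs_continuous c d \<eta>" "c \<le> d" using c by (auto simp: connecting_curve_def)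
  have im: "(\<lambda>t. curve_length N a t \<gamma>) ` {a..b} = {0..\<Phi> \<theta>}" "(\<lambda>t. curve_length N c t \<eta>) ` {c..d} = {0..\<Phi> \<theta>}"
    using continuous_mono_image_interval[OF ac(2) curve_length_continuous[OF ac(1,2)] curve_length_mono[OF ac(1)]]
      continuous_mono_image_interval[OF ac(4) curve_length_continuous[OF ac(3,4)] curve_length_mono[OF ac(3)]]
    by (simp_all add: y(3) z(3)) (simp_all add: curve_length_def)
  \<comment> \<open>For curves of length 0 the vectors \<open>y\<close> and \<open>z\<close> are not
    tied to each other, but then only \<open>r = 0\<close> occurs.\<close>
  have yz: "u ** matrix_exp (r *\<^sub>R z) = u ** matrix_exp (r *\<^sub>R y)" if r: "r \<in> {0..\<Phi> \<theta>}" for r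
  proof (cases "\<Phi> \<theta> = 0")
    case True
    then have "r = 0" using r by simp
    then show ?thesis using exp_curve_0[OF u y(1)] exp_curve_0[OF u z(1)] by simp
  next
    case False
    have "\<Phi> \<theta> *\<^sub>R y = \<Phi> \<theta> *\<^sub>R z" by (rule emb_inj) (simp only: y(4) z(4))
    with False have "y = z" by simp
    then show ?thesis by simp
  qed
  show ?thesis
    unfolding same_up_to_parameter_def
  \<comment> \<open>Arc length serves as \<phi> and as \<psi>; the common curve \<sigma> is
    \<open>u ** matrix_exp (r *\<^sub>R y)\<close> on \<open>{0..\<Phi> \<theta>}\<close>.\<close>
  proof (intro exI conjI ballI)
    show "\<gamma> t = (\<lambda>r. u ** matrix_exp (r *\<^sub>R y)) (curve_length N a t \<gamma>)" if "t \<in> {a..b}" for t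
      using y(2)[OF that] .
    show "\<eta> t = (\<lambda>r. u ** matrix_exp (r *\<^sub>R y)) (curve_length N c t \<eta>)" if "t \<in> {c..d}" for t
    proof -
      have "curve_length N c t \<eta> \<in> {0..\<Phi> \<theta>}" using im(2) that by blast
      from yz[OF this] z(2)[OF that] show ?thesis by simp
    qed
    show "continuous_on {a..b} (\<lambda>t. curve_length N a t \<gamma>)" by (rule curve_length_continuous[OF ac(1,2)])
    show "continuous_on {c..d} (\<lambda>t. curve_length N c t \<eta>)" by (rule curve_length_continuous[OF ac(3,4)])
    show "mono_on {a..b} (\<lambda>t. curve_length N a t \<gamma>)" by (rule curve_length_mono[OF ac(1)])
    show "mono_on {c..d} (\<lambda>t. curve_length N c t \<eta>)" by (rule curve_length_mono[OF ac(3)])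
  qed (rule im)+
qed

text \<open>An eigenvalue -1 of \<open>matrix_inv (\<gamma> a) ** \<gamma> b\<close> would put the
  endpoints at Frobenius distance at least 2, and \<open>K\<close> compares the two norms. By
  invariance one radius serves the whole group.\<close>

lemma close_points_angles:
  obtains \<epsilon> where "\<epsilon> > 0" "\<And>a b \<gamma>. abs_continuous a b \<gamma> \<Longrightarrow> a \<le> b \<Longrightarrow> \<gamma> ` {a..b} \<subseteq> G \<Longrightarrow>
    curve_length N a b \<gamma> < \<epsilon> \<Longrightarrow> \<exists>w \<theta>. angles (emb (matrix_inv (\<gamma> a) ** \<gamma> b)) w \<theta> \<and> (\<forall>i. \<bar>\<theta> $ i\<bar> < pi)"
proof -
  obtain K where K: "K > 0" "\<And>x. norm x \<le> K * N x" by (rule N_lower_bound) blast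
  show thesis
  proof (rule that[of "2 / K"])
    show "0 < 2 / K" using K(1) by simp
    fix a b :: real and \<gamma> :: "real \<Rightarrow> 'a^'n^'n"
    assume ac: "abs_continuous a b \<gamma>" and ab: "a \<le> b" and \<gamma>: "\<gamma> ` {a..b} \<subseteq> G" and len: "curve_length N a b \<gamma> < 2 / K"
    define v where "v t = vector_derivative \<gamma> (at t)" for t
    note ftc = abs_continuous_fundamental_theorem[OF ac ab, folded v_def]
    have "norm (\<gamma> b - \<gamma> a) = norm (integral {a..b} v)" using ftc(3)[of a b] ab by (simp add: integral_unique)
    also have "\<dots> \<le> integral {a..b} (\<lambda>t. K * N (v t))"
      by (rule integral_norm_bound_integral[OF set_lebesgue_integral_eq_integral(1)[OF ftc(2)]
          integrable_on_real_mult[OF N_speed_integrable(2)[OF ac ab, folded v_def]] K(2)])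
    also have "\<dots> = K * curve_length N a b \<gamma>" by (simp add: curve_length_def v_def)
    also have "\<dots> < 2" using len K(1) by (simp add: field_simps)
    finally have close: "norm (\<gamma> b - \<gamma> a) < 2" .
    have g: "\<gamma> a \<in> G" "\<gamma> b \<in> G" using \<gamma> ab by auto
    define h where "h = matrix_inv (\<gamma> a) ** \<gamma> b"
    have h: "h \<in> G" unfolding h_def by (intro G_mult G_inv g)
    obtain w \<theta> where ang: "angles (emb h) w \<theta>" using angles_exist[OF G_unitary[OF h]] by blast
    then have w: "w \<in> unitary_group" and eh: "emb h = w ** cis_diag \<theta> ** adj w" by (auto simp: angles_def)
    have "\<bar>\<theta> $ i\<bar> < pi" for i
    proof (rule ccontr)
      assume "\<not> \<bar>\<theta> $ i\<bar> < pi"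
      with ang have "\<bar>\<theta> $ i\<bar> = pi" by (auto simp: angles_def intro: antisym)
      then have "\<theta> $ i = pi \<or> \<theta> $ i = - pi" by linarith
      then have "cis (\<theta> $ i) = -1" by (auto simp: complex_eq_iff)
      then have "2 = norm ((cis_diag \<theta> - mat 1) $ i $ i)" by (simp add: cis_diag_def mat_def)
      also have "\<dots> \<le> norm (cis_diag \<theta> - mat 1)"
        by (rule order.trans[OF Finite_Cartesian_Product.norm_nth_le Finite_Cartesian_Product.norm_nth_le])
      also have "\<dots> = norm (w ** (cis_diag \<theta> - mat 1) ** adj w)"
        by (simp add: norm_mult_unitary[OF unitary_adj[OF w]] norm_unitary_mult[OF w])
      also have "w ** (cis_diag \<theta> - mat 1) ** adj w = emb h - mat 1"
        by (simp add: eh bounded_bilinear.diff_left[OF bounded_bilinear_matrix_mult] bounded_bilinear.diff_right[OF bounded_bilinear_matrix_mult]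
            unitary_mult_adj[OF w])
      also have "norm (emb h - mat 1) = norm (emb (\<gamma> a) ** (emb h - mat 1))"
        by (simp add: norm_unitary_mult[OF G_unitary[OF g(1)]])
      also have "emb (\<gamma> a) ** (emb h - mat 1) = emb (\<gamma> b - \<gamma> a)"
      proof -
        have "emb (\<gamma> a) ** emb h = emb (\<gamma> b)"
          unfolding emb_mult[symmetric] h_def by (simp add: matrix_mul_assoc inv(2)[OF g(1)])
        then show ?thesis by (simp add: bounded_bilinear.diff_right[OF bounded_bilinear_matrix_mult] linear_diff[OF linear_emb])
      qed
      also have "norm \<dots> < 2" using close by (simp add: norm_emb)
      finally show False by simp
    qed
    with ang show "\<exists>w \<theta>. angles (emb (matrix_inv (\<gamma> a) ** \<gamma> b)) w \<theta> \<and> (\<forall>i. \<bar>\<theta> $ i\<bar> < pi)"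
      unfolding h_def by blast
  qed
qed

text \<open>At an interior point the derivatives agree as well; since \<open>x\<close> commutes with
  its exponentials, they read \<open>g ** x\<close> and \<open>g ** y\<close> for the common value
  \<open>g\<close>.\<close>

lemma exp_curve_eq_imp_eq:
  assumes u: "u \<in> G" "x \<in> L" and v: "v \<in> G" "y \<in> L" and ab: "a < b"
    and eq: "\<And>r. a < r \<Longrightarrow> r < b \<Longrightarrow> u ** matrix_exp (r *\<^sub>R x) = v ** matrix_exp (r *\<^sub>R y)"
  shows "u = v \<and> x = y"
proof -
  define r where "r = (a + b) / 2"
  have r: "a < r" "r < b" using ab by (auto simp: r_def)
  define g where "g = u ** matrix_exp (r *\<^sub>R x)"
  have g: "g = v ** matrix_exp (r *\<^sub>R y)" unfolding g_def by (rule eq[OF r])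
  have gG: "g \<in> G" unfolding g_def by (rule exp_curve_in_G[OF u])
  have "((\<lambda>t. u ** matrix_exp (t *\<^sub>R x)) has_vector_derivative (v ** (y ** matrix_exp (r *\<^sub>R y)))) (at r)"
    by (rule has_vector_derivative_transform_within_open[OF exp_curve_has_vector_derivative[OF v], of "{a<..<b}"])
      (use r eq in auto)
  from vector_derivative_unique_at[OF exp_curve_has_vector_derivative[OF u] this]
  have d: "u ** (x ** matrix_exp (r *\<^sub>R x)) = v ** (y ** matrix_exp (r *\<^sub>R y))" .
  have comm: "z ** matrix_exp (r *\<^sub>R z) = matrix_exp (r *\<^sub>R z) ** z" if z: "z \<in> L" for z
  proof (rule emb_inj)
    obtain w \<theta> where w: "w \<in> unitary_group" "emb z = w ** imag_diag \<theta> ** adj w"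
      "\<And>t. emb (matrix_exp (t *\<^sub>R z)) = w ** cis_diag (t *\<^sub>R \<theta>) ** adj w"
      using lie_algebra_spectral[OF z] by metis
    have "imag_diag \<theta> ** (cis_diag (r *\<^sub>R \<theta>) ** adj w) = cis_diag (r *\<^sub>R \<theta>) ** (imag_diag \<theta> ** adj w)"
      by (simp add: matrix_mul_assoc imag_diag_def cis_diag_def dg_mult_dg mult.commute)
    then show "emb (z ** matrix_exp (r *\<^sub>R z)) = emb (matrix_exp (r *\<^sub>R z) ** z)"
      by (simp add: emb_mult w(2,3) matrix_mul_assoc[symmetric] unitary_cancel[OF w(1)])
  qed
  have "g ** x = g ** y"
    using d unfolding comm[OF u(2)] comm[OF v(2)] by (simp add: matrix_mul_assoc g_def[symmetric] g[symmetric])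
  then have "matrix_inv g ** (g ** x) = matrix_inv g ** (g ** y)" by simp
  then have "x = y" by (simp add: matrix_mul_assoc inv(1)[OF gG])
  have E: "matrix_exp (r *\<^sub>R y) \<in> G" by (intro exp_in_G L_scaleR v)
  have "u ** matrix_exp (r *\<^sub>R y) ** matrix_inv (matrix_exp (r *\<^sub>R y)) = v ** matrix_exp (r *\<^sub>R y) ** matrix_inv (matrix_exp (r *\<^sub>R y))"
    using g \<open>x = y\<close> by (simp add: g_def)
  then have "u = v" by (simp add: matrix_mul_assoc[symmetric] inv(2)[OF E])
  with \<open>x = y\<close> show ?thesis by simp
qed

text \<open>Everything is expressed by the signed arc length \<open>s\<close>. Near each value of
  \<open>s\<close> the curve is \<open>u ** matrix_exp (s t *\<^sub>R x)\<close>, and the pair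
  \<open>(u, x)\<close> is unique; hence it is a locally constant function on the connected set of
  values of \<open>s\<close>.\<close>

theorem geodesic_form:
  assumes strict: "strictly_convex_norm \<Phi>" and geo: "geodesic G N I \<gamma>"
  shows "\<exists>u\<in>G. \<exists>x\<in>L. \<exists>\<phi>. continuous_on I \<phi> \<and> mono_on I \<phi> \<and> (\<forall>t\<in>I. \<gamma> t = u ** matrix_exp (\<phi> t *\<^sub>R x))"
proof (cases "I = {}")
  case True
  then show ?thesis using G_1 L_0 by (intro bexI[of _ "mat 1"] bexI[of _ 0]) (auto simp: mono_on_def)
next
  case False
  then obtain t0 where t0: "t0 \<in> I" by blast
  have I: "is_interval I" and \<gamma>I: "\<gamma> ` I \<subseteq> G" and ac: "\<And>a b. a \<in> I \<Longrightarrow> b \<in> I \<Longrightarrow> a \<le> b \<Longrightarrow> abs_continuous a b \<gamma>"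
    using geo by (auto simp: geodesic_def)
  have local_shortest: "\<exists>\<epsilon>>0. \<forall>a\<in>I. \<forall>b\<in>I. a \<le> t \<and> t \<le> b \<and> curve_length N a b \<gamma> < \<epsilon> \<longrightarrow>
      curve_length N a b \<gamma> = intrinsic_dist G N (\<gamma> a) (\<gamma> b)" if "t \<in> I" for t
    using geo that by (simp add: geodesic_def)
  have Icc: "{a..b} \<subseteq> I" if "a \<in> I" "b \<in> I" for a b
    using mem_is_interval_1_I[OF I that] by auto
  define s where "s t = (if t0 \<le> t then curve_length N t0 t \<gamma> else - curve_length N t t0 \<gamma>)" for t
  have s: "s b - s a = curve_length N a b \<gamma>" if "a \<in> I" "b \<in> I" "a \<le> b" for a b
  proof -
    consider "t0 \<le> a" | "a < t0" "t0 \<le> b" | "b < t0" using that(3) by linarith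
    then show ?thesis
    proof cases
      case 1
      then have "curve_length N t0 a \<gamma> + curve_length N a b \<gamma> = curve_length N t0 b \<gamma>"
        using that t0 by (intro curve_length_combine ac) auto
      then show ?thesis using 1 that by (simp add: s_def)
    next
      case 2
      then have "curve_length N a t0 \<gamma> + curve_length N t0 b \<gamma> = curve_length N a b \<gamma>"
        using that by (intro curve_length_combine ac) auto
      then show ?thesis using 2 by (simp add: s_def)
    next
      case 3
      then have "curve_length N a b \<gamma> + curve_length N b t0 \<gamma> = curve_length N a t0 \<gamma>"
        using that t0 by (intro curve_length_combine ac) auto
      then show ?thesis using 3 that by (simp add: s_def)
    qed
  qed
  have s_mono: "s a \<le> s b" if "a \<in> I" "b \<in> I" "a \<le> b" for a b
    using s[OF that] curve_length_nonneg[OF ac[OF that]] by simp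
  have s_cont_Icc: "continuous_on {a..b} s" if ab: "a \<in> I" "b \<in> I" "a \<le> b" for a b
  proof (rule continuous_on_eq)
    show "continuous_on {a..b} (\<lambda>t. s a + curve_length N a t \<gamma>)"
      by (intro continuous_intros curve_length_continuous ac ab)
    show "s a + curve_length N a t \<gamma> = s t" if "t \<in> {a..b}" for t
      using s[of a t] that ab Icc[of a b] by auto
  qed
  have s_const: "\<gamma> a = \<gamma> b" if ab: "a \<in> I" "b \<in> I" "s a = s b" for a b
  proof -
    have *: "\<gamma> b = \<gamma> a" if "a \<in> I" "b \<in> I" "s a = s b" "a \<le> b" for a b
    proof -
      have "curve_length N a b \<gamma> = 0" using s[OF that(1,2,4)] that(3) by linarith
      from zero_length_constant[OF ac[OF that(1,2,4)] this that(4) order_refl] show ?thesis .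
    qed
    show ?thesis
    proof (cases "a \<le> b")
      case True
      show ?thesis by (rule *[OF ab True, symmetric])
    next
      case False
      then have "b \<le> a" by simp
      show ?thesis by (rule *[OF ab(2,1) ab(3)[symmetric] \<open>b \<le> a\<close>])
    qed
  qed
  \<comment> \<open>\<open>I\<close> may be open, half-open or unbounded; near \<open>t\<close> it
    is replaced by a compact interval that extends beyond \<open>t\<close> on each side on which
    \<open>I\<close> does.\<close>
  have s_cont: "continuous_on I s"
    unfolding continuous_on_eq_continuous_within
  proof
    fix t assume t: "t \<in> I"
    obtain c where c: "c \<in> I" "c \<le> t" "c = t \<Longrightarrow> \<forall>x\<in>I. t \<le> x"
      using t that[of t] that[of c for c] by (cases "\<exists>c\<in>I. c < t") (auto simp: not_less)
    obtain d where d: "d \<in> I" "t \<le> d" "d = t \<Longrightarrow> \<forall>x\<in>I. x \<le> t"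
      using t that[of t] that[of d for d] by (cases "\<exists>d\<in>I. t < d") (auto simp: not_less)
    define U where "U = (if c = t then UNIV else {c<..}) \<inter> (if d = t then UNIV else {..<d})"
    have U: "open U" "t \<in> U" using c d by (auto simp: U_def)
    have "I \<inter> U \<subseteq> {c..d}" using c d by (auto simp: U_def intro: antisym split: if_splits)
    then have "I \<inter> U - {t} = {c..d} \<inter> U - {t}" using Icc[OF c(1) d(1)] by auto
    then have "at t within I = at t within {c..d}" by (rule at_within_nhd[OF U(2,1)])
    moreover have "continuous (at t within {c..d}) s"
      using s_cont_Icc[of c d] c d by (auto simp: continuous_on_eq_continuous_within)
    ultimately show "continuous (at t within I) s" by simp
  qed
  define S where "S = s ` I"
  have "connected S" unfolding S_def using s_cont I is_interval_connected connected_continuous_image by blast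
  then have S: "r \<in> S" if "p \<in> S" "q \<in> S" "p \<le> r" "r \<le> q" for p q r
    using that unfolding connected_iff_interval by blast
  show ?thesis
  proof (cases "\<forall>t\<in>I. s t = s t0")
    case True
    then have "\<gamma> t = \<gamma> t0" if "t \<in> I" for t using s_const[of t t0] that t0 by blast
    moreover have "\<gamma> t0 \<in> G" using \<gamma>I t0 by auto
    ultimately have "\<gamma> t = \<gamma> t0 ** matrix_exp ((\<lambda>_. 0) t *\<^sub>R 0)" if "t \<in> I" for t
      using that exp_curve_0[OF _ L_0, of "\<gamma> t0"] by simp
    with \<open>\<gamma> t0 \<in> G\<close> L_0 show ?thesis
      by (intro bexI[of _ "\<gamma> t0"] bexI[of _ 0] exI[of _ "\<lambda>_. 0"]) (auto simp: mono_on_def)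
  next
    case False
    then obtain p where p: "p \<in> S" "p \<noteq> s t0" by (auto simp: S_def)
    \<comment> \<open>Germs are taken at values \<open>r\<close> of the arc length: during a pause
      of the curve many parameters share one value.\<close>
    define Q where "Q u x r \<longleftrightarrow> u \<in> G \<and> x \<in> L \<and> (\<exists>\<delta>>0. \<forall>t\<in>I. \<bar>s t - r\<bar> < \<delta> \<longrightarrow> \<gamma> t = u ** matrix_exp (s t *\<^sub>R x))" for u x r
    have Q_ex: "\<exists>u x. Q u x r" if "r \<in> S" for r
    proof -
      obtain t where t: "t \<in> I" "s t = r" using \<open>r \<in> S\<close> by (auto simp: S_def)
      obtain \<epsilon>1 where \<epsilon>1: "\<epsilon>1 > 0" "\<forall>a\<in>I. \<forall>b\<in>I. a \<le> t \<and> t \<le> b \<and> curve_length N a b \<gamma> < \<epsilon>1 \<longrightarrow>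
          curve_length N a b \<gamma> = intrinsic_dist G N (\<gamma> a) (\<gamma> b)"
        using local_shortest[OF t(1)] by (elim exE conjE) (rule that)
      obtain \<epsilon>2 where \<epsilon>2: "\<epsilon>2 > 0" "\<And>a b \<gamma>. abs_continuous a b \<gamma> \<Longrightarrow> a \<le> b \<Longrightarrow> \<gamma> ` {a..b} \<subseteq> G \<Longrightarrow>
        curve_length N a b \<gamma> < \<epsilon>2 \<Longrightarrow> \<exists>w \<theta>. angles (emb (matrix_inv (\<gamma> a) ** \<gamma> b)) w \<theta> \<and> (\<forall>i. \<bar>\<theta> $ i\<bar> < pi)"
        by (rule close_points_angles) (rule that)
      \<comment> \<open>The arc chosen below has length at most \<open>2 * \<epsilon>\<close>, which
        a third of the smaller radius keeps below both radii.\<close>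
      define \<epsilon> where "\<epsilon> = min \<epsilon>1 \<epsilon>2 / 3"
      have \<epsilon>: "\<epsilon> > 0" "2 * \<epsilon> < \<epsilon>1" "2 * \<epsilon> < \<epsilon>2" using \<epsilon>1(1) \<epsilon>2(1) by (auto simp: \<epsilon>_def min_def)
      \<comment> \<open>To the left of \<open>t\<close> the arc length either takes values below
        \<open>r\<close> or stays equal to \<open>r\<close>; the last clause records the second
        case. The point \<open>b\<close> does the same on the right.\<close>
      obtain a where a: "a \<in> I" "a \<le> t" "r - \<epsilon> \<le> s a" "s a = r \<Longrightarrow> \<forall>t'\<in>I. t' \<le> t \<longrightarrow> s t' = r"
      proof (cases "\<exists>t'\<in>I. t' \<le> t \<and> s t' \<noteq> r")
        case True
        then obtain t' where t': "t' \<in> I" "t' \<le> t" "s t' \<noteq> r" by blast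
        then have "s t' < r" using s_mono[of t' t] t by simp
        then have "s t' \<le> max (s t') (r - \<epsilon>)" "max (s t') (r - \<epsilon>) \<le> s t" using t \<epsilon>(1) by auto
        from IVT'[OF this t'(2) s_cont_Icc[OF t'(1) t(1) t'(2)]] obtain a where
          a: "t' \<le> a" "a \<le> t" "s a = max (s t') (r - \<epsilon>)" by blast
        then have "a \<in> I" using Icc[OF t'(1) t(1)] by auto
        moreover have "r - \<epsilon> \<le> s a" "s a \<noteq> r" using a(3) \<open>s t' < r\<close> \<epsilon>(1) by linarith+
        ultimately show ?thesis by (intro that[OF _ a(2)]) blast+
      next
        case False
        then show ?thesis using t \<epsilon>(1) by (intro that[of t]) auto
      qed
      obtain b where b: "b \<in> I" "t \<le> b" "s b \<le> r + \<epsilon>" "s b = r \<Longrightarrow> \<forall>t'\<in>I. t \<le> t' \<longrightarrow> s t' = r"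
      proof (cases "\<exists>t'\<in>I. t \<le> t' \<and> s t' \<noteq> r")
        case True
        then obtain t' where t': "t' \<in> I" "t \<le> t'" "s t' \<noteq> r" by blast
        then have "r < s t'" using s_mono[of t t'] t by simp
        then have "s t \<le> min (s t') (r + \<epsilon>)" "min (s t') (r + \<epsilon>) \<le> s t'" using t \<epsilon>(1) by auto
        from IVT'[OF this t'(2) s_cont_Icc[OF t(1) t'(1) t'(2)]] obtain b where
          b: "t \<le> b" "b \<le> t'" "s b = min (s t') (r + \<epsilon>)" by blast
        then have "b \<in> I" using Icc[OF t(1) t'(1)] by auto
        moreover have "s b \<le> r + \<epsilon>" "s b \<noteq> r" using b(3) \<open>r < s t'\<close> \<epsilon>(1) by linarith+
        ultimately show ?thesis by (intro that[OF _ b(1)]) blast+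
      next
        case False
        then show ?thesis using t \<epsilon>(1) by (intro that[of t]) auto
      qed
      have ab: "a \<le> b" using a(2) b(2) by (rule order.trans)
      have len: "curve_length N a b \<gamma> < \<epsilon>1" "curve_length N a b \<gamma> < \<epsilon>2"
        using s[OF a(1) b(1) ab] a(3) b(3) \<epsilon> by linarith+
      have sub: "\<gamma> ` {a..b} \<subseteq> G" using \<gamma>I Icc[OF a(1) b(1)] by blast
      obtain w \<theta> where w: "angles (emb (matrix_inv (\<gamma> a) ** \<gamma> b)) w \<theta>" "\<And>i. \<bar>\<theta> $ i\<bar> < pi"
        using \<epsilon>2(2)[OF ac[OF a(1) b(1) ab] ab sub len(2)] by blast
      have conn: "connecting_curve G (\<gamma> a) (\<gamma> b) a b \<gamma>"
        unfolding connecting_curve_def using ac[OF a(1) b(1) ab] ab sub by simp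
      have short: "curve_length N a b \<gamma> = intrinsic_dist G N (\<gamma> a) (\<gamma> b)"
        using \<epsilon>1(2)[rule_format, OF a(1) b(1)] a(2) b(2) len(1) by blast
      obtain y where y: "y \<in> L" "\<And>t. t \<in> {a..b} \<Longrightarrow> \<gamma> t = \<gamma> a ** matrix_exp (curve_length N a t \<gamma> *\<^sub>R y)"
        by (rule shortest_form[OF strict conn short w]) (rule that)
      define u where "u = \<gamma> a ** matrix_exp (- s a *\<^sub>R y)"
      have ga: "\<gamma> a \<in> G" using \<gamma>I a(1) by auto
      have form: "\<gamma> t' = u ** matrix_exp (s t' *\<^sub>R y)" if t': "t' \<in> {a..b}" for t'
      proof -
        have "t' \<in> I" using t' Icc[OF a(1) b(1)] by blast
        then have "curve_length N a t' \<gamma> = s t' - s a" using s[OF a(1)] t' by simp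
        then show ?thesis
          using y(2)[OF t'] exp_curve_shift[OF ga y(1), of "s t' - s a" "- s a"] by (simp add: u_def)
      qed
      \<comment> \<open>On a side where the values of \<open>s\<close> end at \<open>r\<close> there
        is no constraint, and 1 is a placeholder.\<close>
      define \<delta> where "\<delta> = min (if s a = r then 1 else r - s a) (if s b = r then 1 else s b - r)"
      have "s a \<le> r" "r \<le> s b" using s_mono[OF a(1) t(1) a(2)] s_mono[OF t(1) b(1) b(2)] t(2) by simp_all
      then have "\<delta> > 0" by (auto simp: \<delta>_def)
      have "\<gamma> t' = u ** matrix_exp (s t' *\<^sub>R y)" if t': "t' \<in> I" "\<bar>s t' - r\<bar> < \<delta>" for t'
      proof -
        consider "t' \<in> {a..b}" | "t' < a" | "b < t'" by fastforce
        then have "s t' = r \<or> t' \<in> {a..b}"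
        proof cases
          case 2
          then have "s t' \<le> s a" using s_mono t'(1) a(1) by simp
          then have "s a = r" using t'(2) by (auto simp: \<delta>_def split: if_splits)
          have "t' \<le> t" using 2 a(2) by linarith
          with a(4)[OF \<open>s a = r\<close>] t'(1) show ?thesis by blast
        next
          case 3
          then have "s b \<le> s t'" using s_mono t'(1) b(1) by simp
          then have "s b = r" using t'(2) by (auto simp: \<delta>_def split: if_splits)
          have "t \<le> t'" using 3 b(2) by linarith
          with b(4)[OF \<open>s b = r\<close>] t'(1) show ?thesis by blast
        qed simp
        then show ?thesis
        proof
          assume "s t' = r"
          then have "\<gamma> t' = \<gamma> t" using s_const[OF t'(1) t(1)] t(2) by simp
          moreover have "t \<in> {a..b}" using a(2) b(2) by simp
          ultimately show ?thesis using form[of t] t(2) \<open>s t' = r\<close> by simp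
        qed (rule form)
      qed
      then have "Q u y r"
        unfolding Q_def u_def using \<open>\<delta> > 0\<close> y(1) exp_curve_in_G[OF ga y(1), of "- s a"] by blast
      then show ?thesis by blast
    qed
    have Q_unique: "u = v \<and> x = y" if r: "r \<in> S" and Q: "Q u x r" "Q v y r" for u x v y r
    proof -
      have G: "u \<in> G" "x \<in> L" "v \<in> G" "y \<in> L" using Q by (auto simp: Q_def)
      obtain \<delta>1 where \<delta>1: "\<delta>1 > 0" "\<And>t. t \<in> I \<Longrightarrow> \<bar>s t - r\<bar> < \<delta>1 \<Longrightarrow> \<gamma> t = u ** matrix_exp (s t *\<^sub>R x)"
        using Q(1) unfolding Q_def by blast
      obtain \<delta>2 where \<delta>2: "\<delta>2 > 0" "\<And>t. t \<in> I \<Longrightarrow> \<bar>s t - r\<bar> < \<delta>2 \<Longrightarrow> \<gamma> t = v ** matrix_exp (s t *\<^sub>R y)"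
        using Q(2) unfolding Q_def by blast
      \<comment> \<open>Since \<open>s\<close> is not constant there is a second value
        \<open>p'\<close>, so \<open>S\<close> contains an interval on at least one side of
        \<open>r\<close>; there the two exponential curves coincide.\<close>
      have "s t0 \<in> S" using t0 by (auto simp: S_def)
      then obtain p' where p': "p' \<in> S" "p' \<noteq> r" using p by (cases "p = r") auto
      define \<delta> where "\<delta> = min (min \<delta>1 \<delta>2) \<bar>p' - r\<bar>"
      have \<delta>: "\<delta> > 0" "\<delta> \<le> \<delta>1" "\<delta> \<le> \<delta>2" "\<delta> \<le> \<bar>p' - r\<bar>" using \<delta>1(1) \<delta>2(1) p'(2) by (auto simp: \<delta>_def)
      define l h where "l = (if r < p' then r else r - \<delta>)" and "h = (if r < p' then r + \<delta> else r)"
      have "l < h" using \<delta>(1) by (auto simp: l_def h_def)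
      have "u ** matrix_exp (q *\<^sub>R x) = v ** matrix_exp (q *\<^sub>R y)" if q: "l < q" "q < h" for q
      proof -
        have "\<bar>q - r\<bar> < \<delta>" using q by (auto simp: l_def h_def split: if_splits)
        moreover have "q \<in> S"
          using S[OF r p'(1), of q] S[OF p'(1) r, of q] q \<delta>(4) by (auto simp: l_def h_def split: if_splits)
        then obtain t where "t \<in> I" "s t = q" by (auto simp: S_def)
        ultimately show ?thesis using \<delta>1(2)[of t] \<delta>2(2)[of t] \<delta> by auto
      qed
      from exp_curve_eq_imp_eq[OF G \<open>l < h\<close> this] show ?thesis .
    qed
    define X where "X r = (SOME z. Q (fst z) (snd z) r)" for r
    have X: "Q (fst (X r)) (snd (X r)) r" if "r \<in> S" for r
      unfolding X_def using Q_ex[OF that] by (intro someI_ex[of "\<lambda>z. Q (fst z) (snd z) r"]) auto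
    have "X constant_on S"
    proof (rule locally_constant_imp_constant[OF \<open>connected S\<close>])
      fix r assume r: "r \<in> S"
      obtain \<delta> where \<delta>: "\<delta> > 0" "\<And>t. t \<in> I \<Longrightarrow> \<bar>s t - r\<bar> < \<delta> \<Longrightarrow> \<gamma> t = fst (X r) ** matrix_exp (s t *\<^sub>R snd (X r))"
        using X[OF r] unfolding Q_def by blast
      have "X r' = X r" if r': "r' \<in> S" "\<bar>r' - r\<bar> < \<delta> / 2" for r'
      proof -
        have "Q (fst (X r)) (snd (X r)) r'"
          unfolding Q_def
        proof (intro conjI exI[of _ "\<delta> / 2"] ballI impI)
          fix t assume "t \<in> I" and "\<bar>s t - r'\<bar> < \<delta> / 2"
          with r'(2) have "\<bar>s t - r\<bar> < \<delta>" by arith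
          then show "\<gamma> t = fst (X r) ** matrix_exp (s t *\<^sub>R snd (X r))" by (rule \<delta>(2)[OF \<open>t \<in> I\<close>])
        qed (use X[OF r] \<delta>(1) in \<open>auto simp: Q_def\<close>)
        from Q_unique[OF r'(1) X[OF r'(1)] this] show ?thesis by (simp add: prod_eq_iff)
      qed
      then have "\<forall>x\<in>S \<inter> ball r (\<delta> / 2). X x = X r" by (simp add: dist_real_def abs_minus_commute)
      moreover have "openin (top_of_set S) (S \<inter> ball r (\<delta> / 2))" by (intro openin_open_Int open_ball)
      moreover have "r \<in> S \<inter> ball r (\<delta> / 2)" using r \<delta>(1) by simp
      ultimately show "\<exists>T. openin (top_of_set S) T \<and> r \<in> T \<and> (\<forall>x\<in>T. X x = X r)" by blast
    qed
    then obtain z where z: "\<And>r. r \<in> S \<Longrightarrow> X r = z" by (auto simp: constant_on_def)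
    have Qz: "Q (fst z) (snd z) (s t)" if "t \<in> I" for t
      using X[of "s t"] z[of "s t"] that by (auto simp: S_def)
    show ?thesis
    proof (intro bexI exI conjI ballI)
      show "\<gamma> t = fst z ** matrix_exp (s t *\<^sub>R snd z)" if "t \<in> I" for t
        using Qz[OF that] that unfolding Q_def by force
      show "mono_on I s" using s_mono by (auto intro: mono_onI)
      show "fst z \<in> G" "snd z \<in> L" using Qz[OF t0] by (auto simp: Q_def)
    qed (rule s_cont)
  qed
qed

section \<open>Transfer of strict convexity between the matrix norm and its gauge\<close>

lemma strictly_convex_N_imp_Phi:
  assumes strict: "strictly_convex_norm N"
  shows "strictly_convex_norm \<Phi>"
  unfolding strictly_convex_norm_def
proof clarify
  fix e f :: "real^'n" assume ef: "e \<noteq> f" "closed_segment e f \<subseteq> {z. \<Phi> z = 1}"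
  obtain D where D: "\<And>d. emb (D d) = dg (\<chi> i. complex_of_real (d $ i))" using emb_diag by metis
  have ND: "N (D d) = \<Phi> d" for d
  proof -
    \<comment> \<open>\<open>N_svd\<close> asks for nonnegative entries; the signs of
      \<open>d\<close> go into a unitary factor.\<close>
    define c :: "complex^'n" where "c = (\<chi> i. if d $ i \<ge> 0 then 1 else - 1)"
    have "N (D d) = \<Phi> (\<chi> i. \<bar>d $ i\<bar>)"
    proof (rule N_svd[OF _ unitary_mat_1])
      show "dg c \<in> unitary_group" by (rule unitary_dg) (simp add: c_def)
      show "emb (D d) = dg c ** dg (\<chi> i. complex_of_real ((\<chi> i. \<bar>d $ i\<bar>) $ i)) ** mat 1"
        unfolding D by (simp add: dg_mult_dg vec_eq_iff c_def)
    qed simp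
    then show ?thesis by (simp add: Phi_abs)
  qed
  have lin: "D (u *\<^sub>R d + v *\<^sub>R d') = u *\<^sub>R D d + v *\<^sub>R D d'" for u v d d'
    by (rule emb_inj) (simp add: linear_add[OF linear_emb] linear_scale[OF linear_emb] D vec_eq_iff scaleR_conv_of_real[where 'a = complex])
  have "closed_segment (D e) (D f) \<subseteq> {z. N z = 1}"
  proof
    fix z assume "z \<in> closed_segment (D e) (D f)"
    then obtain u where u: "0 \<le> u" "u \<le> 1" "z = D ((1 - u) *\<^sub>R e + u *\<^sub>R f)" by (auto simp: in_segment lin)
    then have "(1 - u) *\<^sub>R e + u *\<^sub>R f \<in> closed_segment e f" by (auto simp: in_segment)
    with ef(2) show "z \<in> {z. N z = 1}" by (auto simp: u(3) ND)
  qed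
  with strict have "D e = D f" unfolding strictly_convex_norm_def by blast
  then have "dg (\<chi> i. complex_of_real (e $ i)) = dg (\<chi> i. complex_of_real (f $ i))" unfolding D[symmetric] by simp
  then have "e $ i = f $ i" for i
    by (metis dg_nth of_real_eq_iff vec_lambda_beta)
  with ef(1) show False by (simp add: vec_eq_iff)
qed

text \<open>A norming functional at the singular numbers of the midpoint \<open>z\<close>,
  transported by its decomposition, is 1 at \<open>z\<close> and at most 1 at \<open>x\<close> and
  \<open>y\<close>, hence 1 at both. The equality case then gives \<open>x\<close>, \<open>y\<close>
  and \<open>z\<close> the same Frobenius norm, and the parallelogram law yields
  \<open>x = y\<close>.\<close>

lemma strictly_convex_Phi_imp_N:
  assumes strict: "strictly_convex_norm \<Phi>"
  shows "strictly_convex_norm N"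
  unfolding strictly_convex_norm_def
proof clarify
  fix x y assume xy: "x \<noteq> y" "closed_segment x y \<subseteq> {z. N z = 1}"
  define z where "z = (1 / 2) *\<^sub>R (x + y)"
  have "z = (1 - 1 / 2) *\<^sub>R x + (1 / 2) *\<^sub>R y" by (simp add: z_def scaleR_right_distrib)
  then have "z \<in> closed_segment x y" unfolding in_segment by (intro exI[of _ "1 / 2"]) simp
  with xy(2) have N1: "N x = 1" "N y = 1" "N z = 1" by auto
  obtain p q d where pq: "p \<in> unitary_group" "q \<in> unitary_group" "\<And>i. 0 \<le> d $ i"
    "emb z = p ** dg (\<chi> i. complex_of_real (d $ i)) ** q" "N z = \<Phi> d" "norm z = norm d" by (rule emb_svd[of z]) blast
  have d: "\<Phi> d = 1" "d \<noteq> 0" using pq(5) N1(3) Phi_eq_0[of d] by auto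
  then obtain n where n: "norming n d" using norming_exists[OF pq(3)] by blast
  define T where "T m = (\<Sum>i\<in>UNIV. n $ i * Re ((adj p ** m ** adj q) $ i $ i))" for m
  have T_le: "T (emb m) \<le> dual_norm n (emb m)" for m
    unfolding T_def by (intro weighted_trace_le_dual_norm unitary_adj pq)
  have "adj p ** emb z ** adj q = dg (\<chi> i. complex_of_real (d $ i))"
    unfolding pq(4) by (simp add: matrix_mul_assoc[symmetric] unitary_cancel[OF pq(1)] unitary_mult_adj[OF pq(2)])
  then have "T (emb z) = n \<bullet> d" by (simp add: T_def inner_vec_def)
  then have Tz: "T (emb z) = 1" using n d(1) by (simp add: norming_def)
  have "emb z = (1 / 2) *\<^sub>R (emb x + emb y)" by (simp add: z_def linear_scale[OF linear_emb] linear_add[OF linear_emb])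
  then have "T (emb z) = (T (emb x) + T (emb y)) / 2"
    by (simp add: T_def bounded_bilinear.add_left[OF bounded_bilinear_matrix_mult] bounded_bilinear.add_right[OF bounded_bilinear_matrix_mult]
        bounded_bilinear.scaleR_left[OF bounded_bilinear_matrix_mult] bounded_bilinear.scaleR_right[OF bounded_bilinear_matrix_mult]
        distrib_left sum.distrib sum_divide_distrib[symmetric] flip: add_divide_distrib)
  moreover have "dual_norm n (emb x) \<le> 1" "dual_norm n (emb y) \<le> 1"
    using dual_norm_le_N[OF n, of x] dual_norm_le_N[OF n, of y] N1 by auto
  ultimately have "dual_norm n (emb x) = N x" "dual_norm n (emb y) = N y"
    using Tz T_le[of x] T_le[of y] N1 by auto
  from dual_norm_eq_N[OF strict n d(2) this(1)] dual_norm_eq_N[OF strict n d(2) this(2)]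
  have eq: "norm x = norm z" "norm y = norm z" using N1 d(1) pq(6) by auto
  have "x + y = 2 *\<^sub>R z" by (simp add: z_def)
  then have "norm (x + y) = 2 * norm z" by simp
  moreover have "(norm (x - y))\<^sup>2 = 2 * (norm x)\<^sup>2 + 2 * (norm y)\<^sup>2 - (norm (x + y))\<^sup>2"
    by (simp add: power2_norm_eq_inner inner_add_left inner_add_right inner_diff_left inner_diff_right inner_commute)
  ultimately have "(norm (x - y))\<^sup>2 = 0" by (simp add: eq)
  with xy(1) show False by simp
qed

end

section \<open>Schatten norms\<close>

text \<open>Mean value theorem on both halves of the interval; the derivative
  \<open>p * z powr (p - 1)\<close> is strictly increasing.\<close>

lemma powr_midpoint_strict:
  fixes x y p :: real
  assumes p: "1 < p" and xy: "0 \<le> x" "x < y"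
  shows "((x + y) / 2) powr p < (x powr p + y powr p) / 2"
proof -
  define m where "m = (x + y) / 2"
  have "m - x = y - m" by (simp add: m_def field_simps)
  have m: "x < m" "m < y" using xy by (auto simp: m_def)
  have mvt: "\<exists>z. a < z \<and> z < b \<and> b powr p - a powr p = (b - a) * (p * z powr (p - 1))" if a0: "0 \<le> a" and ab: "a < b" for a b
  proof -
    have der: "((\<lambda>t. t powr p) has_real_derivative p * t powr (p - 1)) (at t)" if "0 < t" for t
      using has_real_derivative_powr[OF that] by simp
    have "continuous_on {a..b} (\<lambda>t. t powr p)"
      using a0 p by (intro continuous_on_powr' continuous_intros) auto
    moreover have "(\<lambda>t. t powr p) differentiable (at t)" if "a < t" "t < b" for t
      using der[of t] that a0 by (auto simp: real_differentiable_def)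
    ultimately obtain l z where z: "a < z" "z < b" "((\<lambda>t. t powr p) has_real_derivative l) (at z)" "b powr p - a powr p = (b - a) * l"
      using MVT[OF ab, of "\<lambda>t. t powr p"] by blast
    then have "l = p * z powr (p - 1)" using DERIV_unique[OF z(3) der[of z]] a0 by simp
    with z show ?thesis by blast
  qed
  obtain z1 where z1: "x < z1" "z1 < m" "m powr p - x powr p = (m - x) * (p * z1 powr (p - 1))" using mvt[OF xy(1) m(1)] by blast
  obtain z2 where z2: "m < z2" "z2 < y" "y powr p - m powr p = (y - m) * (p * z2 powr (p - 1))" using mvt[of m y] m xy by auto
  have "z1 powr (p - 1) < z2 powr (p - 1)" using z1 z2 xy p by (intro powr_less_mono2) auto
  then have "(m - x) * (p * z1 powr (p - 1)) < (y - m) * (p * z2 powr (p - 1))"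
    unfolding \<open>m - x = y - m\<close> using m(2) p by (intro mult_strict_left_mono) auto
  then show ?thesis using z1(3) z2(3) by (simp add: m_def[symmetric] field_simps)
qed

lemma abs_powr_midpoint_strict:
  fixes x y p :: real
  assumes p: "1 < p" and xy: "x \<noteq> y"
  shows "\<bar>(x + y) / 2\<bar> powr p < (\<bar>x\<bar> powr p + \<bar>y\<bar> powr p) / 2"
proof (cases "\<bar>x\<bar> = \<bar>y\<bar>")
  case True
  with xy have "y = - x" "x \<noteq> 0" by (auto simp: abs_if split: if_splits)
  then show ?thesis by simp
next
  case False
  have "\<bar>(x + y) / 2\<bar> powr p \<le> ((\<bar>x\<bar> + \<bar>y\<bar>) / 2) powr p" using p by (intro powr_mono2) auto
  also have "\<dots> < (\<bar>x\<bar> powr p + \<bar>y\<bar> powr p) / 2"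
    using powr_midpoint_strict[OF p, of "\<bar>x\<bar>" "\<bar>y\<bar>"] powr_midpoint_strict[OF p, of "\<bar>y\<bar>" "\<bar>x\<bar>"] False
    by (cases "\<bar>x\<bar> < \<bar>y\<bar>") (auto simp: add.commute)
  finally show ?thesis .
qed

text \<open>On the unit sphere the p-th powers of the coordinates sum to 1; strict convexity in a
  coordinate where \<open>x\<close> and \<open>y\<close> differ pushes their midpoint
  inside.\<close>

lemma (in symmetric_gauge) strictly_convex_lp:
  assumes p: "1 < p" and lp: "\<And>d. (\<And>i. 0 \<le> d $ i) \<Longrightarrow> \<Phi> d = (\<Sum>i\<in>UNIV. d $ i powr p) powr (1 / p)"
  shows "strictly_convex_norm \<Phi>"
  unfolding strictly_convex_norm_def
proof clarify
  fix x y :: "real^'n" assume xy: "x \<noteq> y" "closed_segment x y \<subseteq> {z. \<Phi> z = 1}"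
  define z where "z = (1 / 2) *\<^sub>R (x + y)"
  have "z = (1 - 1 / 2) *\<^sub>R x + (1 / 2) *\<^sub>R y" by (simp add: z_def scaleR_right_distrib)
  then have "z \<in> closed_segment x y" unfolding in_segment by (intro exI[of _ "1 / 2"]) simp
  with xy(2) have N1: "\<Phi> x = 1" "\<Phi> y = 1" "\<Phi> z = 1" by auto
  have sum1: "(\<Sum>i\<in>UNIV. \<bar>w $ i\<bar> powr p) = 1" if "\<Phi> w = 1" for w
  proof -
    have "(\<Sum>i\<in>UNIV. \<bar>w $ i\<bar> powr p) powr (1 / p) = 1"
      using lp[of "\<chi> i. \<bar>w $ i\<bar>"] that by (simp add: Phi_abs)
    then have "((\<Sum>i\<in>UNIV. \<bar>w $ i\<bar> powr p) powr (1 / p)) powr p = 1" by simp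
    then show ?thesis using p by (simp add: powr_powr sum_nonneg)
  qed
  obtain k where k: "x $ k \<noteq> y $ k" using xy(1) by (auto simp: vec_eq_iff)
  have "(\<Sum>i\<in>UNIV. \<bar>z $ i\<bar> powr p) < (\<Sum>i\<in>UNIV. (\<bar>x $ i\<bar> powr p + \<bar>y $ i\<bar> powr p) / 2)"
  proof (rule sum_strict_mono_ex1)
    show "\<forall>i\<in>UNIV. \<bar>z $ i\<bar> powr p \<le> (\<bar>x $ i\<bar> powr p + \<bar>y $ i\<bar> powr p) / 2"
    proof
      fix i show "\<bar>z $ i\<bar> powr p \<le> (\<bar>x $ i\<bar> powr p + \<bar>y $ i\<bar> powr p) / 2"
        using abs_powr_midpoint_strict[OF p, of "x $ i" "y $ i"] by (cases "x $ i = y $ i") (auto simp: z_def)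
    qed
    show "\<exists>i\<in>UNIV. \<bar>z $ i\<bar> powr p < (\<bar>x $ i\<bar> powr p + \<bar>y $ i\<bar> powr p) / 2"
      using abs_powr_midpoint_strict[OF p k] by (intro bexI[of _ k]) (auto simp: z_def)
  qed simp
  then show False using sum1 N1 by (simp add: sum_divide_distrib[symmetric] sum.distrib)
qed

text \<open>An angle of modulus \<pi> makes a diagonal entry of
  \<open>cis_diag \<theta> + mat 1\<close> vanish, which contradicts the invertibility of
  \<open>g - mat (-1)\<close>.\<close>

lemma angles_less_pi:
  assumes ang: "angles g w \<theta>" and spec: "-1 \<notin> matrix_spectrum g"
  shows "\<bar>\<theta> $ i\<bar> < pi"
proof (rule ccontr)
  assume "\<not> \<bar>\<theta> $ i\<bar> < pi"
  with ang have "\<bar>\<theta> $ i\<bar> = pi" by (auto simp: angles_def intro: antisym)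
  then have "\<theta> $ i = pi \<or> \<theta> $ i = - pi" by linarith
  then have cis: "cis (\<theta> $ i) = -1" by (auto simp: complex_eq_iff)
  have w: "w \<in> unitary_group" and g: "g = w ** cis_diag \<theta> ** adj w" using ang by (auto simp: angles_def)
  have "g - mat (-1) = w ** (cis_diag \<theta> + mat 1) ** adj w"
    by (simp add: g bounded_bilinear.add_left[OF bounded_bilinear_matrix_mult] bounded_bilinear.add_right[OF bounded_bilinear_matrix_mult]
        unitary_mult_adj[OF w]) (simp add: vec_eq_iff mat_def)
  moreover obtain b where "(g - mat (-1)) ** b = mat 1"
    using spec by (auto simp: matrix_spectrum_def invertible_def)
  ultimately have "adj w ** (w ** ((cis_diag \<theta> + mat 1) ** (adj w ** b))) ** w = adj w ** w"
    by (simp add: matrix_mul_assoc)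
  then have "(cis_diag \<theta> + mat 1) ** (adj w ** b) ** w = mat 1"
    by (simp add: unitary_cancel[OF w] unitary_adj_mult[OF w])
  moreover have "cis_diag \<theta> + mat 1 = dg (\<chi> i. cis (\<theta> $ i) + 1)"
    by (simp add: vec_eq_iff cis_diag_def mat_def)
  ultimately have "(dg (\<chi> i. cis (\<theta> $ i) + 1) ** (adj w ** b ** w)) $ i $ i = 1"
    by (simp add: matrix_mul_assoc mat_def)
  then show False by (simp add: dg_mult_nth cis)
qed

context invariant_norm_group
begin

lemma strictly_convex_schatten:
  assumes p: "1 < p" and N: "N = schatten_norm p \<circ> emb"
  shows "strictly_convex_norm N"
proof (rule strictly_convex_Phi_imp_N, rule strictly_convex_lp[OF p])
  fix d :: "real^'n" assume d: "\<And>i. 0 \<le> d $ i"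
  obtain x where x: "emb x = dg (\<chi> i. complex_of_real (d $ i))" using emb_diag by blast
  have "N x = \<Phi> d" by (rule N_svd[OF unitary_mat_1 unitary_mat_1 d]) (simp add: x)
  moreover have "emb x = diag d" by (simp add: x vec_eq_iff diag_def)
  ultimately show "\<Phi> d = (\<Sum>i\<in>UNIV. d $ i powr p) powr (1 / p)" by (simp add: N schatten_norm_diag[OF d])
qed

theorem geodesics_characterization:
  "(\<forall>u\<in>G. \<forall>x\<in>L. geodesic G N UNIV (\<lambda>t. u ** matrix_exp (t *\<^sub>R x))) \<and>
   (strictly_convex_norm N \<longrightarrow>
      (\<forall>I \<gamma>. geodesic G N I \<gamma> \<longrightarrow>
         (\<exists>u\<in>G. \<exists>x\<in>L. \<exists>\<phi>. continuous_on I \<phi> \<and> mono_on I \<phi> \<and> (\<forall>t\<in>I. \<gamma> t = u ** matrix_exp (\<phi> t *\<^sub>R x))))) \<and>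
   ((\<exists>p>1. N = schatten_norm p \<circ> emb) \<longrightarrow> strictly_convex_norm N) \<and>
   (strictly_convex_norm N \<longrightarrow>
      (\<forall>u\<in>G. \<forall>v\<in>G. -1 \<notin> matrix_spectrum (emb (matrix_inv u ** v)) \<longrightarrow>
         (\<exists>a b \<gamma>. shortest_curve G N u v a b \<gamma>) \<and>
         (\<forall>a b \<gamma> c d \<eta>. shortest_curve G N u v a b \<gamma> \<and> shortest_curve G N u v c d \<eta> \<longrightarrow>
            same_up_to_parameter a b \<gamma> c d \<eta>)))"
proof (intro conjI impI)
  show "\<forall>u\<in>G. \<forall>x\<in>L. geodesic G N UNIV (\<lambda>t. u ** matrix_exp (t *\<^sub>R x))" using exp_curve_geodesic by blast
  show "\<forall>I \<gamma>. geodesic G N I \<gamma> \<longrightarrow>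
      (\<exists>u\<in>G. \<exists>x\<in>L. \<exists>\<phi>. continuous_on I \<phi> \<and> mono_on I \<phi> \<and> (\<forall>t\<in>I. \<gamma> t = u ** matrix_exp (\<phi> t *\<^sub>R x)))"
    if "strictly_convex_norm N"
    using geodesic_form[OF strictly_convex_N_imp_Phi[OF that]] by blast
  show "strictly_convex_norm N" if "\<exists>p>1. N = schatten_norm p \<circ> emb" using that strictly_convex_schatten by blast
  show "\<forall>u\<in>G. \<forall>v\<in>G. -1 \<notin> matrix_spectrum (emb (matrix_inv u ** v)) \<longrightarrow>
         (\<exists>a b \<gamma>. shortest_curve G N u v a b \<gamma>) \<and>
         (\<forall>a b \<gamma> c d \<eta>. shortest_curve G N u v a b \<gamma> \<and> shortest_curve G N u v c d \<eta> \<longrightarrow>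
            same_up_to_parameter a b \<gamma> c d \<eta>)"
    if strict: "strictly_convex_norm N"
  proof (intro ballI impI)
    fix u v assume uv: "u \<in> G" "v \<in> G" and spec: "-1 \<notin> matrix_spectrum (emb (matrix_inv u ** v))"
    have "matrix_inv u ** v \<in> G" by (intro G_mult G_inv uv)
    then obtain w \<theta> where ang: "angles (emb (matrix_inv u ** v)) w \<theta>" using angles_exist[OF G_unitary] by blast
    have \<theta>: "\<And>i. \<bar>\<theta> $ i\<bar> < pi" using angles_less_pi[OF ang spec] .
    show "(\<exists>a b \<gamma>. shortest_curve G N u v a b \<gamma>) \<and>
         (\<forall>a b \<gamma> c d \<eta>. shortest_curve G N u v a b \<gamma> \<and> shortest_curve G N u v c d \<eta> \<longrightarrow>
            same_up_to_parameter a b \<gamma> c d \<eta>)"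
      using shortest_curve_exists[OF uv ang \<theta>] shortest_curve_unique[OF strictly_convex_N_imp_Phi[OF strict] ang \<theta>] by blast
  qed
qed

end

lemma matrix_inv_eq:
  assumes "a ** b = mat 1" "b ** a = mat 1"
  shows "matrix_inv a = b"
proof -
  have "a ** matrix_inv a = mat 1 \<and> matrix_inv a ** a = mat 1"
    unfolding matrix_inv_def by (rule someI[of _ b]) (simp add: assms)
  then have "matrix_inv a = (b ** a) ** matrix_inv a" "a ** matrix_inv a = mat 1" by (simp_all add: assms)
  then show ?thesis by (simp add: matrix_mul_assoc[symmetric])
qed

lemma is_norm_scaleR:
  fixes N :: "'a::real_normed_field^'n^'m \<Rightarrow> real"
  assumes "is_norm (\<lambda>c. map_matrix ((*) c)) N"
  shows "is_norm (*\<^sub>R) N"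
proof -
  have "r *\<^sub>R x = map_matrix ((*) (of_real r)) x" for r and x :: "'a^'n^'m"
    by (simp add: vec_eq_iff map_matrix_def scaleR_conv_of_real[where 'a = 'a])
  then show ?thesis using assms by (simp add: is_norm_def)
qed

lemma unitarily_invariant_norm_svd:
  fixes emb :: "'a::real_normed_field^'n^'n \<Rightarrow> complex^'n^'n"
  assumes "unitarily_invariant_norm G (\<lambda>x. singular_numbers (emb x)) N"
  obtains \<Phi> where "symmetric_norm \<Phi>"
    "\<And>p q d x. p \<in> unitary_group \<Longrightarrow> q \<in> unitary_group \<Longrightarrow> (\<And>i. 0 \<le> d $ i) \<Longrightarrow>
      emb x = p ** dg (\<chi> i. complex_of_real (d $ i)) ** q \<Longrightarrow> N x = \<Phi> d"
proof -
  obtain \<Phi> :: "real^'n \<Rightarrow> real" where \<Phi>: "symmetric_norm \<Phi>" "\<And>x s. image_mset (($) s) (mset_set UNIV) = singular_numbers (emb x) \<Longrightarrow> N x = \<Phi> s"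
    using assms unfolding unitarily_invariant_norm_def by blast
  show thesis
  proof (rule that[OF \<Phi>(1)])
    fix p q and d :: "real^'n" and x
    assume "p \<in> unitary_group" "q \<in> unitary_group" "\<And>i. 0 \<le> d $ i" "emb x = p ** dg (\<chi> i. complex_of_real (d $ i)) ** q"
    then show "N x = \<Phi> d" by (intro \<Phi>(2)) (simp add: singular_numbers_svd)
  qed
qed

section \<open>The unitary group\<close>

lemma matrix_inv_unitary: "u \<in> unitary_group \<Longrightarrow> matrix_inv u = adj u"
  by (intro matrix_inv_eq unitary_adj_mult unitary_mult_adj)

lemma invariant_norm_unitary_group:
  fixes N :: "complex^'n^'n \<Rightarrow> real"
  assumes N: "unitarily_invariant_norm unitary_group singular_numbers N"
  shows "\<exists>\<Phi>. invariant_norm_group \<Phi> (\<lambda>x. x) unitary_group skew_hermitian N"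
proof -
  obtain \<Phi> where \<Phi>: "symmetric_norm \<Phi>"
    "\<And>p q d x. p \<in> unitary_group \<Longrightarrow> q \<in> unitary_group \<Longrightarrow> (\<And>i. 0 \<le> d $ i) \<Longrightarrow>
      x = p ** dg (\<chi> i. complex_of_real (d $ i)) ** q \<Longrightarrow> N x = \<Phi> d"
    using unitarily_invariant_norm_svd[of unitary_group "\<lambda>x. x" N] N by auto
  have skew: "u ** imag_diag \<theta> ** adj u \<in> skew_hermitian" for u :: "complex^'n^'n" and \<theta>
  proof -
    have "adj (imag_diag \<theta>) = (- 1) *\<^sub>R imag_diag \<theta>" by (simp add: vec_eq_iff imag_diag_def)
    then show ?thesis
      by (simp add: skew_hermitian_def adj_mult matrix_mul_assoc[symmetric] bounded_bilinear.minus_left[OF bounded_bilinear_matrix_mult]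
          bounded_bilinear.minus_right[OF bounded_bilinear_matrix_mult])
  qed
  show ?thesis
  proof (rule exI[of _ \<Phi>], intro invariant_norm_group.intro invariant_norm_group_axioms.intro symmetric_gauge.intro)
    show "symmetric_norm \<Phi>" by (rule \<Phi>(1))
    show "linear (\<lambda>x :: complex^'n^'n. x)" by (rule linear_ident)
    show "is_norm (*\<^sub>R) N" using N by (intro is_norm_scaleR) (simp add: unitarily_invariant_norm_def)
    show "matrix_exp x \<in> unitary_group" if "x \<in> skew_hermitian" for x :: "complex^'n^'n"
    proof -
      obtain u \<theta> where u: "u \<in> unitary_group" "x = u ** imag_diag \<theta> ** adj u"
        using skew_hermitian_spectral[of x] \<open>x \<in> skew_hermitian\<close> by (auto simp: skew_hermitian_def)
      show ?thesis unfolding u(2) matrix_exp_imag_diag[OF u(1)]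
        by (intro unitary_mult unitary_adj unitary_cis_diag u(1))
    qed
    show "0 \<in> (skew_hermitian :: (complex^'n^'n) set)" by (simp add: skew_hermitian_def vec_eq_iff)
    show "N x = \<Phi> d" if "p \<in> unitary_group" "q \<in> unitary_group" "\<And>i. 0 \<le> d $ i"
        "x = p ** dg (\<chi> i. complex_of_real (d $ i)) ** q" for p q d x
      using \<Phi>(2)[OF that] .
    show "\<exists>x\<in>skew_hermitian. x = u ** imag_diag \<theta> ** adj u" for u :: "complex^'n^'n" and \<theta> using skew by blast
  qed (auto simp: unitary_mat_1 unitary_mult unitary_adj matrix_inv_unitary unitary_adj_mult unitary_mult_adj
      skew_hermitian_def adj_scaleR)
qed

section \<open>The special orthogonal group\<close>

lemma complexify_nth [simp]: "complexify x $ i $ j = complex_of_real (x $ i $ j)"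
  by (simp add: complexify_def map_matrix_def)

lemma linear_complexify: "linear (complexify :: real^'n^'m \<Rightarrow> _)"
  by (rule linearI) (simp_all add: vec_eq_iff scaleR_conv_of_real[where 'a = complex])

lemma norm_complexify: "norm (complexify x) = norm x"
  by (simp add: norm_vec_def)

lemma complexify_inject: "complexify x = complexify y \<longleftrightarrow> x = y"
  by (simp add: vec_eq_iff)

lemma complexify_mult: "complexify (x ** y) = complexify x ** complexify y"
  by (simp add: vec_eq_iff matrix_matrix_mult_def)

lemma complexify_mat_1: "complexify (mat 1) = mat 1"
  by (simp add: vec_eq_iff mat_def)

lemma adj_complexify: "adj (complexify x) = complexify (transpose x)"
  by (simp add: vec_eq_iff transpose_def)

lemma complexify_minus: "complexify (- x) = - complexify x"
  by (simp add: vec_eq_iff)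

lemma orthogonal_matrix_complexify: "orthogonal_matrix x \<longleftrightarrow> complexify x \<in> unitary_group"
  unfolding orthogonal_matrix_def unitary_group_def mem_Collect_eq adj_complexify complexify_mult[symmetric]
    complexify_mat_1[symmetric] complexify_inject ..

lemma skew_symmetric_complexify: "x \<in> skew_symmetric \<longleftrightarrow> adj (complexify x) = - complexify x"
  by (simp add: skew_symmetric_def adj_complexify complexify_minus[symmetric] complexify_inject)

text \<open>The entrywise real part is bounded linear, so the real series converges; its
  complexification then has the limit \<open>s\<close>.\<close>

lemma complexify_sums:
  fixes f :: "nat \<Rightarrow> real^'n^'m"
  assumes "(\<lambda>k. complexify (f k)) sums s"
  shows "complexify (suminf f) = s"
proof -
  define R :: "complex^'n^'m \<Rightarrow> real^'n^'m" where "R m = (\<chi> i j. Re (m $ i $ j))" for m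
  have "linear R" by (rule linearI) (simp_all add: R_def vec_eq_iff)
  then have "bounded_linear R" by (simp add: linear_conv_bounded_linear)
  from bounded_linear.sums[OF this assms] have f: "f sums R s" by (simp add: R_def)
  have "bounded_linear (complexify :: real^'n^'m \<Rightarrow> _)" using linear_complexify by (simp add: linear_conv_bounded_linear)
  from bounded_linear.sums[OF this f] have "(\<lambda>k. complexify (f k)) sums complexify (R s)" .
  with assms have "complexify (R s) = s" by (rule sums_unique2[symmetric])
  then show ?thesis using sums_unique[OF f] by simp
qed

lemma complexify_matrix_exp:
  assumes u: "u \<in> unitary_group" and x: "complexify x = u ** dg c ** adj u"
  shows "complexify (matrix_exp x) = matrix_exp (complexify x)"
proof -
  have "complexify (matrix_pow x k) = matrix_pow (complexify x) k" for k
    by (induction k) (simp_all add: complexify_mat_1 complexify_mult)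
  then have "complexify (matrix_pow x k /\<^sub>R fact k) = matrix_pow (complexify x) k /\<^sub>R fact k" for k
    by (simp add: linear_scale[OF linear_complexify])
  then show ?thesis
    using matrix_exp_sums_unitary_diag[OF u, of c] unfolding matrix_exp_def[of x]
    by (intro complexify_sums) (simp add: x matrix_exp_unitary_diag[OF u])
qed

lemma complexify_matrix_exp_imag_diag:
  assumes u: "u \<in> unitary_group" and x: "complexify x = u ** imag_diag \<theta> ** adj u"
  shows "complexify (matrix_exp x) = u ** cis_diag \<theta> ** adj u"
  using complexify_matrix_exp[OF u x[unfolded imag_diag_def]] by (simp add: x matrix_exp_imag_diag[OF u])

text \<open>The exponential of \<open>x\<close> is the square of the orthogonal matrix
  \<open>h\<close>, the exponential of x / 2, so its determinant is 1 whatever the sign of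
  \<open>det h\<close>.\<close>

lemma rotation_matrix_exp:
  assumes x: "x \<in> skew_symmetric"
  shows "rotation_matrix (matrix_exp x)"
proof -
  obtain u \<theta> where u: "u \<in> unitary_group" "complexify x = u ** imag_diag \<theta> ** adj u"
    using skew_hermitian_spectral[of "complexify x"] x by (auto simp: skew_symmetric_complexify)
  define h where "h = matrix_exp ((1 / 2) *\<^sub>R x)"
  have "complexify ((1 / 2) *\<^sub>R x) = u ** ((1 / 2) *\<^sub>R imag_diag \<theta>) ** adj u"
    by (simp add: linear_scale[OF linear_complexify] u(2) bounded_bilinear.scaleR_left[OF bounded_bilinear_matrix_mult]
        bounded_bilinear.scaleR_right[OF bounded_bilinear_matrix_mult])
  also have "(1 / 2) *\<^sub>R imag_diag \<theta> = imag_diag ((1 / 2) *\<^sub>R \<theta>)" by (simp add: vec_eq_iff imag_diag_def scaleR_conv_of_real[where 'a = complex])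
  finally have h: "complexify h = u ** cis_diag ((1 / 2) *\<^sub>R \<theta>) ** adj u"
    unfolding h_def by (rule complexify_matrix_exp_imag_diag[OF u(1)])
  have oh: "orthogonal_matrix h" unfolding orthogonal_matrix_complexify h
    by (intro unitary_mult unitary_adj unitary_cis_diag u)
  have cc: "cis_diag ((1 / 2) *\<^sub>R \<theta>) ** cis_diag ((1 / 2) *\<^sub>R \<theta>) = cis_diag \<theta>" by (simp add: cis_diag_def dg_mult_dg cis_mult)
  have "complexify (h ** h) = u ** (cis_diag ((1 / 2) *\<^sub>R \<theta>) ** cis_diag ((1 / 2) *\<^sub>R \<theta>)) ** adj u"
    unfolding complexify_mult h by (simp add: matrix_mul_assoc[symmetric] unitary_cancel[OF u(1)])
  also have "\<dots> = complexify (matrix_exp x)" unfolding cc by (rule complexify_matrix_exp_imag_diag[OF u, symmetric])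
  finally have "matrix_exp x = h ** h" by (simp only: complexify_inject)
  moreover have "det h * det h = 1" using det_orthogonal_matrix[OF oh] by auto
  ultimately show ?thesis by (simp add: rotation_matrix_def orthogonal_matrix_mul[OF oh oh] det_mul)
qed

text \<open>Conjugating the diagonalisation of a real matrix exchanges \<open>\<theta>\<close> and \<open>- \<theta>\<close>, and the principal
  argument is odd away from the negative axis.\<close>

lemma real_logarithm:
  fixes g :: "real^'n^'n"
  assumes u: "u \<in> unitary_group" and \<theta>: "\<And>i. \<bar>\<theta> $ i\<bar> < pi" and g: "complexify g = u ** cis_diag \<theta> ** adj u"
  shows "\<exists>x\<in>skew_symmetric. complexify x = u ** imag_diag \<theta> ** adj u"
proof -
  define C :: "complex^'n^'n \<Rightarrow> complex^'n^'n" where "C m = map_matrix cnj m" for m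
  have C_nth: "C m $ i $ j = cnj (m $ i $ j)" for m i j by (simp add: C_def map_matrix_def)
  have C_mult: "C (m ** n) = C m ** C n" for m n by (simp add: vec_eq_iff C_nth matrix_matrix_mult_def)
  have C_adj: "C (adj m) = adj (C m)" for m by (simp add: vec_eq_iff C_nth)
  have C_dg: "C (dg c) = dg (\<chi> i. cnj (c $ i))" for c by (simp add: vec_eq_iff C_nth)
  have "C (mat 1) = mat 1" by (simp add: vec_eq_iff C_nth mat_def)
  then have Cu: "C u \<in> unitary_group"
    by (intro unitary_groupI) (simp add: C_adj[symmetric] C_mult[symmetric] unitary_adj_mult[OF u])
  define X where "X = u ** imag_diag \<theta> ** adj u"
  have Arg: "Arg (cis t) = t" if "\<bar>t\<bar> < pi" for t
    using that by (intro cis_Arg_unique) (auto simp: sgn_eq)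
  have f: "\<i> * complex_of_real (Arg (cis (\<theta> $ i))) = \<i> * complex_of_real (\<theta> $ i)"
    "\<i> * complex_of_real (Arg (cis (- \<theta> $ i))) = cnj (\<i> * complex_of_real (\<theta> $ i))" for i
    using \<theta>[of i] by (simp_all add: Arg)
  have "C (complexify g) = complexify g" by (simp add: vec_eq_iff C_nth)
  then have "u ** dg (\<chi> i. cis (\<theta> $ i)) ** adj u = C u ** dg (\<chi> i. cis (- \<theta> $ i)) ** adj (C u)"
    unfolding g by (simp add: C_mult C_adj cis_diag_def C_dg cis_cnj)
  \<comment> \<open>The same real matrix has two diagonalisations, conjugate to each other; applying
    i times the principal argument to both shows that \<open>X\<close> equals its own
    conjugate.\<close>
  from dg_functional_calculus[OF u Cu this, of "\<lambda>z. \<i> * complex_of_real (Arg z)"]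
  have "X = C u ** dg (\<chi> i. cnj (\<i> * complex_of_real (\<theta> $ i))) ** adj (C u)"
    by (simp only: f X_def imag_diag_def vec_lambda_beta)
  also have "\<dots> = C X" by (simp only: X_def imag_diag_def C_mult C_adj C_dg vec_lambda_beta)
  finally have "X = C X" .
  define x where "x = (\<chi> i j. Re (X $ i $ j))"
  have x: "complexify x = X"
  proof -
    have "X $ i $ j = cnj (X $ i $ j)" for i j using \<open>X = C X\<close> C_nth by metis
    then have "X $ i $ j \<in> \<real>" for i j using Reals_cnj_iff by metis
    then show ?thesis by (simp add: vec_eq_iff x_def of_real_Re)
  qed
  have "adj (imag_diag \<theta>) = - imag_diag \<theta>" by (simp add: vec_eq_iff imag_diag_def)
  then have "adj X = - X"
    by (simp add: X_def adj_mult matrix_mul_assoc[symmetric] bounded_bilinear.minus_left[OF bounded_bilinear_matrix_mult]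
        bounded_bilinear.minus_right[OF bounded_bilinear_matrix_mult])
  then have "x \<in> skew_symmetric" by (simp add: skew_symmetric_complexify x)
  with x X_def show ?thesis by blast
qed

lemma matrix_inv_orthogonal: "orthogonal_matrix u \<Longrightarrow> matrix_inv u = transpose u"
  by (intro matrix_inv_eq) (simp_all add: orthogonal_matrix_def)

lemma invariant_norm_special_orthogonal_group:
  fixes N :: "real^'n^'n \<Rightarrow> real"
  assumes N: "unitarily_invariant_norm special_orthogonal_group (singular_numbers \<circ> complexify) N"
  shows "\<exists>\<Phi>. invariant_norm_group \<Phi> complexify special_orthogonal_group skew_symmetric N"
proof -
  obtain \<Phi> where \<Phi>: "symmetric_norm \<Phi>"
    "\<And>p q d x. p \<in> unitary_group \<Longrightarrow> q \<in> unitary_group \<Longrightarrow> (\<And>i. 0 \<le> d $ i) \<Longrightarrow>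
      complexify x = p ** dg (\<chi> i. complex_of_real (d $ i)) ** q \<Longrightarrow> N x = \<Phi> d"
    using unitarily_invariant_norm_svd[of special_orthogonal_group complexify N] N by (auto simp: o_def)
  have SO: "orthogonal_matrix g" "det g = 1" if "g \<in> special_orthogonal_group" for g :: "real^'n^'n"
    using that by (auto simp: special_orthogonal_group_def rotation_matrix_def)
  show ?thesis
  proof (rule exI[of _ \<Phi>], intro invariant_norm_group.intro invariant_norm_group_axioms.intro symmetric_gauge.intro)
    show "\<exists>x. complexify x = dg (\<chi> i. complex_of_real (d $ i))" for d :: "real^'n"
      by (rule exI[of _ "\<chi> i j. if i = j then d $ i else 0"]) (simp add: vec_eq_iff)
    show "complexify (matrix_exp x) = matrix_exp (complexify x)" if "x \<in> skew_symmetric" for x :: "real^'n^'n"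
      using skew_hermitian_spectral[of "complexify x"] that complexify_matrix_exp unfolding skew_symmetric_complexify imag_diag_def
      by metis
    show "is_norm (*\<^sub>R) N" using N by (intro is_norm_scaleR) (simp add: unitarily_invariant_norm_def)
    show "N x = \<Phi> d" if "p \<in> unitary_group" "q \<in> unitary_group" "\<And>i. 0 \<le> d $ i"
        "complexify x = p ** dg (\<chi> i. complex_of_real (d $ i)) ** q" for p q d x
      using \<Phi>(2)[OF that] .
    show "\<exists>x\<in>skew_symmetric. complexify x = u ** imag_diag \<theta> ** adj u"
      if "u \<in> unitary_group" "\<And>i. \<bar>\<theta> $ i\<bar> < pi" "complexify g = u ** cis_diag \<theta> ** adj u" for u \<theta> and g :: "real^'n^'n"
      using real_logarithm[OF that] .
    show "g ** h \<in> special_orthogonal_group" if "g \<in> special_orthogonal_group" "h \<in> special_orthogonal_group" for g h :: "real^'n^'n"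
      using that by (simp add: special_orthogonal_group_def rotation_matrix_def orthogonal_matrix_mul det_mul)
    show "matrix_inv g \<in> special_orthogonal_group" if "g \<in> special_orthogonal_group" for g :: "real^'n^'n"
      using SO[OF that] by (simp add: matrix_inv_orthogonal special_orthogonal_group_def rotation_matrix_def)
    show "matrix_exp x \<in> special_orthogonal_group" if "x \<in> skew_symmetric" for x :: "real^'n^'n"
      using rotation_matrix_exp[OF that] by (simp add: special_orthogonal_group_def)
    show "r *\<^sub>R x \<in> skew_symmetric" if "x \<in> skew_symmetric" for r and x :: "real^'n^'n"
    proof -
      have "transpose (r *\<^sub>R x) = r *\<^sub>R transpose x" by (simp add: transpose_def vec_eq_iff)
      with that show ?thesis by (simp add: skew_symmetric_def)
    qed
    show "0 \<in> (skew_symmetric :: (real^'n^'n) set)" by (simp add: skew_symmetric_def transpose_def vec_eq_iff)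
    show "mat 1 \<in> (special_orthogonal_group :: (real^'n^'n) set)"
      by (simp add: special_orthogonal_group_def rotation_matrix_def orthogonal_matrix_id)
    show "matrix_inv g ** g = mat 1" "g ** matrix_inv g = mat 1" "complexify g \<in> unitary_group"
      if "g \<in> special_orthogonal_group" for g :: "real^'n^'n"
      using SO(1)[OF that] by (simp_all add: matrix_inv_orthogonal orthogonal_matrix_def orthogonal_matrix_complexify[symmetric])
  qed (simp_all add: \<Phi>(1) linear_complexify norm_complexify complexify_mult complexify_mat_1 skew_symmetric_complexify)
qed

theorem proposition6:
  fixes N\<^sub>U :: "complex^'n^'n \<Rightarrow> real" and N\<^sub>O :: "real^'n^'n \<Rightarrow> real"
  shows
   "(unitarily_invariant_norm unitary_group singular_numbers N\<^sub>U \<longrightarrow>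
      (\<forall>u\<in>unitary_group. \<forall>x\<in>skew_hermitian.
         geodesic unitary_group N\<^sub>U UNIV (\<lambda>t. u ** matrix_exp (t *\<^sub>R x))) \<and>
      (strictly_convex_norm N\<^sub>U \<longrightarrow>
         (\<forall>I \<gamma>. geodesic unitary_group N\<^sub>U I \<gamma> \<longrightarrow>
            (\<exists>u\<in>unitary_group. \<exists>x\<in>skew_hermitian. \<exists>\<phi>.
               continuous_on I \<phi> \<and> mono_on I \<phi> \<and>
               (\<forall>t\<in>I. \<gamma> t = u ** matrix_exp (\<phi> t *\<^sub>R x))))) \<and>
      ((\<exists>p>1. N\<^sub>U = schatten_norm p) \<longrightarrow> strictly_convex_norm N\<^sub>U) \<and>
      (strictly_convex_norm N\<^sub>U \<longrightarrow>
         (\<forall>u\<in>unitary_group. \<forall>v\<in>unitary_group.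
            -1 \<notin> matrix_spectrum (matrix_inv u ** v) \<longrightarrow>
              (\<exists>a b \<gamma>. shortest_curve unitary_group N\<^sub>U u v a b \<gamma>) \<and>
              (\<forall>a b \<gamma> c d \<eta>.
                 shortest_curve unitary_group N\<^sub>U u v a b \<gamma> \<and>
                 shortest_curve unitary_group N\<^sub>U u v c d \<eta> \<longrightarrow>
                 same_up_to_parameter a b \<gamma> c d \<eta>)))) \<and>
    (unitarily_invariant_norm special_orthogonal_group (singular_numbers \<circ> complexify) N\<^sub>O \<longrightarrow>
      (\<forall>u\<in>special_orthogonal_group. \<forall>x\<in>skew_symmetric.
         geodesic special_orthogonal_group N\<^sub>O UNIV (\<lambda>t. u ** matrix_exp (t *\<^sub>R x))) \<and>
      (strictly_convex_norm N\<^sub>O \<longrightarrow>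
         (\<forall>I \<gamma>. geodesic special_orthogonal_group N\<^sub>O I \<gamma> \<longrightarrow>
            (\<exists>u\<in>special_orthogonal_group. \<exists>x\<in>skew_symmetric. \<exists>\<phi>.
               continuous_on I \<phi> \<and> mono_on I \<phi> \<and>
               (\<forall>t\<in>I. \<gamma> t = u ** matrix_exp (\<phi> t *\<^sub>R x))))) \<and>
      ((\<exists>p>1. N\<^sub>O = schatten_norm p \<circ> complexify) \<longrightarrow> strictly_convex_norm N\<^sub>O) \<and>
      (strictly_convex_norm N\<^sub>O \<longrightarrow>
         (\<forall>u\<in>special_orthogonal_group. \<forall>v\<in>special_orthogonal_group.
            -1 \<notin> matrix_spectrum (complexify (matrix_inv u ** v)) \<longrightarrow>
              (\<exists>a b \<gamma>. shortest_curve special_orthogonal_group N\<^sub>O u v a b \<gamma>) \<and>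
              (\<forall>a b \<gamma> c d \<eta>.
                 shortest_curve special_orthogonal_group N\<^sub>O u v a b \<gamma> \<and>
                 shortest_curve special_orthogonal_group N\<^sub>O u v c d \<eta> \<longrightarrow>
                 same_up_to_parameter a b \<gamma> c d \<eta>))))"
  (is "(?HU \<longrightarrow> ?U) \<and> (?HO \<longrightarrow> ?O)")
proof (intro conjI[of "_ \<longrightarrow> _"] impI)
  show ?U if ?HU
    using invariant_norm_unitary_group[OF that] invariant_norm_group.geodesics_characterization[where emb = "\<lambda>x. x"]
    unfolding o_def by (elim exE)
  show ?O if ?HO
    using invariant_norm_special_orthogonal_group[OF that] invariant_norm_group.geodesics_characterization by (elim exE)
qed

end
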